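(* Let $K$ be a knot with minimal crossing number $c(K)$ and minimal polygon index $s(K)$. Then $$c(K) \le \frac{\bigl(s(K)-3\bigr)\bigl(s(K)-4\bigr)}{2}.$$ Completing the square in this inequality shows that, with $c=c(K)$ and $s=s(K)$, $$2c \le s^2-7s+12=\Bigl(s-\frac{7}{2}\Bigr)^2-\frac14,$$ so that $$s(K) \ge \frac{7+\sqrt{8\,c(K)+1}}{2}.$$
   Context: Knots are closed embedded loops in $\mathbb{R}^3$, considered up to topological knot type. The minimal crossing number $c(K)$ of a knot $K$ is the smallest number of crossings present in any general position projection of the knot into a plane or sphere. The minimal polygon index $s(K)$ (also known as the stick number, broken line number, or edge number) is the smallest number of edges present in any polygonal embedding of the knot in $\mathbb{R}^3$, that is, in any closed loop of straight line segments without self-intersections that realizes the topological knot type of $K$.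
   Formalization: The final inequality s(K) ≥ (7+√(8c(K)+1))/2 is stated only for nontrivial knots, since it fails for the unknot (c = 0, s = 3 would give 3 ≥ 4); K is assumed tame, so that s(K) exists. *)

theory Defs
  imports "HOL-Analysis.Analysis"
begin

type_synonym space = "real ^ 3"


subsection \<open>Knots and topological knot type\<close>

definition closed_loop :: "(real \<Rightarrow> space) \<Rightarrow> bool" where
  "closed_loop g \<longleftrightarrow> simple_path g \<and> pathfinish g = pathstart g"

definition knot :: "space set \<Rightarrow> bool" where
  "knot K \<longleftrightarrow> (\<exists>g. closed_loop g \<and> path_image g = K)"

definition ambient_isotopic :: "space set \<Rightarrow> space set \<Rightarrow> bool" where
  "ambient_isotopic K K' \<longleftrightarrow>
     (\<exists>H :: real \<times> space \<Rightarrow> space.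
        continuous_on ({0..1} \<times> UNIV) H \<and>
        (\<forall>t\<in>{0..1}. \<exists>h. homeomorphism UNIV UNIV (\<lambda>x. H (t, x)) h) \<and>
        (\<forall>x. H (0, x) = x) \<and>
        (\<lambda>x. H (1, x)) ` K = K')"

definition trivial_knot :: "space set \<Rightarrow> bool" where
  "trivial_knot K \<longleftrightarrow> ambient_isotopic K {x. (x $ 1)\<^sup>2 + (x $ 2)\<^sup>2 = 1 \<and> x $ 3 = 0}"


subsection \<open>Minimal polygon index\<close>

text \<open>The vertices are \<open>v 0, \<dots>, v (n - 1)\<close>, closed up by \<open>v n = v 0\<close>.  The last
  clause lets adjacent edges meet only in their common vertex and keeps all other
  pairs of edges disjoint.  Consecutive edges may be collinear.\<close>

definition polygon_with_edges :: "nat \<Rightarrow> space set \<Rightarrow> bool" where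
  "polygon_with_edges n P \<longleftrightarrow>
     (\<exists>v :: nat \<Rightarrow> space.
        3 \<le> n \<and> inj_on v {..<n} \<and> v n = v 0 \<and>
        P = (\<Union>i<n. closed_segment (v i) (v (Suc i))) \<and>
        (\<forall>i<n. \<forall>j<n. i \<noteq> j \<longrightarrow>
           closed_segment (v i) (v (Suc i)) \<inter> closed_segment (v j) (v (Suc j))
             = {v i, v (Suc i)} \<inter> {v j, v (Suc j)}))"

definition polygonal_realization :: "space set \<Rightarrow> nat \<Rightarrow> bool" where
  "polygonal_realization K n \<longleftrightarrow> (\<exists>P. polygon_with_edges n P \<and> ambient_isotopic K P)"

definition tame :: "space set \<Rightarrow> bool" where
  "tame K \<longleftrightarrow> (\<exists>n. polygonal_realization K n)"

text \<open>Meaningful for tame \<open>K\<close>; a wild knot has no polygonal realization.\<close>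

definition polygon_index :: "space set \<Rightarrow> nat" where
  "polygon_index K = (LEAST n. polygonal_realization K n)"


subsection \<open>Minimal crossing number\<close>

text \<open>Orthogonal projection onto the plane through the origin with unit normal \<open>u\<close>, and
  radial projection onto a sphere about \<open>p\<close> (rescaled to the unit sphere about the
  origin).  Translating the plane or changing the radius does not affect crossings.\<close>

definition plane_projection :: "space \<Rightarrow> space \<Rightarrow> space" where
  "plane_projection u x = x - (x \<bullet> u) *\<^sub>R u"

definition sphere_projection :: "space \<Rightarrow> space \<Rightarrow> space" where
  "sphere_projection p x = sgn (x - p)"

definition admissible_projection :: "space set \<Rightarrow> (space \<Rightarrow> space) \<Rightarrow> bool" where
  "admissible_projection K \<pi> \<longleftrightarrow>
     (\<exists>u. norm u = 1 \<and> \<pi> = plane_projection u) \<or>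
     (\<exists>p. p \<notin> K \<and> \<pi> = sphere_projection p)"

definition crossings :: "(space \<Rightarrow> space) \<Rightarrow> space set \<Rightarrow> space set" where
  "crossings \<pi> K = {y. \<exists>x\<in>K. \<exists>x'\<in>K. x \<noteq> x' \<and> \<pi> x = y \<and> \<pi> x' = y}"

text \<open>General position: finitely many multiple points, all of them transverse double
  points.  Transversality means that the two projected strands have linearly independent
  velocities.  The base point \<open>g 0 = g 1\<close> must not lie over a crossing, so that these
  velocities are two-sided derivatives; this only restricts the parametrization.
  Note that \<open>card\<close> of an infinite fibre is 0, so such fibres are excluded.\<close>

definition general_position :: "(space \<Rightarrow> space) \<Rightarrow> (real \<Rightarrow> space) \<Rightarrow> bool" where
  "general_position \<pi> g \<longleftrightarrow>
     finite (crossings \<pi> (path_image g)) \<and>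
     (\<forall>y\<in>crossings \<pi> (path_image g). card {x \<in> path_image g. \<pi> x = y} = 2) \<and>
     (\<forall>s\<in>{0..1}. \<forall>t\<in>{0..1}. g s \<noteq> g t \<and> \<pi> (g s) = \<pi> (g t) \<longrightarrow>
        s \<in> {0<..<1} \<and> t \<in> {0<..<1} \<and>
        (\<exists>d e. ((\<pi> \<circ> g) has_vector_derivative d) (at s) \<and>
               ((\<pi> \<circ> g) has_vector_derivative e) (at t) \<and>
               d \<noteq> e \<and> independent {d, e}))"

definition projection_with_crossings :: "space set \<Rightarrow> nat \<Rightarrow> bool" where
  "projection_with_crossings K n \<longleftrightarrow>
     (\<exists>g \<pi>. closed_loop g \<and> ambient_isotopic K (path_image g) \<and>
        admissible_projection (path_image g) \<pi> \<and> general_position \<pi> g \<and>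
        card (crossings \<pi> (path_image g)) = n)"

definition crossing_number :: "space set \<Rightarrow> nat" where
  "crossing_number K = (LEAST n. projection_with_crossings K n)"

end

theory Submission
  imports Defs
begin

text \<open>
  A polygon with \<open>s\<close> edges is projected radially from one of its vertices, \<open>v 0\<close>.  The two edges at \<open>v 0\<close> shrink to
  points, and the other \<open>s - 2\<close> edges become a chain of great circle arcs on the sphere.  For vertices in general
  position two such arcs cross at most once, and adjacent arcs do not cross.  This leaves at most
  \<open>(s - 2) (s - 3) / 2 - (s - 3) = (s - 3) (s - 4) / 2\<close> crossings.  But the ends of the chain have to be joined again,
  and a direct connection would add crossings.

  To join them at no cost, \<open>v 0\<close> is chosen to be a vertex farthest from the origin, so that all other vertices lie
  strictly below some plane through \<open>v 0\<close>, the horizon.  Close to \<open>v 0\<close> the corner is replaced by a detour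
  \<open>v (s - 1), b, t, a, v 1\<close>.  Seen from \<open>v 0\<close>, the edge from \<open>v 1\<close> to \<open>a\<close> continues the arc from \<open>v 2\<close> to \<open>v 1\<close> on the same
  great circle up to the horizon; likewise the edge from \<open>v (s - 1)\<close> to \<open>b\<close>.  The edges at \<open>t\<close> run above the horizon,
  where nothing else is.  As all arcs are below the horizon, each of them meets the great circle of \<open>v 1\<close> and \<open>v 2\<close> at
  most once, and so crosses at most one of the two arcs on it.  Hence the crossings are still counted by pairs of
  non-neighbouring great circles among the original \<open>s - 2\<close> ones (lemma \<open>card_weak_pairs\<close>).

  It remains to see that the knot type does not change and that the projection is in general position.  A small
  displacement of the vertices of a simple polygon is Lipschitz with a small constant with respect to the distance in
  space, so it extends to a contraction of space, and adding a contraction to the identity is an ambient isotopy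
  (\<open>polygon_vertex_perturbation\<close>).  Hence a continuous motion through simple polygons preserves the knot type.  The
  detour is created by moving single vertices across thin triangles (\<open>bend_first_edge\<close>).  General position is
  reached by choosing the vertices successively off finitely many planes (\<open>generic_polygon_perturbation\<close>); for a
  generic polygon all crossings are transverse double points and determined by the two edges involved
  (\<open>general_position_polygon_path\<close>, \<open>card_crossings_le\<close>).  All this comes together in \<open>polygon_diagram\<close>.

  The bound on \<open>s\<close> in terms of \<open>c\<close> follows by completing the square if \<open>s \<ge> 4\<close>.  If \<open>s = 3\<close>, the knot is a triangle and
  therefore trivial (\<open>triangle_trivial\<close>).
\<close>

section \<open>Ambient isotopy\<close>

lemma ambient_isotopic_trans:
  assumes "ambient_isotopic K L" "ambient_isotopic L M"
  shows "ambient_isotopic K M"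
proof -
  obtain H :: "real \<times> space \<Rightarrow> space" where H: "continuous_on ({0..1} \<times> UNIV) H"
    "\<And>t. t \<in> {0..1} \<Longrightarrow> \<exists>h. homeomorphism UNIV UNIV (\<lambda>x. H (t, x)) h"
    "\<And>x. H (0, x) = x" "(\<lambda>x. H (1, x)) ` K = L"
    using assms(1) unfolding ambient_isotopic_def by blast
  obtain G :: "real \<times> space \<Rightarrow> space" where G: "continuous_on ({0..1} \<times> UNIV) G"
    "\<And>t. t \<in> {0..1} \<Longrightarrow> \<exists>h. homeomorphism UNIV UNIV (\<lambda>x. G (t, x)) h"
    "\<And>x. G (0, x) = x" "(\<lambda>x. G (1, x)) ` L = M"
    using assms(2) unfolding ambient_isotopic_def by auto
  define F where "F = (\<lambda>z::real \<times> space. if fst z \<le> 1/2 then H (2 * fst z, snd z)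
      else G (2 * fst z - 1, H (1, snd z)))"
  have contH: "continuous_on ({0..1/2} \<times> UNIV) (\<lambda>z. H (2 * fst z, snd z))"
    by (rule continuous_on_compose2[OF H(1)]) (auto intro!: continuous_intros)
  have "continuous_on UNIV (\<lambda>x. H (1, x))"
    by (rule continuous_on_compose2[OF H(1)]) (auto intro!: continuous_intros)
  then have "continuous_on ({1/2..1} \<times> UNIV) (\<lambda>z::real \<times> space. H (1, snd z))"
    by (rule continuous_on_compose2) (auto intro!: continuous_intros)
  then have contG: "continuous_on ({1/2..1} \<times> UNIV) (\<lambda>z. G (2 * fst z - 1, H (1, snd z)))"
    by (intro continuous_on_compose2[OF G(1)]) (auto intro!: continuous_intros)
  have "continuous_on ({0..1/2} \<times> UNIV \<union> {1/2..1} \<times> UNIV) F"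
    unfolding F_def
  proof (rule continuous_on_cases[OF _ _ contH contG])
    show "\<forall>z. z \<in> {0..1/2} \<times> UNIV \<and> \<not> fst z \<le> 1/2 \<or> z \<in> {1/2..1} \<times> UNIV \<and> fst z \<le> 1/2 \<longrightarrow>
        H (2 * fst z, snd z) = G (2 * fst z - 1, H (1, snd z))"
    proof (intro allI impI)
      fix z :: "real \<times> space"
      assume "z \<in> {0..1/2} \<times> UNIV \<and> \<not> fst z \<le> 1/2 \<or> z \<in> {1/2..1} \<times> UNIV \<and> fst z \<le> 1/2"
      then have "2 * fst z = 1" by auto
      then show "H (2 * fst z, snd z) = G (2 * fst z - 1, H (1, snd z))"
        by (simp only: diff_self G(3))
    qed
  qed (auto intro!: closed_Times)
  moreover have "{0..1/2} \<times> UNIV \<union> {1/2..1} \<times> UNIV = {0..1::real} \<times> (UNIV :: space set)"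
    by auto
  ultimately have contF: "continuous_on ({0..1} \<times> UNIV) F"
    by simp
  have homeo: "\<exists>h. homeomorphism UNIV UNIV (\<lambda>x. F (t, x)) h" if t: "t \<in> {0..1}" for t
  proof (cases "t \<le> 1/2")
    case True
    then show ?thesis
      using H(2)[of "2 * t"] t by (simp add: F_def)
  next
    case False
    obtain h where h: "homeomorphism UNIV UNIV (\<lambda>x. H (1, x)) h"
      using H(2)[of 1] by auto
    obtain k where k: "homeomorphism UNIV UNIV (\<lambda>x. G (2 * t - 1, x)) k"
      using G(2)[of "2 * t - 1"] False t by auto
    show ?thesis
      using homeomorphism_compose[OF h k] False by (auto simp: F_def o_def)
  qed
  have "(\<lambda>x. F (1, x)) ` K = M"
    using H(4) G(4) by (auto simp: F_def image_image)
  then show ?thesis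
    unfolding ambient_isotopic_def using contF homeo H(3)
    by (intro exI[of _ F]) (auto simp: F_def)
qed

lemma ambient_isotopic_sym:
  assumes "ambient_isotopic K L"
  shows "ambient_isotopic L K"
proof -
  obtain H :: "real \<times> space \<Rightarrow> space" where H: "continuous_on ({0..1} \<times> UNIV) H"
    "\<And>t. t \<in> {0..1} \<Longrightarrow> \<exists>h. homeomorphism UNIV UNIV (\<lambda>x. H (t, x)) h"
    "\<And>x. H (0, x) = x" "(\<lambda>x. H (1, x)) ` K = L"
    using assms unfolding ambient_isotopic_def by blast
  obtain h where h: "homeomorphism UNIV UNIV (\<lambda>x. H (1, x)) h"
    using H(2)[of 1] by auto
  then have conth: "continuous_on UNIV h" and inv: "\<And>x. H (1, h x) = x" "\<And>x. h (H (1, x)) = x"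
    by (auto simp: homeomorphism_def)
  define G where "G = (\<lambda>z::real \<times> space. H (1 - fst z, h (snd z)))"
  have "continuous_on ({0..1} \<times> UNIV) (\<lambda>z::real \<times> space. h (snd z))"
    by (rule continuous_on_compose2[OF conth]) (auto intro!: continuous_intros)
  then have "continuous_on ({0..1} \<times> UNIV) G"
    unfolding G_def by (intro continuous_on_compose2[OF H(1)]) (auto intro!: continuous_intros)
  moreover have "\<exists>k. homeomorphism UNIV UNIV (\<lambda>x. G (t, x)) k" if t: "t \<in> {0..1}" for t
  proof -
    obtain k where k: "homeomorphism UNIV UNIV (\<lambda>x. H (1 - t, x)) k"
      using H(2)[of "1 - t"] t by auto
    show ?thesis
      using homeomorphism_compose[OF homeomorphism_symD[OF h] k] by (auto simp: G_def o_def)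
  qed
  moreover have "(\<lambda>x. G (1, x)) ` L = K"
    using H(4) by (auto simp: G_def H(3) inv image_image)
  ultimately show ?thesis
    unfolding ambient_isotopic_def by (intro exI[of _ G]) (auto simp: G_def inv)
qed

text \<open>The straight-line homotopy from the identity to \<open>x \<mapsto> x + F x\<close> consists of homeomorphisms:
  by Banach's fixed point theorem a contraction perturbs the identity to a bijection.\<close>

lemma ambient_isotopic_contraction_perturbation:
  fixes F :: "space \<Rightarrow> space"
  assumes L: "0 \<le> L" "L < 1" and lip: "\<And>x y. norm (F x - F y) \<le> L * norm (x - y)"
  shows "ambient_isotopic K ((\<lambda>x. x + F x) ` K)" and "inj (\<lambda>x. x + F x)"
proof -
  have contF: "continuous_on UNIV F"
    by (rule lipschitz_on_continuous_on[of L])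
      (auto simp: lipschitz_on_def dist_norm L lip)
  have tlip: "norm (t *\<^sub>R F x - t *\<^sub>R F y) \<le> L * norm (x - y)" if "t \<in> {0..1}" for t x y
  proof -
    have "norm (t *\<^sub>R F x - t *\<^sub>R F y) = t * norm (F x - F y)"
      using that by (simp add: scaleR_diff_right[symmetric])
    also have "\<dots> \<le> 1 * norm (F x - F y)"
      using that by (intro mult_right_mono) auto
    finally show ?thesis using lip[of x y] by simp
  qed
  have inj: "inj (\<lambda>x. x + t *\<^sub>R F x)" if t: "t \<in> {0..1}" for t
  proof (rule injI)
    fix x y assume "x + t *\<^sub>R F x = y + t *\<^sub>R F y"
    then have "x - y = t *\<^sub>R F y - t *\<^sub>R F x" by (simp add: algebra_simps)
    then have "norm (x - y) \<le> L * norm (x - y)"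
      using tlip[OF t, of y x] by (simp add: norm_minus_commute)
    then have "(1 - L) * norm (x - y) \<le> 0" by (simp add: algebra_simps)
    then show "x = y" using L by (simp add: mult_le_0_iff)
  qed
  have surj: "surj (\<lambda>x. x + t *\<^sub>R F x)" if t: "t \<in> {0..1}" for t
  proof (rule surjI)
    fix y
    have "\<exists>!x. y - t *\<^sub>R F x = x"
      using tlip[OF t] by (intro banach_fix_type[OF L]) (auto simp: dist_norm norm_minus_commute)
    then have "\<exists>x. x + t *\<^sub>R F x = y"
      by (metis diff_add_cancel)
    then show "(SOME x. x + t *\<^sub>R F x = y) + t *\<^sub>R F (SOME x. x + t *\<^sub>R F x = y) = y"
      by (rule someI_ex)
  qed
  have "\<exists>h. homeomorphism UNIV UNIV (\<lambda>x. x + t *\<^sub>R F x) h" if t: "t \<in> {0..1}" for t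
  proof -
    have "continuous_on UNIV (\<lambda>x. x + t *\<^sub>R F x)"
      by (intro continuous_intros contF)
    then show ?thesis
      by (metis invariance_of_domain_homeomorphism inj[OF t] surj[OF t] open_UNIV order_refl)
  qed
  moreover have "continuous_on ({0..1} \<times> UNIV) (\<lambda>z::real \<times> space. snd z + fst z *\<^sub>R F (snd z))"
    by (intro continuous_intros continuous_on_compose2[OF contF]) auto
  ultimately show "ambient_isotopic K ((\<lambda>x. x + F x) ` K)"
    unfolding ambient_isotopic_def
    by (intro exI[of _ "\<lambda>z. snd z + fst z *\<^sub>R F (snd z)"]) auto
  show "inj (\<lambda>x. x + F x)" using inj[of 1] by simp
qed

lemma ambient_isotopic_translation: "ambient_isotopic K ((+) c ` K)"
  using ambient_isotopic_contraction_perturbation(1)[of 0 "\<lambda>_. c" K]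
  by (simp add: add.commute)

text \<open>McShane's formula, applied to each of the three coordinates; hence the factor \<open>3\<close>.  The values
  are given along a parametrization \<open>g\<close>, as they are for a polygon; that they agree where \<open>g\<close> takes the
  same value twice follows from the Lipschitz bound.\<close>

lemma lipschitz_extension_space:
  fixes g f :: "'i \<Rightarrow> space"
  assumes "L \<ge> 0" and lip: "\<And>i j. i \<in> I \<Longrightarrow> j \<in> I \<Longrightarrow> norm (f i - f j) \<le> L * norm (g i - g j)"
    and "I \<noteq> {}"
  obtains F :: "space \<Rightarrow> space" where "\<And>i. i \<in> I \<Longrightarrow> F (g i) = f i"
    "\<And>x y. norm (F x - F y) \<le> 3 * L * norm (x - y)"
proof -
  define F where "F = (\<lambda>x. \<chi> k. INF i\<in>I. f i $ k + L * norm (x - g i))"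
  have comp: "\<bar>f i $ k - f j $ k\<bar> \<le> L * norm (g i - g j)" if "i \<in> I" "j \<in> I" for i j k
    using lip[OF that] component_le_norm_cart[of "f i - f j" k] by simp
  obtain i0 where i0: "i0 \<in> I" using \<open>I \<noteq> {}\<close> by auto
  have bdd: "bdd_below ((\<lambda>i. f i $ k + L * norm (x - g i)) ` I)" for x k
  proof (rule bdd_belowI2)
    fix i assume i: "i \<in> I"
    have "L * norm (g i0 - g i) \<le> L * (norm (x - g i) + norm (x - g i0))"
      using norm_triangle_ineq4[of "x - g i" "x - g i0"] by (intro mult_left_mono \<open>L \<ge> 0\<close>) simp
    then show "f i0 $ k - L * norm (x - g i0) \<le> f i $ k + L * norm (x - g i)"
      using comp[OF i0 i, of k] by (simp add: algebra_simps)
  qed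
  have ext: "F (g i) = f i" if i: "i \<in> I" for i
  proof (subst vec_eq_iff, intro allI)
    fix k
    have "(INF j\<in>I. f j $ k + L * norm (g i - g j)) \<le> f i $ k + L * norm (g i - g i)"
      by (rule cINF_lower[OF bdd i])
    moreover have "f i $ k \<le> (INF j\<in>I. f j $ k + L * norm (g i - g j))"
      using comp[OF i, of _ k] by (intro cINF_greatest \<open>I \<noteq> {}\<close>) (fastforce simp: abs_le_iff)
    ultimately show "F (g i) $ k = f i $ k" by (simp add: F_def)
  qed
  have half: "F x $ k \<le> F y $ k + L * norm (x - y)" for x y k
  proof -
    have "F x $ k - L * norm (x - y) \<le> (INF i\<in>I. f i $ k + L * norm (y - g i))"
    proof (rule cINF_greatest[OF \<open>I \<noteq> {}\<close>])
      fix i assume i: "i \<in> I"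
      have "F x $ k \<le> f i $ k + L * norm (x - g i)"
        unfolding F_def by (simp add: cINF_lower[OF bdd i])
      also have "L * norm (x - g i) \<le> L * (norm (x - y) + norm (y - g i))"
        using norm_triangle_ineq[of "x - y" "y - g i"] by (intro mult_left_mono \<open>L \<ge> 0\<close>) simp
      finally show "F x $ k - L * norm (x - y) \<le> f i $ k + L * norm (y - g i)"
        by (simp add: algebra_simps)
    qed
    then show ?thesis by (simp add: F_def)
  qed
  have "norm (F x - F y) \<le> 3 * L * norm (x - y)" for x y
  proof -
    have "norm (F x - F y) \<le> (\<Sum>k\<in>UNIV. \<bar>(F x - F y) $ k\<bar>)"
      by (rule norm_le_l1_cart)
    also have "\<dots> \<le> (\<Sum>k\<in>(UNIV::3 set). L * norm (x - y))"
    proof (rule sum_mono)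
      fix k :: 3
      show "\<bar>(F x - F y) $ k\<bar> \<le> L * norm (x - y)"
        using half[of x k y] half[of y k x] by (simp add: norm_minus_commute abs_le_iff)
    qed
    finally show ?thesis by simp
  qed
  with ext show ?thesis using that by blast
qed

section \<open>Simple polygons and their isotopies\<close>

definition edge :: "(nat \<Rightarrow> space) \<Rightarrow> nat \<Rightarrow> space set" where
  "edge v i = closed_segment (v i) (v (Suc i))"

definition edge_point :: "(nat \<Rightarrow> space) \<Rightarrow> nat \<Rightarrow> real \<Rightarrow> space" where
  "edge_point v i s = (1 - s) *\<^sub>R v i + s *\<^sub>R v (Suc i)"

definition polygon_set :: "nat \<Rightarrow> (nat \<Rightarrow> space) \<Rightarrow> space set" where
  "polygon_set n v = (\<Union>i<n. edge v i)"

definition simple_polygon :: "nat \<Rightarrow> (nat \<Rightarrow> space) \<Rightarrow> bool" where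
  "simple_polygon n v \<longleftrightarrow> 3 \<le> n \<and> inj_on v {..<n} \<and> v n = v 0 \<and>
     (\<forall>i<n. \<forall>j<n. i \<noteq> j \<longrightarrow> edge v i \<inter> edge v j = {v i, v (Suc i)} \<inter> {v j, v (Suc j)})"

lemma polygon_with_edges_iff:
  "polygon_with_edges n P \<longleftrightarrow> (\<exists>v. simple_polygon n v \<and> P = polygon_set n v)"
  unfolding polygon_with_edges_def simple_polygon_def polygon_set_def edge_def by blast

lemma edge_eq_image: "edge v i = edge_point v i ` {0..1}"
  by (auto simp: edge_def edge_point_def closed_segment_def)

lemma edge_point_mem: "s \<in> {0..1} \<Longrightarrow> edge_point v i s \<in> edge v i"
  by (auto simp: edge_eq_image)

lemma simple_polygonD:
  assumes "simple_polygon n v"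
  shows "3 \<le> n" "inj_on v {..<n}" "v n = v 0"
    "\<And>i j. i < n \<Longrightarrow> j < n \<Longrightarrow> i \<noteq> j \<Longrightarrow> edge v i \<inter> edge v j = {v i, v (Suc i)} \<inter> {v j, v (Suc j)}"
  using assms unfolding simple_polygon_def by auto

lemma simple_polygon_vertex_eq_iff:
  assumes "simple_polygon n v" "i < n" "j \<le> n"
  shows "v i = v j \<longleftrightarrow> i = j \<or> i = 0 \<and> j = n"
proof -
  have "inj_on v {..<n}" "v n = v 0" "n > 0"
    using simple_polygonD[OF assms(1)] by auto
  then show ?thesis
    using assms(2,3) by (cases "j = n") (auto simp: inj_on_eq_iff)
qed

lemma simple_polygon_Suc_eq_iff:
  assumes "simple_polygon n v" "i < n" "j < n"
  shows "v (Suc i) = v (Suc j) \<longleftrightarrow> i = j"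
proof -
  have n: "3 \<le> n" "v n = v 0" using simple_polygonD[OF assms(1)] by auto
  show ?thesis
  proof (cases "Suc i = n")
    case True
    then show ?thesis
      using simple_polygon_vertex_eq_iff[OF assms(1), of 0 "Suc j"] n assms by auto
  next
    case False
    then show ?thesis
      using simple_polygon_vertex_eq_iff[OF assms(1), of "Suc i" "Suc j"] n assms by auto
  qed
qed

lemma simple_polygon_edge_nontrivial:
  assumes "simple_polygon n v" "i < n"
  shows "v i \<noteq> v (Suc i)"
  using simple_polygon_vertex_eq_iff[OF assms, of "Suc i"] simple_polygonD(1)[OF assms(1)] assms(2)
  by auto

text \<open>Both sides of the inequality are homogeneous in \<open>s\<close> and \<open>t\<close>, and for \<open>s + t = 1\<close> the right-hand side is the
  distance of \<open>0\<close> from a point of the segment between \<open>a\<close> and \<open>- b\<close>, which does not contain \<open>0\<close>.\<close>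

lemma segments_at_corner_diverge:
  fixes a b :: "'a::euclidean_space"
  assumes "a \<noteq> 0" "b \<noteq> 0" and meet: "\<And>s t. s \<in> {0..1} \<Longrightarrow> t \<in> {0..1} \<Longrightarrow> s *\<^sub>R a = t *\<^sub>R b \<Longrightarrow> s = 0"
  obtains c where "c > 0" "\<And>s t. s \<ge> 0 \<Longrightarrow> t \<ge> 0 \<Longrightarrow> c * (s + t) \<le> norm (s *\<^sub>R a - t *\<^sub>R b)"
proof -
  have "0 \<notin> closed_segment a (- b)"
  proof
    assume "0 \<in> closed_segment a (- b)"
    then obtain u where u: "0 \<le> u" "u \<le> 1" "(1 - u) *\<^sub>R a = u *\<^sub>R b"
      by (auto simp: closed_segment_def)
    then have "1 - u = 0" using meet[of "1 - u" u] by auto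
    then show False using u \<open>b \<noteq> 0\<close> by auto
  qed
  then obtain c where c: "c > 0" "\<And>x. x \<in> closed_segment a (- b) \<Longrightarrow> c \<le> norm x"
    using separate_point_closed[of "closed_segment a (- b)" 0] closed_segment by (auto simp: dist_norm)
  have "c * (s + t) \<le> norm (s *\<^sub>R a - t *\<^sub>R b)" if st: "s \<ge> 0" "t \<ge> 0" for s t
  proof (cases "s + t = 0")
    case False
    then have pos: "s + t > 0" using st by auto
    define u where "u = t / (s + t)"
    have u: "0 \<le> u" "u \<le> 1" "1 - u = s / (s + t)" using st pos by (auto simp: u_def field_simps)
    have "(1 - u) *\<^sub>R a + u *\<^sub>R (- b) \<in> closed_segment a (- b)"
      using u by (auto simp: closed_segment_def intro!: exI[of _ u])
    then have "c \<le> norm ((1 - u) *\<^sub>R a + u *\<^sub>R (- b))" by (rule c(2))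
    moreover have "s *\<^sub>R a - t *\<^sub>R b = (s + t) *\<^sub>R ((1 - u) *\<^sub>R a + u *\<^sub>R (- b))"
      using pos unfolding u(3) by (simp add: u_def scaleR_diff_right)
    ultimately show ?thesis using pos by (simp add: mult.commute)
  qed (use st in auto)
  with c(1) show ?thesis using that by blast
qed

text \<open>Where one edge ends and the other begins, the displacements of two points differ by at most a
  multiple of their distances from the corner, and by the previous lemma these are bounded by a multiple
  of the distance between the points.\<close>

lemma edge_pair_lipschitz_at_corner:
  assumes v: "simple_polygon n v" and ij: "i < n" "j < n" "i \<noteq> j" and corner: "v (Suc i) = v j"
  shows "\<exists>M\<ge>0. \<forall>d \<delta>. d n = d 0 \<longrightarrow> (\<forall>k\<le>n. norm (d k) \<le> \<delta>) \<longrightarrow> (\<forall>s\<in>{0..1}. \<forall>t\<in>{0..1}.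
    norm (edge_point d i s - edge_point d j t) \<le> M * \<delta> * norm (edge_point v i s - edge_point v j t))"
proof -
  define a where "a = v i - v (Suc i)"
  define b where "b = v (Suc j) - v j"
  have nz: "a \<noteq> 0" "b \<noteq> 0"
    using simple_polygon_edge_nontrivial[OF v, of i] simple_polygon_edge_nontrivial[OF v, of j] ij
    by (auto simp: a_def b_def)
  have ep: "edge_point v i s = v j + (1 - s) *\<^sub>R a" "edge_point v j t = v j + t *\<^sub>R b" for s t
    using corner by (simp_all add: edge_point_def a_def b_def algebra_simps)
  have only: "edge v i \<inter> edge v j = {v j}"
  proof -
    have "v i \<noteq> v j" using simple_polygon_vertex_eq_iff[OF v, of i j] ij by auto
    moreover have "v i \<noteq> v (Suc j)"
    proof
      assume "v i = v (Suc j)"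
      then have "i = Suc j \<or> i = 0 \<and> Suc j = n"
        using simple_polygon_vertex_eq_iff[OF v, of i "Suc j"] ij by auto
      moreover have "j = Suc i \<or> j = 0 \<and> Suc i = n"
        using simple_polygon_vertex_eq_iff[OF v, of j "Suc i"] ij corner by auto
      ultimately show False using simple_polygonD(1)[OF v] by auto
    qed
    moreover have "v (Suc i) \<noteq> v (Suc j)"
      using simple_polygon_Suc_eq_iff[OF v] ij by auto
    ultimately show ?thesis
      using simple_polygonD(4)[OF v ij] corner by auto
  qed
  have "s = 0" if "s \<in> {0..1}" "t \<in> {0..1}" "s *\<^sub>R a = t *\<^sub>R b" for s t
  proof -
    have "edge_point v i (1 - s) = edge_point v j t" using that by (simp add: ep)
    then have "edge_point v i (1 - s) \<in> edge v i \<inter> edge v j"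
      using edge_point_mem[of "1 - s" v i] edge_point_mem[of t v j] that by auto
    then have "s *\<^sub>R a = 0" using only by (simp add: ep)
    then show "s = 0" using nz by simp
  qed
  then obtain c where c: "c > 0" "\<And>s t. s \<ge> 0 \<Longrightarrow> t \<ge> 0 \<Longrightarrow> c * (s + t) \<le> norm (s *\<^sub>R a - t *\<^sub>R b)"
    using segments_at_corner_diverge[OF nz] by blast
  have "norm (edge_point d i s - edge_point d j t) \<le> 2 / c * \<delta> * norm (edge_point v i s - edge_point v j t)"
    if d: "d n = d 0" "\<And>k. k \<le> n \<Longrightarrow> norm (d k) \<le> \<delta>" and st: "s \<in> {0..1}" "t \<in> {0..1}" for d \<delta> s t
  proof -
    have "\<delta> \<ge> 0" using d(2)[of 0] norm_ge_zero order_trans by blast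
    have "j = Suc i \<or> j = 0 \<and> Suc i = n"
      using simple_polygon_vertex_eq_iff[OF v, of j "Suc i"] ij corner by auto
    then have dj: "d (Suc i) = d j" using d(1) by auto
    have "edge_point d i s - edge_point d j t = (1 - s) *\<^sub>R (d i - d (Suc i)) - t *\<^sub>R (d (Suc j) - d j)"
      using dj by (simp add: edge_point_def algebra_simps)
    also have "norm \<dots> \<le> (1 - s) * norm (d i - d (Suc i)) + t * norm (d (Suc j) - d j)"
      using st norm_triangle_ineq4[of "(1 - s) *\<^sub>R (d i - d (Suc i))" "t *\<^sub>R (d (Suc j) - d j)"] by simp
    also have "\<dots> \<le> (1 - s) * (2 * \<delta>) + t * (2 * \<delta>)"
      using st norm_triangle_ineq4[of "d i" "d (Suc i)"] norm_triangle_ineq4[of "d (Suc j)" "d j"]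
        d(2)[of i] d(2)[of "Suc i"] d(2)[of j] d(2)[of "Suc j"] ij
      by (intro add_mono mult_left_mono) auto
    also have "\<dots> = 2 / c * \<delta> * (c * ((1 - s) + t))"
      using c(1) by (simp add: field_simps)
    also have "\<dots> \<le> 2 / c * \<delta> * norm ((1 - s) *\<^sub>R a - t *\<^sub>R b)"
      using c st \<open>\<delta> \<ge> 0\<close> by (intro mult_left_mono) auto
    finally show ?thesis by (simp add: ep)
  qed
  then show ?thesis using c(1) by (intro exI[of _ "2 / c"]) auto
qed

text \<open>Two edges of a simple polygon coincide, share a corner, or have a positive distance.  The constant
  must serve all displacements \<open>d\<close> of the vertices, because \<open>\<delta>\<close> is chosen in terms of it.\<close>

lemma edge_pair_lipschitz:
  assumes v: "simple_polygon n v" and ij: "i < n" "j < n"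
  shows "\<exists>M\<ge>0. \<forall>d \<delta>. d n = d 0 \<longrightarrow> (\<forall>k\<le>n. norm (d k) \<le> \<delta>) \<longrightarrow> (\<forall>s\<in>{0..1}. \<forall>t\<in>{0..1}.
    norm (edge_point d i s - edge_point d j t) \<le> M * \<delta> * norm (edge_point v i s - edge_point v j t))"
proof (cases "i = j")
  case True
  define m where "m = norm (v (Suc i) - v i)"
  have m: "m > 0" using simple_polygon_edge_nontrivial[OF v ij(1)] by (simp add: m_def)
  have diff: "edge_point w i s - edge_point w i t = (s - t) *\<^sub>R (w (Suc i) - w i)" for w s t
    by (simp add: edge_point_def algebra_simps)
  have "norm (edge_point d i s - edge_point d i t) \<le> 2 / m * \<delta> * norm (edge_point v i s - edge_point v i t)"
    if d: "\<And>k. k \<le> n \<Longrightarrow> norm (d k) \<le> \<delta>" for d \<delta> s t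
  proof -
    have "norm (d (Suc i) - d i) \<le> 2 * \<delta>"
      using norm_triangle_ineq4[of "d (Suc i)" "d i"] d[of i] d[of "Suc i"] ij by auto
    then have "\<bar>s - t\<bar> * norm (d (Suc i) - d i) \<le> \<bar>s - t\<bar> * (2 * \<delta>)"
      by (intro mult_left_mono) auto
    then show ?thesis
      using m unfolding diff norm_scaleR m_def[symmetric] by (simp add: field_simps)
  qed
  then show ?thesis using m True by (intro exI[of _ "2 / m"]) auto
next
  case False
  consider "v (Suc i) = v j" | "v i = v (Suc j)" | "v (Suc i) \<noteq> v j" "v i \<noteq> v (Suc j)" by blast
  then show ?thesis
  proof cases
    case 1
    then show ?thesis by (rule edge_pair_lipschitz_at_corner[OF v ij False])
  next
    case 2
    then obtain M where "M \<ge> 0" "\<forall>d \<delta>. d n = d 0 \<longrightarrow> (\<forall>k\<le>n. norm (d k) \<le> \<delta>) \<longrightarrow> (\<forall>s\<in>{0..1}. \<forall>t\<in>{0..1}.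
        norm (edge_point d j s - edge_point d i t) \<le> M * \<delta> * norm (edge_point v j s - edge_point v i t))"
      using edge_pair_lipschitz_at_corner[OF v ij(2,1)] False by metis
    then show ?thesis
      by (intro exI[of _ M] conjI allI impI ballI) (auto simp: norm_minus_commute)
  next
    case 3
    have "v i \<noteq> v j" "v (Suc i) \<noteq> v (Suc j)"
      using simple_polygon_vertex_eq_iff[OF v ij(1), of j] simple_polygon_Suc_eq_iff[OF v ij] ij False
      by auto
    with 3 have "edge v i \<inter> edge v j = {}"
      using simple_polygonD(4)[OF v ij False] by auto
    moreover have "compact (edge v i)" "closed (edge v j)"
      by (auto simp: edge_def)
    ultimately obtain m where m: "m > 0" "\<And>x y. x \<in> edge v i \<Longrightarrow> y \<in> edge v j \<Longrightarrow> m \<le> dist x y"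
      using separate_compact_closed by metis
    have "norm (edge_point d i s - edge_point d j t) \<le> 2 / m * \<delta> * norm (edge_point v i s - edge_point v j t)"
      if d: "\<And>k. k \<le> n \<Longrightarrow> norm (d k) \<le> \<delta>" and st: "s \<in> {0..1}" "t \<in> {0..1}" for d \<delta> s t
    proof -
      have "\<delta> \<ge> 0" using d[of 0] norm_ge_zero order_trans by blast
      have small: "norm (edge_point d k r) \<le> \<delta>" if "k < n" "r \<in> {0..1}" for k r
      proof -
        have "edge_point d k r \<in> closed_segment (d k) (d (Suc k))"
          using edge_point_mem[OF that(2)] by (simp add: edge_def)
        moreover have "closed_segment (d k) (d (Suc k)) \<subseteq> cball 0 \<delta>"
          using d[of k] d[of "Suc k"] that by (intro closed_segment_subset) auto
        ultimately show ?thesis by auto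
      qed
      have "norm (edge_point d i s - edge_point d j t) \<le> 2 * \<delta>"
        using norm_triangle_ineq4[of "edge_point d i s" "edge_point d j t"]
          small[OF ij(1) st(1)] small[OF ij(2) st(2)] by linarith
      also have "\<dots> = 2 / m * \<delta> * m" using m by simp
      also have "\<dots> \<le> 2 / m * \<delta> * norm (edge_point v i s - edge_point v j t)"
        using m(1) m(2)[OF edge_point_mem[OF st(1)] edge_point_mem[OF st(2)]] \<open>\<delta> \<ge> 0\<close>
        by (intro mult_left_mono) (auto simp: dist_norm)
      finally show ?thesis .
    qed
    then show ?thesis using m(1) by (intro exI[of _ "2 / m"]) auto
  qed
qed

lemma polygon_displacement_lipschitz:
  assumes v: "simple_polygon n v"
  shows "\<exists>M\<ge>0. \<forall>d \<delta>. d n = d 0 \<longrightarrow> (\<forall>k\<le>n. norm (d k) \<le> \<delta>) \<longrightarrow>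
    (\<forall>i<n. \<forall>j<n. \<forall>s\<in>{0..1}. \<forall>t\<in>{0..1}.
    norm (edge_point d i s - edge_point d j t) \<le> M * \<delta> * norm (edge_point v i s - edge_point v j t))"
proof -
  define Q where "Q = (\<lambda>p M. \<forall>d \<delta>. d n = d 0 \<longrightarrow> (\<forall>k\<le>n. norm (d k) \<le> \<delta>) \<longrightarrow> (\<forall>s\<in>{0..1}. \<forall>t\<in>{0..1}.
    norm (edge_point d (fst p) s - edge_point d (snd p) t)
      \<le> M * \<delta> * norm (edge_point v (fst p) s - edge_point v (snd p) t)))"
  have "\<forall>p\<in>{..<n} \<times> {..<n}. \<exists>M. M \<ge> 0 \<and> Q p M"
    using edge_pair_lipschitz[OF v] unfolding Q_def by auto
  then obtain m where m: "\<And>p. p \<in> {..<n} \<times> {..<n} \<Longrightarrow> m p \<ge> 0 \<and> Q p (m p)"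
    by metis
  define M where "M = (\<Sum>p\<in>{..<n} \<times> {..<n}. m p)"
  have M: "m p \<le> M" if "p \<in> {..<n} \<times> {..<n}" for p
    unfolding M_def using that m by (intro member_le_sum) auto
  have "M \<ge> 0" unfolding M_def using m by (intro sum_nonneg) auto
  moreover have "norm (edge_point d i s - edge_point d j t) \<le> M * \<delta> * norm (edge_point v i s - edge_point v j t)"
    if d: "d n = d 0" "\<forall>k\<le>n. norm (d k) \<le> \<delta>" and ij: "i < n" "j < n" and st: "s \<in> {0..1}" "t \<in> {0..1}"
    for d \<delta> i j s t
  proof -
    have "\<delta> \<ge> 0" using d(2) norm_ge_zero order_trans by blast
    have p: "(i, j) \<in> {..<n} \<times> {..<n}" using ij by auto
    have "norm (edge_point d i s - edge_point d j t) \<le> m (i, j) * \<delta> * norm (edge_point v i s - edge_point v j t)"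
      using m[OF p] d st unfolding Q_def by auto
    also have "\<dots> \<le> M * \<delta> * norm (edge_point v i s - edge_point v j t)"
      using M[OF p] \<open>\<delta> \<ge> 0\<close> by (intro mult_right_mono) auto
    finally show ?thesis .
  qed
  ultimately show ?thesis by blast
qed

text \<open>A small displacement of the vertices of a simple polygon, interpolated linearly along the edges,
  is Lipschitz with a small constant with respect to distance in space, not just along the polygon.
  Hence it extends to a contraction of space, and this gives an ambient isotopy.\<close>

lemma polygon_vertex_perturbation:
  assumes v: "simple_polygon n v"
  obtains \<delta> where "\<delta> > 0" "\<And>w. w n = w 0 \<Longrightarrow> (\<And>i. i < n \<Longrightarrow> norm (w i - v i) < \<delta>) \<Longrightarrow>
    simple_polygon n w \<and> ambient_isotopic (polygon_set n v) (polygon_set n w)"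
proof -
  obtain M where M: "M \<ge> 0" "\<And>d \<delta> i j s t. d n = d 0 \<Longrightarrow> (\<forall>k\<le>n. norm (d k) \<le> \<delta>) \<Longrightarrow>
    i < n \<Longrightarrow> j < n \<Longrightarrow> s \<in> {0..1} \<Longrightarrow> t \<in> {0..1} \<Longrightarrow>
    norm (edge_point d i s - edge_point d j t) \<le> M * \<delta> * norm (edge_point v i s - edge_point v j t)"
    using polygon_displacement_lipschitz[OF v] by metis
  \<comment> \<open>The extension to space costs a factor \<open>3\<close>, and the result has to be a contraction.\<close>
  define \<delta> where "\<delta> = 1 / (6 * (M + 1))"
  have \<delta>: "\<delta> > 0" "3 * (M * \<delta>) < 1" using M(1) by (auto simp: \<delta>_def field_simps)
  have n: "3 \<le> n" using simple_polygonD(1)[OF v] .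
  have "simple_polygon n w \<and> ambient_isotopic (polygon_set n v) (polygon_set n w)"
    if w: "w n = w 0" "\<And>i. i < n \<Longrightarrow> norm (w i - v i) < \<delta>" for w
  proof -
    define d where "d = (\<lambda>i. w i - v i)"
    have dn: "d n = d 0" using w(1) simple_polygonD(3)[OF v] by (simp add: d_def)
    have dle: "\<forall>k\<le>n. norm (d k) \<le> \<delta>"
    proof (intro allI impI)
      fix k assume "k \<le> n"
      then show "norm (d k) \<le> \<delta>"
        using w(2)[of k] w(2)[of 0] n dn by (cases "k = n") (auto simp: d_def)
    qed
    define I where "I = {..<n} \<times> {0..1::real}"
    have lip: "norm (edge_point d (fst p) (snd p) - edge_point d (fst q) (snd q))
        \<le> M * \<delta> * norm (edge_point v (fst p) (snd p) - edge_point v (fst q) (snd q))"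
      if "p \<in> I" "q \<in> I" for p q
      using that M(2)[OF dn dle] by (auto simp: I_def)
    have "(0, 0) \<in> I" using n by (auto simp: I_def)
    then have ne: "I \<noteq> {}" by blast
    have "M * \<delta> \<ge> 0" using M(1) \<delta>(1) by simp
    from lipschitz_extension_space[OF this, of I "\<lambda>p. edge_point d (fst p) (snd p)"
        "\<lambda>p. edge_point v (fst p) (snd p)", OF lip ne]
    obtain F where F: "\<And>p. p \<in> I \<Longrightarrow> F (edge_point v (fst p) (snd p)) = edge_point d (fst p) (snd p)"
      "\<And>x y. norm (F x - F y) \<le> 3 * (M * \<delta>) * norm (x - y)"
      by blast
    define h where "h = (\<lambda>x. x + F x)"
    have hp: "h (edge_point v i s) = edge_point w i s" if "i < n" "s \<in> {0..1}" for i s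
    proof -
      have "F (edge_point v i s) = edge_point d i s" using F(1)[of "(i, s)"] that by (auto simp: I_def)
      then show ?thesis by (simp add: h_def d_def edge_point_def algebra_simps)
    qed
    have iso: "ambient_isotopic K (h ` K)" and inj: "inj h" for K
      unfolding h_def using ambient_isotopic_contraction_perturbation[OF _ \<delta>(2) F(2)]
        \<open>M * \<delta> \<ge> 0\<close> by auto
    have he: "edge w i = h ` edge v i" if "i < n" for i
      unfolding edge_eq_image using hp[OF that] by (force simp: image_iff)
    have hv: "w i = h (v i)" if "i \<le> n" for i
    proof -
      have *: "w i = h (v i)" if "i < n" for i
        using hp[OF that, of 0] by (simp add: edge_point_def)
      show ?thesis
        using *[of i] *[of 0] that n w(1) simple_polygonD(3)[OF v] by (cases "i = n") auto
    qed
    have "polygon_set n w = h ` polygon_set n v"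
      by (auto simp: polygon_set_def he)
    moreover have "simple_polygon n w"
      unfolding simple_polygon_def
    proof (intro conjI allI impI)
      have "inj_on (h \<circ> v) {..<n}"
        using simple_polygonD(2)[OF v] inj by (auto intro: comp_inj_on inj_on_subset)
      then show "inj_on w {..<n}" by (simp add: inj_on_def hv)
      fix i j assume "i < n" "j < n" "i \<noteq> j"
      then show "edge w i \<inter> edge w j = {w i, w (Suc i)} \<inter> {w j, w (Suc j)}"
        using simple_polygonD(4)[OF v, of i j] image_Int[OF inj, of "edge v i" "edge v j"]
          image_Int[OF inj, of "{v i, v (Suc i)}" "{v j, v (Suc j)}"]
        by (simp add: he hv Suc_le_eq)
    qed (use n w in auto)
    ultimately show ?thesis using iso by simp
  qed
  with \<delta>(1) show ?thesis using that by blast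
qed

text \<open>By the previous lemma the isotopy type is locally constant along a path of simple polygons.\<close>

lemma ambient_isotopic_polygon_path:
  assumes cont: "\<And>i. i \<le> n \<Longrightarrow> continuous_on {0..1} (\<lambda>t::real. v t i)"
    and v: "\<And>t. t \<in> {0..1} \<Longrightarrow> simple_polygon n (v t)"
  shows "ambient_isotopic (polygon_set n (v 0)) (polygon_set n (v 1))"
proof (rule connected_equivalence_relation[of "{0..1::real}" 0 1
      "\<lambda>s t. ambient_isotopic (polygon_set n (v s)) (polygon_set n (v t))"])
  fix t :: real assume t: "t \<in> {0..1}"
  obtain \<delta> where \<delta>: "\<delta> > 0" "\<And>w. w n = w 0 \<Longrightarrow> (\<And>i. i < n \<Longrightarrow> norm (w i - v t i) < \<delta>) \<Longrightarrow>
    simple_polygon n w \<and> ambient_isotopic (polygon_set n (v t)) (polygon_set n w)"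
    using polygon_vertex_perturbation[OF v[OF t]] by blast
  define T where "T = (\<Inter>i\<in>{..n}. {0..1} \<inter> (\<lambda>s. v s i) -` ball (v t i) \<delta>)"
  have "openin (top_of_set {0..1}) T"
    unfolding T_def using cont by (intro openin_INT2) (auto intro!: continuous_openin_preimage_gen)
  moreover have "t \<in> T" using t \<delta>(1) by (auto simp: T_def)
  moreover have "ambient_isotopic (polygon_set n (v t)) (polygon_set n (v s))" if s: "s \<in> T" for s
  proof -
    have "s \<in> {0..1}" using s by (auto simp: T_def)
    then have "v s n = v s 0" using simple_polygonD(3)[OF v] by blast
    moreover have "norm (v s i - v t i) < \<delta>" if "i < n" for i
      using s that by (auto simp: T_def dist_norm norm_minus_commute)
    ultimately show ?thesis using \<delta>(2) by blast
  qed
  ultimately show "\<exists>T. openin (top_of_set {0..1}) T \<and> t \<in> T \<and>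
      (\<forall>s\<in>T. ambient_isotopic (polygon_set n (v t)) (polygon_set n (v s)))"
    by blast
qed (auto intro: ambient_isotopic_sym ambient_isotopic_trans)

lemma polygon_vertex_move:
  assumes "0 < k" "k < n"
    and simple: "\<And>z. z \<in> closed_segment a b \<Longrightarrow> simple_polygon n (v(k := z))"
  shows "ambient_isotopic (polygon_set n (v(k := a))) (polygon_set n (v(k := b)))"
proof -
  have "ambient_isotopic (polygon_set n (v(k := (1 - 0) *\<^sub>R a + 0 *\<^sub>R b)))
      (polygon_set n (v(k := (1 - 1) *\<^sub>R a + 1 *\<^sub>R b)))"
  proof (rule ambient_isotopic_polygon_path[where v = "\<lambda>t. v(k := (1 - t) *\<^sub>R a + t *\<^sub>R b)"])
    fix i
    show "continuous_on {0..1} (\<lambda>t. (v(k := (1 - t) *\<^sub>R a + t *\<^sub>R b)) i)"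
      by (cases "i = k") (auto intro!: continuous_intros)
  next
    fix t :: real assume "t \<in> {0..1}"
    then show "simple_polygon n (v(k := (1 - t) *\<^sub>R a + t *\<^sub>R b))"
      by (intro simple) (auto simp: closed_segment_def)
  qed
  then show ?thesis by simp
qed

lemma simple_polygon_rotate:
  assumes v: "simple_polygon n v" and "r < n"
  shows "simple_polygon n (\<lambda>i. v ((i + r) mod n))"
    and "polygon_set n (\<lambda>i. v ((i + r) mod n)) = polygon_set n v"
proof -
  define w where "w = (\<lambda>i. v ((i + r) mod n))"
  have n: "3 \<le> n" "v n = v 0" using simple_polygonD[OF v] by auto
  have wS: "w (Suc i) = v (Suc ((i + r) mod n))" for i
    using n by (auto simp: w_def mod_Suc)
  have we: "edge w i = edge v ((i + r) mod n)" for i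
    unfolding edge_def wS by (simp add: w_def)
  have inj: "inj_on (\<lambda>i. (i + r) mod n) {..<n}"
  proof (rule inj_onI)
    fix i j assume ij: "i \<in> {..<n}" "j \<in> {..<n}" and eq: "(i + r) mod n = (j + r) mod n"
    have "(k + r) mod n = (if k + r < n then k + r else k + r - n)" if "k < n" for k
      using that \<open>r < n\<close> by (auto simp: le_mod_geq)
    then show "i = j"
      using eq ij by (auto split: if_splits)
  qed
  have img: "(\<lambda>i. (i + r) mod n) ` {..<n} = {..<n}"
    by (rule endo_inj_surj) (use inj n in auto)
  have lt: "(i + r) mod n < n" for i using n by simp
  show "simple_polygon n (\<lambda>i. v ((i + r) mod n))"
    unfolding w_def[symmetric] simple_polygon_def
  proof (intro conjI allI impI)
    show "inj_on w {..<n}"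
      using comp_inj_on[OF inj, of v] simple_polygonD(2)[OF v] img by (simp add: w_def o_def)
    show "w n = w 0" by (simp add: w_def)
    fix i j assume ij: "i < n" "j < n" "i \<noteq> j"
    then have "(i + r) mod n \<noteq> (j + r) mod n" using inj unfolding inj_on_def by blast
    then show "edge w i \<inter> edge w j = {w i, w (Suc i)} \<inter> {w j, w (Suc j)}"
      unfolding we wS using simple_polygonD(4)[OF v lt lt] by (simp add: w_def)
  qed (use n in auto)
  have "(\<Union>i<n. edge v ((i + r) mod n)) = (\<Union>k\<in>(\<lambda>i. (i + r) mod n) ` {..<n}. edge v k)"
    by auto
  then show "polygon_set n (\<lambda>i. v ((i + r) mod n)) = polygon_set n v"
    unfolding w_def[symmetric] polygon_set_def we by (simp only: img)
qed

lemma simple_polygon_translate: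
  assumes v: "simple_polygon n v"
  shows "simple_polygon n (\<lambda>i. c + v i)" "polygon_set n (\<lambda>i. c + v i) = (+) c ` polygon_set n v"
proof -
  have e: "edge (\<lambda>i. c + v i) i = (+) c ` edge v i" for i
    by (simp add: edge_def closed_segment_translation)
  show "polygon_set n (\<lambda>i. c + v i) = (+) c ` polygon_set n v"
    by (auto simp: polygon_set_def e)
  show "simple_polygon n (\<lambda>i. c + v i)"
    unfolding simple_polygon_def e
  proof (intro conjI allI impI)
    fix i j assume "i < n" "j < n" "i \<noteq> j"
    then show "(+) c ` edge v i \<inter> (+) c ` edge v j = {c + v i, c + v (Suc i)} \<inter> {c + v j, c + v (Suc j)}"
      using simple_polygonD(4)[OF v, of i j] image_Int[of "(+) c" "edge v i" "edge v j"]
        image_Int[of "(+) c" "{v i, v (Suc i)}" "{v j, v (Suc j)}"] by simp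
  qed (use simple_polygonD[OF v] in \<open>auto simp: inj_on_def\<close>)
qed

section \<open>Vectors in general position\<close>

unbundle cross3_syntax

abbreviation triple :: "space \<Rightarrow> space \<Rightarrow> space \<Rightarrow> real" where
  "triple a b c \<equiv> (a \<times> b) \<bullet> c"

lemma triple_permute:
  "triple b a c = - triple a b c" "triple a c b = - triple a b c" "triple c b a = - triple a b c"
  "triple b c a = triple a b c" "triple c a b = triple a b c"
  by (simp_all add: cross3_simps)

lemma triple_nonzero_independent:
  assumes "triple a b c \<noteq> 0" and eq: "x *\<^sub>R a + y *\<^sub>R b + z *\<^sub>R c = 0"
  shows "x = 0" "y = 0" "z = 0"
proof -
  have "(b \<times> c) \<bullet> (x *\<^sub>R a + y *\<^sub>R b + z *\<^sub>R c) = x * triple a b c"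
    "(c \<times> a) \<bullet> (x *\<^sub>R a + y *\<^sub>R b + z *\<^sub>R c) = y * triple a b c"
    "(a \<times> b) \<bullet> (x *\<^sub>R a + y *\<^sub>R b + z *\<^sub>R c) = z * triple a b c"
    by (simp_all add: cross3_simps)
  then have "x * triple a b c = 0" "y * triple a b c = 0" "z * triple a b c = 0"
    unfolding eq by simp_all
  then show "x = 0" "y = 0" "z = 0" using assms(1) by auto
qed

lemma cross_nonzero_independent:
  assumes "a \<times> b \<noteq> 0" and eq: "x *\<^sub>R a + y *\<^sub>R b = 0"
  shows "x = 0" "y = 0"
proof -
  have "(x *\<^sub>R a + y *\<^sub>R b) \<times> b = x *\<^sub>R (a \<times> b)" "a \<times> (x *\<^sub>R a + y *\<^sub>R b) = y *\<^sub>R (a \<times> b)"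
    by (simp_all add: cross_add_left cross_add_right cross_mult_left cross_mult_right)
  then have "x *\<^sub>R (a \<times> b) = 0" "y *\<^sub>R (a \<times> b) = 0"
    unfolding eq by simp_all
  then show "x = 0" "y = 0" using assms(1) by auto
qed

lemma orthogonal_to_three_triple_eq_0:
  assumes "y \<bullet> a = 0" "y \<bullet> b = 0" "y \<bullet> c = 0" "y \<noteq> 0"
  shows "triple a b c = 0"
proof -
  have "triple a b c *\<^sub>R y = (y \<bullet> a) *\<^sub>R (b \<times> c) + (y \<bullet> b) *\<^sub>R (c \<times> a) + (y \<bullet> c) *\<^sub>R (a \<times> b)"
    by (simp add: cross3_simps forall_3)
  then show ?thesis using assms by simp
qed

text \<open>Eliminating \<open>a\<close> from the two relations leaves one between the independent vectors \<open>b\<close>, \<open>c\<close> and \<open>d\<close>.\<close>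

lemma four_vector_relation_unique:
  assumes "triple b c d \<noteq> 0"
    and "\<alpha> *\<^sub>R a + \<beta> *\<^sub>R b = \<gamma> *\<^sub>R c + \<epsilon> *\<^sub>R d" "\<alpha>' *\<^sub>R a + \<beta>' *\<^sub>R b = \<gamma>' *\<^sub>R c + \<epsilon>' *\<^sub>R d"
  shows "\<alpha> * \<beta>' = \<alpha>' * \<beta>" "\<alpha> * \<gamma>' = \<alpha>' * \<gamma>" "\<alpha> * \<epsilon>' = \<alpha>' * \<epsilon>"
proof -
  have "\<alpha>' *\<^sub>R (\<alpha> *\<^sub>R a + \<beta> *\<^sub>R b - \<gamma> *\<^sub>R c - \<epsilon> *\<^sub>R d) - \<alpha> *\<^sub>R (\<alpha>' *\<^sub>R a + \<beta>' *\<^sub>R b - \<gamma>' *\<^sub>R c - \<epsilon>' *\<^sub>R d) = 0"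
    using assms(2,3) by simp
  then have "(\<alpha>' * \<beta> - \<alpha> * \<beta>') *\<^sub>R b + (\<alpha> * \<gamma>' - \<alpha>' * \<gamma>) *\<^sub>R c + (\<alpha> * \<epsilon>' - \<alpha>' * \<epsilon>) *\<^sub>R d = 0"
    by (simp add: algebra_simps)
  from triple_nonzero_independent[OF assms(1) this]
  show "\<alpha> * \<beta>' = \<alpha>' * \<beta>" "\<alpha> * \<gamma>' = \<alpha>' * \<gamma>" "\<alpha> * \<epsilon>' = \<alpha>' * \<epsilon>" by auto
qed

definition generic :: "nat \<Rightarrow> (nat \<Rightarrow> space) \<Rightarrow> bool" where
  "generic n q \<longleftrightarrow> (\<forall>i<n. \<forall>j<n. i \<noteq> j \<longrightarrow> q i \<times> q j \<noteq> 0) \<and>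
     (\<forall>i<n. \<forall>j<n. \<forall>k<n. i \<noteq> j \<and> j \<noteq> k \<and> i \<noteq> k \<longrightarrow> triple (q i) (q j) (q k) \<noteq> 0)"

lemma genericD:
  assumes "generic n q" "i < n" "j < n" "i \<noteq> j"
  shows "q i \<times> q j \<noteq> 0" "k < n \<Longrightarrow> j \<noteq> k \<Longrightarrow> i \<noteq> k \<Longrightarrow> triple (q i) (q j) (q k) \<noteq> 0"
  using assms unfolding generic_def by auto

lemma avoid_hyperplanes:
  fixes p :: space
  assumes "finite A" "\<delta> > 0"
  obtains c where "norm (c - p) < \<delta>" "\<And>m. m \<in> A \<Longrightarrow> m \<noteq> 0 \<Longrightarrow> m \<bullet> c \<noteq> 0"
proof -
  have "negligible (\<Union>m\<in>A - {0}. {c. m \<bullet> c = 0})"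
    using assms(1) by (intro negligible_Union) (auto intro!: negligible_hyperplane[OF disjI1])
  moreover have "\<not> negligible (ball p \<delta>)"
    using assms(2) by (simp add: open_not_negligible)
  ultimately have "\<not> ball p \<delta> \<subseteq> (\<Union>m\<in>A - {0}. {c. m \<bullet> c = 0})"
    using negligible_subset by blast
  then obtain c where "c \<in> ball p \<delta>" "c \<notin> (\<Union>m\<in>A - {0}. {c. m \<bullet> c = 0})" by blast
  then show ?thesis
    by (intro that[of c]) (auto simp: dist_norm norm_minus_commute)
qed

text \<open>Points are chosen one after the other, each off finitely many planes through the origin that
  the earlier points determine.\<close>

lemma successive_generic_choice:
  fixes M :: "nat \<Rightarrow> (nat \<Rightarrow> space) \<Rightarrow> space set"
  assumes fin: "\<And>k f. finite (M k f)"
    and cong: "\<And>k f g. (\<And>i. i < k \<Longrightarrow> f i = g i) \<Longrightarrow> M k f = M k g"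
    and "\<delta> > 0"
  shows "\<exists>q. \<forall>k<n. norm (q k - p k) < \<delta> \<and> (\<forall>m\<in>M k q. m \<noteq> 0 \<longrightarrow> m \<bullet> q k \<noteq> 0)"
proof (induction n)
  case (Suc n)
  then obtain q where q: "\<And>k. k < n \<Longrightarrow> norm (q k - p k) < \<delta> \<and> (\<forall>m\<in>M k q. m \<noteq> 0 \<longrightarrow> m \<bullet> q k \<noteq> 0)"
    by blast
  obtain c where c: "norm (c - p n) < \<delta>" "\<And>m. m \<in> M n q \<Longrightarrow> m \<noteq> 0 \<Longrightarrow> m \<bullet> c \<noteq> 0"
    using avoid_hyperplanes[OF fin \<open>\<delta> > 0\<close>] by metis
  define q' where "q' = q(n := c)"
  have M': "M k q' = M k q" if "k \<le> n" for k
    using that by (intro cong) (auto simp: q'_def)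
  show ?case
  proof (intro exI[of _ q'] allI impI)
    fix k assume "k < Suc n"
    then consider "k < n" | "k = n" by linarith
    then show "norm (q' k - p k) < \<delta> \<and> (\<forall>m\<in>M k q'. m \<noteq> 0 \<longrightarrow> m \<bullet> q' k \<noteq> 0)"
    proof cases
      case 1
      then show ?thesis using q[OF 1] M' by (simp add: q'_def)
    next
      case 2
      then show ?thesis using c M' by (simp add: q'_def)
    qed
  qed
qed auto

definition next_index :: "nat \<Rightarrow> nat \<Rightarrow> nat" where
  "next_index n i = (if Suc i = n then 0 else Suc i)"

definition nonadjacent :: "nat \<Rightarrow> nat \<Rightarrow> nat \<Rightarrow> bool" where
  "nonadjacent n i j \<longleftrightarrow> i \<noteq> j \<and> next_index n i \<noteq> j \<and> next_index n j \<noteq> i"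

text \<open>By the second clause, the planes that the origin spans with three pairwise non-adjacent edges have
  only the origin in common; so no ray from the origin meets three such edges.\<close>

definition generic_polygon :: "nat \<Rightarrow> (nat \<Rightarrow> space) \<Rightarrow> bool" where
  "generic_polygon n q \<longleftrightarrow> generic n q \<and>
     (\<forall>i<n. \<forall>j<n. \<forall>k<n. nonadjacent n i j \<and> nonadjacent n j k \<and> nonadjacent n i k \<longrightarrow>
       triple (q i \<times> q (Suc i)) (q j \<times> q (Suc j)) (q k \<times> q (Suc k)) \<noteq> 0)"

text \<open>For the triple products, vertex \<open>k\<close> has to avoid the planes spanned by two earlier vertices.  Three
  edges meet a common ray only if the ray lies on the line \<open>(f i \<times> f (Suc i)) \<times> (f j \<times> f (Suc j))\<close> in which the
  planes of two of them intersect; so the last vertex \<open>k\<close> of the third edge has to avoid the plane spanned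
  by this line and the other end \<open>a\<close> of that edge.\<close>

lemma generic_polygon_perturbation:
  fixes p :: "nat \<Rightarrow> space"
  assumes "\<delta> > 0"
  obtains q where "q n = q 0" "\<And>k. k < n \<Longrightarrow> norm (q k - p k) < \<delta>" "generic_polygon n q"
proof -
  \<comment> \<open>The normals of the planes that vertex \<open>k\<close> has to avoid.  The first two groups only ensure that it is
    neither \<open>0\<close> nor a multiple of an earlier vertex.\<close>
  define M :: "nat \<Rightarrow> (nat \<Rightarrow> space) \<Rightarrow> space set" where
    "M = (\<lambda>k f. range (\<lambda>a. axis a 1) \<union> (\<lambda>(i, a). f i \<times> axis a 1) ` (Sigma {..<k} (\<lambda>_. UNIV))
      \<union> (\<lambda>(i, j). f i \<times> f j) ` (Sigma {..<k} (\<lambda>_. {..<k}))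
      \<union> (\<lambda>(a, i, j). f a \<times> ((f i \<times> f (Suc i)) \<times> (f j \<times> f (Suc j)))) ` (Sigma {..<k} (\<lambda>_. Sigma {..<k-1} (\<lambda>_. {..<k-1}))))"
  have fin: "finite (M k f)" for k f by (auto simp: M_def)
  have cong: "M k f = M k g" if "\<And>i. i < k \<Longrightarrow> f i = g i" for k f g
    unfolding M_def using that by (intro arg_cong2[of _ _ _ _ "(\<union>)"] image_cong refl) auto
  obtain q0 where q0: "\<And>k. k < n \<Longrightarrow> norm (q0 k - p k) < \<delta> \<and> (\<forall>m\<in>M k q0. m \<noteq> 0 \<longrightarrow> m \<bullet> q0 k \<noteq> 0)"
    using successive_generic_choice[of M, OF fin cong assms] by metis
  define q where "q = q0(n := q0 0)"
  have M: "m \<bullet> q k \<noteq> 0" if "k < n" "m \<in> M k q" "m \<noteq> 0" for k m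
  proof -
    have "M k q = M k q0" using that(1) by (intro cong) (auto simp: q_def)
    then show ?thesis using q0[OF that(1)] that by (auto simp: q_def)
  qed
  have cross: "q i \<times> q k \<noteq> 0" if "i < k" "k < n" for i k
  proof
    assume eq: "q i \<times> q k = 0"
    have "axis 1 1 \<bullet> q i \<noteq> 0" using that by (intro M) (auto simp: M_def)
    then have "q i \<noteq> 0" by auto
    then obtain a :: 3 where "q i \<times> axis a 1 \<noteq> 0" using cross_basis_nonzero by blast
    moreover have "q i \<times> axis a 1 \<in> M k q" using that by (auto simp: M_def)
    ultimately have "(q i \<times> axis a 1) \<bullet> q k \<noteq> 0" using that M by blast
    moreover have "(q i \<times> axis a 1) \<bullet> q k = - ((q i \<times> q k) \<bullet> axis a 1)" by (rule triple_permute)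
    ultimately show False using eq by simp
  qed
  have trip: "triple (q i) (q j) (q k) \<noteq> 0" if "i < j" "j < k" "k < n" for i j k
  proof -
    have "q i \<times> q j \<in> M k q" using that by (auto simp: M_def)
    then show ?thesis using M[OF that(3)] cross[of i j] that by auto
  qed
  have gen: "generic n q"
    unfolding generic_def
  proof (intro conjI allI impI)
    fix i j assume "i < n" "j < n" "i \<noteq> j"
    then show "q i \<times> q j \<noteq> 0"
      using cross[of i j] cross[of j i] cross_skew[of "q i" "q j"] by (cases "i < j") auto
  next
    fix i j k assume "i < n" "j < n" "k < n" "i \<noteq> j \<and> j \<noteq> k \<and> i \<noteq> k"
    then consider "i < j" "j < k" | "i < k" "k < j" | "j < i" "i < k" | "j < k" "k < i"
      | "k < i" "i < j" | "k < j" "j < i" by linarith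
    then show "triple (q i) (q j) (q k) \<noteq> 0"
    proof cases
    qed (use trip[of i j k] trip[of i k j] trip[of j i k] trip[of j k i] trip[of k i j] trip[of k j i]
        triple_permute[of "q i" "q j" "q k"] \<open>i < n\<close> \<open>j < n\<close> \<open>k < n\<close> in auto)
  qed
  have sorted: "triple (q i \<times> q (Suc i)) (q j \<times> q (Suc j)) (q k \<times> q (Suc k)) \<noteq> 0"
    if ijk: "i < j" "j < k" "k < n" and ap: "nonadjacent n i j" "nonadjacent n j k" "nonadjacent n i k" for i j k
  proof -
    \<comment> \<open>The ends of edge \<open>k\<close>, the one chosen last being \<open>b\<close>.\<close>
    define a b where "a = (if Suc k = n then 0 else k)" and "b = (if Suc k = n then k else Suc k)"
    have ij: "Suc i < j" "Suc j < k" and i0: "Suc k = n \<Longrightarrow> i \<noteq> 0"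
      using ap ijk by (auto simp: nonadjacent_def next_index_def split: if_splits)
    then have ab: "a < b" "b < n" "Suc i < b" "Suc j < b" "a \<noteq> i" "a \<noteq> Suc i" "a \<noteq> j" "a \<noteq> Suc j"
      using ijk by (auto simp: a_def b_def)
    define Ni Nj where "Ni = q i \<times> q (Suc i)" and "Nj = q j \<times> q (Suc j)"
    define m where "m = q a \<times> (Ni \<times> Nj)"
    have "m \<noteq> 0"
    proof
      assume "m = 0"
      then have eq: "(q a \<bullet> Nj) *\<^sub>R Ni = (q a \<bullet> Ni) *\<^sub>R Nj" by (simp add: m_def Lagrange)
      have "q a \<bullet> Nj \<noteq> 0"
        using genericD(2)[OF gen, of j "Suc j" a] ab by (auto simp: Nj_def inner_commute)
      moreover have "Ni \<bullet> q j \<noteq> 0"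
        using genericD(2)[OF gen, of i "Suc i" j] ab ij by (auto simp: Ni_def)
      moreover have "((q a \<bullet> Nj) *\<^sub>R Ni) \<bullet> q j = 0"
        unfolding eq by (simp add: Nj_def dot_cross_self)
      ultimately show False by simp
    qed
    moreover have "m \<in> M b q"
      unfolding M_def m_def Ni_def Nj_def
      by (rule UnI2, rule image_eqI[of _ _ "(a, i, j)"]) (use ab in auto)
    ultimately have "m \<bullet> q b \<noteq> 0" using M ab by blast
    moreover have "m \<bullet> q b = - triple Ni Nj (q a \<times> q b)"
      using triple_permute(2)[of "q a" "q b" "Ni \<times> Nj"] by (simp add: m_def inner_commute)
    moreover have "q k \<times> q (Suc k) = q a \<times> q b \<or> q k \<times> q (Suc k) = - (q a \<times> q b)"
      using cross_skew[of "q k" "q 0"] \<open>k < n\<close> by (auto simp: a_def b_def q_def)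
    ultimately show ?thesis unfolding Ni_def Nj_def by auto
  qed
  have "generic_polygon n q"
    unfolding generic_polygon_def
  proof (intro conjI gen allI impI)
    fix i j k assume *: "i < n" "j < n" "k < n" "nonadjacent n i j \<and> nonadjacent n j k \<and> nonadjacent n i k"
    then have sym: "nonadjacent n j i" "nonadjacent n k j" "nonadjacent n k i" by (auto simp: nonadjacent_def)
    have "i \<noteq> j" "j \<noteq> k" "i \<noteq> k" using * by (auto simp: nonadjacent_def)
    then consider "i < j" "j < k" | "i < k" "k < j" | "j < i" "i < k" | "j < k" "k < i"
      | "k < i" "i < j" | "k < j" "j < i" by linarith
    then show "triple (q i \<times> q (Suc i)) (q j \<times> q (Suc j)) (q k \<times> q (Suc k)) \<noteq> 0"
      using sorted[of i j k] sorted[of i k j] sorted[of j i k] sorted[of j k i] sorted[of k i j]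
        sorted[of k j i] * sym
        triple_permute[of "q i \<times> q (Suc i)" "q j \<times> q (Suc j)" "q k \<times> q (Suc k)"]
      by cases auto
  qed
  moreover have "norm (q k - p k) < \<delta>" if "k < n" for k
    using q0[OF that] that by (auto simp: q_def)
  moreover have "q n = q 0" by (simp add: q_def)
  ultimately show ?thesis using that by blast
qed

section \<open>Polygons as closed loops\<close>

text \<open>The vertex \<open>v 0\<close> plus the travelled part of each edge vector; \<open>max 0 (min 1 (n * t - i))\<close> is
  the fraction of edge \<open>i\<close> covered at time \<open>t\<close>.\<close>

definition polygon_path :: "nat \<Rightarrow> (nat \<Rightarrow> space) \<Rightarrow> real \<Rightarrow> space" where
  "polygon_path n v t = v 0 + (\<Sum>i<n. max 0 (min 1 (real n * t - real i)) *\<^sub>R (v (Suc i) - v i))"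

lemma polygon_path_on_edge:
  assumes "i < n" "real i \<le> real n * t" "real n * t \<le> real (Suc i)"
  shows "polygon_path n v t = edge_point v i (real n * t - real i)"
proof -
  define f where "f = (\<lambda>k. max 0 (min 1 (real n * t - real k)) *\<^sub>R (v (Suc k) - v k))"
  have "(\<Sum>k<n. f k) = (\<Sum>k<Suc i. f k)"
    using assms by (intro sum.mono_neutral_right) (auto simp: f_def)
  also have "\<dots> = (\<Sum>k<i. f k) + f i" by simp
  also have "(\<Sum>k<i. f k) = (\<Sum>k<i. v (Suc k) - v k)"
    using assms by (intro sum.cong) (auto simp: f_def)
  also have "\<dots> = v i - v 0" by (rule sum_lessThan_telescope)
  also have "f i = (real n * t - real i) *\<^sub>R (v (Suc i) - v i)"
    using assms by (simp add: f_def)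
  finally show ?thesis
    unfolding polygon_path_def f_def[symmetric] by (simp add: edge_point_def algebra_simps)
qed

lemma unit_interval_piece:
  assumes "0 \<le> t" "t < 1" "n > 0"
  obtains i where "i < n" "real i \<le> real n * t" "real n * t < real (Suc i)"
proof -
  define i where "i = nat \<lfloor>real n * t\<rfloor>"
  have nn: "0 \<le> real n * t" using assms by simp
  have "real n * t < real n * 1" using assms by (intro mult_strict_left_mono) auto
  then have "real n * t < real n" by simp
  moreover have "real i = of_int \<lfloor>real n * t\<rfloor>" using nn by (simp add: i_def)
  ultimately show ?thesis using that[of i] by linarith
qed

lemma polygon_path_end:
  assumes "n > 0" "v n = v 0"
  shows "polygon_path n v 0 = v 0" "polygon_path n v 1 = v 0"
  using polygon_path_on_edge[of 0 n 0 v] polygon_path_on_edge[of "n - 1" n 1 v] assms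
  by (auto simp: edge_point_def)

lemma polygon_path_image:
  assumes "n > 0" "v n = v 0"
  shows "path_image (polygon_path n v) = polygon_set n v"
proof
  show "path_image (polygon_path n v) \<subseteq> polygon_set n v"
  proof
    fix x assume "x \<in> path_image (polygon_path n v)"
    then obtain t where t: "t \<in> {0..1}" "x = polygon_path n v t" by (auto simp: path_image_def)
    have "\<exists>t'. 0 \<le> t' \<and> t' < 1 \<and> x = polygon_path n v t'"
      using t polygon_path_end[of n v, OF assms] by (cases "t = 1") (auto intro: exI[of _ 0])
    then obtain t' where t': "0 \<le> t'" "t' < 1" "x = polygon_path n v t'" by blast
    then obtain i where i: "i < n" "real i \<le> real n * t'" "real n * t' < real (Suc i)"
      using unit_interval_piece assms(1) by metis
    then have "x = edge_point v i (real n * t' - real i)"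
      using t'(3) polygon_path_on_edge[of i n t' v] by simp
    then have "x \<in> edge v i" using i edge_point_mem[of "real n * t' - real i" v i] by simp
    then show "x \<in> polygon_set n v" using i by (auto simp: polygon_set_def)
  qed
next
  show "polygon_set n v \<subseteq> path_image (polygon_path n v)"
  proof
    fix x assume "x \<in> polygon_set n v"
    then obtain i s where i: "i < n" and s: "s \<in> {0..1}" and x: "x = edge_point v i s"
      by (auto simp: polygon_set_def edge_eq_image)
    define t where "t = (real i + s) / real n"
    have nt: "real n * t = real i + s" using assms by (simp add: t_def)
    have "polygon_path n v t = x"
      using polygon_path_on_edge[of i n t v] i s nt x by simp
    moreover have "real i + s \<le> real n" using i s by simp
    then have "t \<in> {0..1}" using s assms by (auto simp: t_def)
    ultimately show "x \<in> path_image (polygon_path n v)" by (auto simp: path_image_def)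
  qed
qed

lemma closed_loop_polygon_path:
  assumes v: "simple_polygon n v"
  shows "closed_loop (polygon_path n v)"
proof -
  have n: "n > 0" "v n = v 0" using simple_polygonD[OF v] by auto
  have "path (polygon_path n v)"
    unfolding path_def polygon_path_def by (intro continuous_intros)
  moreover have inj: "t = t'"
    if t: "0 \<le> t" "t < 1" "0 \<le> t'" "t' < 1" and eq: "polygon_path n v t = polygon_path n v t'" for t t'
  proof -
    obtain i where i: "i < n" "real i \<le> real n * t" "real n * t < real (Suc i)"
      using unit_interval_piece[OF t(1,2) n(1)] .
    obtain j where j: "j < n" "real j \<le> real n * t'" "real n * t' < real (Suc j)"
      using unit_interval_piece[OF t(3,4) n(1)] .
    define s r where "s = real n * t - real i" and "r = real n * t' - real j"
    have sr: "s \<in> {0..1}" "s < 1" "r \<in> {0..1}" "r < 1" using i j by (auto simp: s_def r_def)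
    have eq': "edge_point v i s = edge_point v j r"
      using eq polygon_path_on_edge[of i n t v] polygon_path_on_edge[of j n t' v] i j
      by (simp add: s_def r_def)
    have along: "edge_point v k a = edge_point v k b \<longleftrightarrow> a = b" if "k < n" for k a b
    proof -
      have "edge_point v k a - edge_point v k b = (a - b) *\<^sub>R (v (Suc k) - v k)"
        by (simp add: edge_point_def algebra_simps)
      then show ?thesis using simple_polygon_edge_nontrivial[OF v that] by force
    qed
    have ends: "edge_point v k 0 = v k" "edge_point v k 1 = v (Suc k)" for k
      by (auto simp: edge_point_def)
    have "i = j"
    proof (rule ccontr)
      assume ij: "i \<noteq> j"
      have "edge_point v i s \<in> edge v i \<inter> edge v j"
        using edge_point_mem[OF sr(1), of v i] edge_point_mem[OF sr(3), of v j] eq' by auto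
      then have "edge_point v i s \<in> {v i, v (Suc i)} \<inter> {v j, v (Suc j)}"
        using simple_polygonD(4)[OF v i(1) j(1) ij] by simp
      moreover have "edge_point v i s \<noteq> v (Suc i)" "edge_point v j r \<noteq> v (Suc j)"
        using along[OF i(1), of s 1] along[OF j(1), of r 1] sr by (auto simp: ends)
      ultimately have "v i = v j" using eq' by auto
      then show False using simple_polygon_vertex_eq_iff[OF v i(1), of j] j ij by auto
    qed
    moreover have "s = r" using eq' along[OF i(1)] \<open>i = j\<close> by simp
    ultimately show "t = t'" using n by (simp add: s_def r_def)
  qed
  have "loop_free (polygon_path n v)"
    unfolding loop_free_def
  proof (intro ballI impI)
    fix x y :: real assume xy: "x \<in> {0..1}" "y \<in> {0..1}" and eq: "polygon_path n v x = polygon_path n v y"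
    have ends: "polygon_path n v 1 = polygon_path n v 0"
      using polygon_path_end[of n v] n by simp
    have "(if x = 1 then 0 else x) = (if y = 1 then 0 else y)"
      by (rule inj) (use xy eq ends in auto)
    then show "x = y \<or> x = 0 \<and> y = 1 \<or> x = 1 \<and> y = 0"
      by (auto split: if_splits)
  qed
  moreover have "pathfinish (polygon_path n v) = pathstart (polygon_path n v)"
    using polygon_path_end[of n v] n by (simp add: pathfinish_def pathstart_def)
  ultimately show ?thesis by (simp add: closed_loop_def simple_path_def)
qed

lemma polygon_path_derivative:
  assumes "i < n" "real i < real n * t" "real n * t < real (Suc i)"
  shows "(polygon_path n v has_vector_derivative (real n *\<^sub>R (v (Suc i) - v i))) (at t)"
proof -
  define S where "S = {s. real i < real n * s} \<inter> {s. real n * s < real (Suc i)}"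
  have "open S" unfolding S_def by (intro open_Int open_Collect_less continuous_intros)
  have "((\<lambda>t. edge_point v i (real n * t - real i)) has_vector_derivative (real n *\<^sub>R (v (Suc i) - v i))) (at t)"
    unfolding edge_point_def
    by (auto intro!: derivative_eq_intros simp: algebra_simps)
  moreover have "polygon_path n v s = edge_point v i (real n * s - real i)" if "s \<in> S" for s
    using that assms(1) by (intro polygon_path_on_edge) (auto simp: S_def)
  moreover have "t \<in> S" using assms by (auto simp: S_def)
  ultimately show ?thesis
    using \<open>open S\<close> has_vector_derivative_transform_within_open by (metis (no_types, lifting))
qed

section \<open>Spherical projection of a generic polygon\<close>

lemma sgn_eq_imp_scaleR:
  fixes x y :: space
  assumes "x \<noteq> 0" "sgn x = sgn y"
  obtains c where "c > 0" "y = c *\<^sub>R x"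
proof -
  have "y \<noteq> 0" using assms by (metis sgn_zero_iff)
  have "y = norm y *\<^sub>R sgn y" using \<open>y \<noteq> 0\<close> by (simp add: sgn_div_norm)
  also have "\<dots> = norm y *\<^sub>R sgn x" using assms(2) by simp
  also have "\<dots> = (norm y / norm x) *\<^sub>R x" by (simp add: sgn_div_norm divide_inverse)
  finally show ?thesis using that[of "norm y / norm x"] assms \<open>y \<noteq> 0\<close> by auto
qed

lemma has_vector_derivative_sgn:
  fixes g :: "real \<Rightarrow> space"
  assumes g: "(g has_vector_derivative D) (at s)" and "g s \<noteq> 0"
  obtains \<alpha> \<beta> where "\<alpha> \<noteq> 0" "((\<lambda>t. sgn (g t)) has_vector_derivative (\<alpha> *\<^sub>R D + \<beta> *\<^sub>R g s)) (at s)"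
proof -
  have "g differentiable (at s)"
    using g by (auto simp: has_vector_derivative_def differentiable_def)
  then have "(norm \<circ> g) differentiable (at s)"
    using \<open>g s \<noteq> 0\<close> by (intro differentiable_chain_at differentiable_norm_at) auto
  then obtain r where r: "((\<lambda>t. norm (g t)) has_real_derivative r) (at s)"
    by (auto simp: real_differentiable_def o_def)
  define r' where "r' = - (inverse (norm (g s)) * r * inverse (norm (g s)))"
  have "((\<lambda>t. inverse (norm (g t))) has_real_derivative r') (at s)"
    unfolding r'_def by (rule DERIV_inverse'[OF r]) (use \<open>g s \<noteq> 0\<close> in simp)
  then have "((\<lambda>t. inverse (norm (g t)) *\<^sub>R g t) has_vector_derivative
      (inverse (norm (g s)) *\<^sub>R D + r' *\<^sub>R g s)) (at s)"
    by (rule has_vector_derivative_scaleR[OF _ g])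
  then show ?thesis
    using that[of "inverse (norm (g s))" r'] \<open>g s \<noteq> 0\<close> by (simp add: sgn_div_norm)
qed

definition crossing_pairs :: "nat \<Rightarrow> (nat \<Rightarrow> space) \<Rightarrow> (nat \<times> nat) set" where
  "crossing_pairs n q = {(i, j). i < j \<and> j < n \<and> nonadjacent n i j \<and> (\<exists>x\<in>edge q i. \<exists>y\<in>edge q j. sgn x = sgn y)}"

context
  fixes n :: nat and q :: "nat \<Rightarrow> space"
  assumes simple: "simple_polygon n q" and gen: "generic_polygon n q"
begin

lemma n_ge_3: "3 \<le> n" and closes_up: "q n = q 0"
  using simple_polygonD[OF simple] by auto

lemma next_index_less: "i < n \<Longrightarrow> next_index n i < n"
  by (auto simp: next_index_def)

lemma next_index_eq_iff: "i < n \<Longrightarrow> j < n \<Longrightarrow> next_index n i = next_index n j \<longleftrightarrow> i = j"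
  by (auto simp: next_index_def)

lemma next_index_neq: "i < n \<Longrightarrow> next_index n i \<noteq> i" "i < n \<Longrightarrow> next_index n (next_index n i) \<noteq> i"
  using n_ge_3 by (auto simp: next_index_def)

lemma q_Suc: "q (Suc i) = q (next_index n i)"
  using closes_up by (auto simp: next_index_def)

lemma cross_nonzero: "i < n \<Longrightarrow> j < n \<Longrightarrow> i \<noteq> j \<Longrightarrow> q i \<times> q j \<noteq> 0"
  and triple_nonzero: "i < n \<Longrightarrow> j < n \<Longrightarrow> k < n \<Longrightarrow> i \<noteq> j \<Longrightarrow> j \<noteq> k \<Longrightarrow> i \<noteq> k \<Longrightarrow>
    triple (q i) (q j) (q k) \<noteq> 0"
  using gen unfolding generic_polygon_def generic_def by blast+

lemma on_edge:
  assumes "x \<in> edge q i"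
  obtains a b where "a \<ge> 0" "b \<ge> 0" "a + b = 1" "x = a *\<^sub>R q i + b *\<^sub>R q (next_index n i)"
proof -
  obtain s where "s \<in> {0..1}" "x = edge_point q i s" using assms by (auto simp: edge_eq_image)
  then show ?thesis using that[of "1 - s" s] by (auto simp: edge_point_def q_Suc)
qed

lemma edge_nonzero: "i < n \<Longrightarrow> x \<in> edge q i \<Longrightarrow> x \<noteq> 0"
proof
  assume i: "i < n" and x: "x \<in> edge q i" "x = 0"
  obtain a b where ab: "a + b = 1" "x = a *\<^sub>R q i + b *\<^sub>R q (next_index n i)"
    using x(1) by (rule on_edge)
  have "q i \<times> q (next_index n i) \<noteq> 0"
    using next_index_less[OF i] next_index_neq(1)[OF i] i by (intro cross_nonzero) auto
  then show False
    using cross_nonzero_independent[of "q i" "q (next_index n i)" a b] ab x(2) by auto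
qed

text \<open>The planes of two adjacent edges intersect in the line through the common vertex.\<close>

lemma sgn_eq_adjacent_edges:
  assumes i: "i < n" and x: "x \<in> edge q i" "y \<in> edge q (next_index n i)" and eq: "sgn x = sgn y"
  shows "x = y"
proof -
  define j k where "j = next_index n i" and "k = next_index n j"
  have ijk: "j < n" "k < n" "i \<noteq> j" "j \<noteq> k" "i \<noteq> k"
    using i next_index_less next_index_neq[of i] next_index_neq[of j] by (auto simp: j_def k_def)
  obtain a b where ab: "a + b = 1" "x = a *\<^sub>R q i + b *\<^sub>R q j"
    using x(1) unfolding j_def by (rule on_edge)
  obtain c d where cd: "c + d = 1" "y = c *\<^sub>R q j + d *\<^sub>R q k"
    using x(2) unfolding j_def k_def by (rule on_edge)
  obtain r where r: "r > 0" "y = r *\<^sub>R x"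
    using sgn_eq_imp_scaleR[OF edge_nonzero[OF i x(1)] eq] .
  have "(r * a) *\<^sub>R q i + (r * b - c) *\<^sub>R q j + (- d) *\<^sub>R q k = 0"
    using r(2) unfolding ab cd by (simp add: algebra_simps)
  from triple_nonzero_independent[OF _ this]
  have "r * a = 0" "d = 0" using triple_nonzero[of i j k] i ijk by auto
  then show "x = y" using r(1) ab cd by auto
qed

lemma sgn_eq_edges_nonadjacent:
  assumes ij: "i < n" "j < n" and x: "x \<in> edge q i" "y \<in> edge q j" and eq: "sgn x = sgn y"
    and "x \<noteq> y"
  shows "nonadjacent n i j"
proof (rule ccontr)
  assume "\<not> nonadjacent n i j"
  then consider "i = j" | "j = next_index n i" | "i = next_index n j" unfolding nonadjacent_def by auto
  then show False
  proof cases
    case 1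
    define k where "k = next_index n i"
    have k: "k < n" "i \<noteq> k" using ij next_index_less next_index_neq[of i] by (auto simp: k_def)
    obtain a b where ab: "a + b = 1" "x = a *\<^sub>R q i + b *\<^sub>R q k"
      using x(1) unfolding k_def by (rule on_edge)
    obtain c d where cd: "c + d = 1" "y = c *\<^sub>R q i + d *\<^sub>R q k"
      using x(2) unfolding 1[symmetric] k_def by (rule on_edge)
    obtain r where r: "r > 0" "y = r *\<^sub>R x"
      using sgn_eq_imp_scaleR[OF edge_nonzero[OF ij(1) x(1)] eq] .
    have "(r * a - c) *\<^sub>R q i + (r * b - d) *\<^sub>R q k = 0"
      using r(2) unfolding ab cd by (simp add: algebra_simps)
    from cross_nonzero_independent[OF cross_nonzero[OF ij(1) k(1,2)] this]
    have "r * (a + b) = c + d" by (simp add: algebra_simps)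
    then show False using ab cd r \<open>x \<noteq> y\<close> by simp
  next
    case 2
    then show False using sgn_eq_adjacent_edges[OF ij(1)] x eq \<open>x \<noteq> y\<close> by auto
  next
    case 3
    then show False using sgn_eq_adjacent_edges[OF ij(2), of y x] x eq \<open>x \<noteq> y\<close> by auto
  qed
qed

text \<open>The coefficients \<open>a\<close> and \<open>b\<close> are not zero, because a vertex does not lie over a non-adjacent edge.\<close>

lemma nonadjacent_edges_relation:
  assumes ij: "i < n" "j < n" "nonadjacent n i j" and x: "x \<in> edge q i" "y \<in> edge q j" and eq: "sgn x = sgn y"
  obtains a b c d where "a > 0" "b > 0" "a + b = 1" "x = a *\<^sub>R q i + b *\<^sub>R q (next_index n i)"
    "x = c *\<^sub>R q j + d *\<^sub>R q (next_index n j)"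
proof -
  define k l where "k = next_index n i" and "l = next_index n j"
  have kl: "k < n" "l < n" "i \<noteq> j" "i \<noteq> k" "i \<noteq> l" "j \<noteq> k" "j \<noteq> l" "k \<noteq> l"
    using ij next_index_less next_index_neq[of i] next_index_neq[of j] next_index_eq_iff[of i j]
    by (auto simp: k_def l_def nonadjacent_def)
  obtain a b where ab: "a \<ge> 0" "b \<ge> 0" "a + b = 1" "x = a *\<^sub>R q i + b *\<^sub>R q k"
    using x(1) unfolding k_def by (rule on_edge)
  obtain c d where cd: "y = c *\<^sub>R q j + d *\<^sub>R q l"
    using x(2) unfolding l_def by (rule on_edge)
  obtain r where r: "r > 0" "x = r *\<^sub>R y"
    using sgn_eq_imp_scaleR[OF edge_nonzero[OF ij(2) x(2)]] eq by metis
  have x': "x = (r * c) *\<^sub>R q j + (r * d) *\<^sub>R q l" using r cd by (simp add: algebra_simps)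
  have "a \<noteq> 0"
  proof
    assume "a = 0"
    then have "b *\<^sub>R q k + (- (r * c)) *\<^sub>R q j + (- (r * d)) *\<^sub>R q l = 0"
      using ab x' by (simp add: algebra_simps)
    from triple_nonzero_independent(1)[OF _ this] have "b = 0"
      using triple_nonzero[of k j l] ij kl by auto
    then show False using ab \<open>a = 0\<close> by simp
  qed
  moreover have "b \<noteq> 0"
  proof
    assume "b = 0"
    then have "a *\<^sub>R q i + (- (r * c)) *\<^sub>R q j + (- (r * d)) *\<^sub>R q l = 0"
      using ab x' by (simp add: algebra_simps)
    from triple_nonzero_independent(1)[OF _ this] have "a = 0"
      using triple_nonzero[of i j l] ij kl by auto
    then show False using ab \<open>b = 0\<close> by simp
  qed
  ultimately show ?thesis using that[of a b "r * c" "r * d"] ab x' by (auto simp: k_def l_def)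
qed

text \<open>Two edges that cross in two points would give two independent relations between their four ends.\<close>

lemma crossing_of_edges_unique:
  assumes ij: "i < n" "j < n" "nonadjacent n i j"
    and x: "x \<in> edge q i" "y \<in> edge q j" "sgn x = sgn y"
    and z: "z \<in> edge q i" "w \<in> edge q j" "sgn z = sgn w"
  shows "x = z"
proof -
  define k l where "k = next_index n i" and "l = next_index n j"
  have kl: "k < n" "l < n" "i \<noteq> j" "i \<noteq> k" "i \<noteq> l" "j \<noteq> k" "j \<noteq> l" "k \<noteq> l"
    using ij next_index_less next_index_neq[of i] next_index_neq[of j] next_index_eq_iff[of i j]
    by (auto simp: k_def l_def nonadjacent_def)
  obtain a b c d where x': "a > 0" "b > 0" "a + b = 1" "x = a *\<^sub>R q i + b *\<^sub>R q k"
    "x = c *\<^sub>R q j + d *\<^sub>R q l"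
    using nonadjacent_edges_relation[OF ij x] unfolding k_def l_def by metis
  obtain a' b' c' d' where z': "a' > 0" "b' > 0" "a' + b' = 1" "z = a' *\<^sub>R q i + b' *\<^sub>R q k"
    "z = c' *\<^sub>R q j + d' *\<^sub>R q l"
    using nonadjacent_edges_relation[OF ij z] unfolding k_def l_def by metis
  have "a * b' = a' * b"
    by (rule four_vector_relation_unique(1)[of "q k" "q j" "q l" a "q i" b c d a' b' c' d'])
      (use triple_nonzero[of k j l] ij kl x' z' in auto)
  moreover have "b = 1 - a" "b' = 1 - a'" using x' z' by auto
  ultimately have "a = a'" by (simp add: algebra_simps)
  then show ?thesis using x' z' by auto
qed

lemma no_triple_crossing:
  assumes "i < n" "j < n" "k < n" "nonadjacent n i j" "nonadjacent n j k" "nonadjacent n i k"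
    and "x \<in> edge q i" "y \<in> edge q j" "z \<in> edge q k" and eq: "sgn x = sgn y" "sgn x = sgn z"
  shows False
proof -
  have orth: "sgn u \<bullet> (q m \<times> q (Suc m)) = 0" if "u \<in> edge q m" for u m
  proof -
    obtain a b where "u = a *\<^sub>R q m + b *\<^sub>R q (Suc m)" using on_edge[OF \<open>u \<in> edge q m\<close>] q_Suc by metis
    then show ?thesis by (simp add: sgn_div_norm inner_add_left dot_cross_self)
  qed
  have "sgn x \<noteq> 0" using edge_nonzero assms by (simp add: sgn_zero_iff)
  then have "triple (q i \<times> q (Suc i)) (q j \<times> q (Suc j)) (q k \<times> q (Suc k)) = 0"
    using orth[of x i] orth[of y j] orth[of z k] assms by (intro orthogonal_to_three_triple_eq_0[of "sgn x"]) auto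
  then show False using gen assms unfolding generic_polygon_def by blast
qed

lemma nonadjacent_sym: "nonadjacent n i j \<longleftrightarrow> nonadjacent n j i"
  by (auto simp: nonadjacent_def)

lemma crossing_on_edges:
  assumes "y \<in> crossings sgn (polygon_set n q)"
  obtains i j x x' where "i < j" "j < n" "nonadjacent n i j" "x \<in> edge q i" "x' \<in> edge q j" "x \<noteq> x'"
    "sgn x = y" "sgn x' = y"
proof -
  obtain x x' i j where x: "i < n" "j < n" "x \<in> edge q i" "x' \<in> edge q j" "x \<noteq> x'" "sgn x = y" "sgn x' = y"
    using assms unfolding crossings_def polygon_set_def by blast
  then have ap: "nonadjacent n i j" using sgn_eq_edges_nonadjacent by metis
  then have "i \<noteq> j" by (auto simp: nonadjacent_def)
  then consider "i < j" | "j < i" by linarith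
  then show ?thesis
  proof cases
    case 1
    then show ?thesis using that[of i j x x'] x ap by auto
  next
    case 2
    then show ?thesis using that[of j i x' x] x ap nonadjacent_sym by auto
  qed
qed

text \<open>A crossing is determined by the two edges that pass over it.\<close>

lemma card_crossings_le:
  "finite (crossings sgn (polygon_set n q)) \<and>
   card (crossings sgn (polygon_set n q)) \<le> card (crossing_pairs n q)"
proof -
  define Y where "Y = (\<lambda>(i, j). SOME y. \<exists>x\<in>edge q i. \<exists>x'\<in>edge q j. sgn x = y \<and> sgn x' = y)"
  have fin: "finite (crossing_pairs n q)"
    by (rule finite_subset[of _ "Sigma {..<n} (\<lambda>_. {..<n})"]) (auto simp: crossing_pairs_def)
  have sub: "crossings sgn (polygon_set n q) \<subseteq> Y ` crossing_pairs n q"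
  proof
    fix y assume "y \<in> crossings sgn (polygon_set n q)"
    then obtain i j x x' where x: "i < j" "j < n" "nonadjacent n i j" "x \<in> edge q i" "x' \<in> edge q j"
      "sgn x = y" "sgn x' = y" using crossing_on_edges by metis
    then have "\<exists>y. \<exists>x\<in>edge q i. \<exists>x'\<in>edge q j. sgn x = y \<and> sgn x' = y" by blast
    then have "\<exists>z\<in>edge q i. \<exists>w\<in>edge q j. sgn z = Y (i, j) \<and> sgn w = Y (i, j)"
      unfolding Y_def prod.case by (rule someI_ex)
    then obtain z w where z: "z \<in> edge q i" "w \<in> edge q j" "sgn z = Y (i, j)" "sgn w = Y (i, j)" by blast
    have "x = z"
      by (rule crossing_of_edges_unique[of i j x x' z w]) (use x z in auto)
    then have "y = Y (i, j)" using x z by simp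
    moreover have "\<exists>x\<in>edge q i. \<exists>y\<in>edge q j. sgn x = sgn y" using x(4-7) by metis
    then have "(i, j) \<in> crossing_pairs n q" using x(1-3) by (simp add: crossing_pairs_def)
    ultimately show "y \<in> Y ` crossing_pairs n q" by blast
  qed
  have "card (crossings sgn (polygon_set n q)) \<le> card (Y ` crossing_pairs n q)"
    by (rule card_mono[OF finite_imageI[OF fin] sub])
  also have "\<dots> \<le> card (crossing_pairs n q)" by (rule card_image_le[OF fin])
  finally show ?thesis using finite_subset[OF sub finite_imageI[OF fin]] by blast
qed

lemma crossing_fibre:
  assumes "y \<in> crossings sgn (polygon_set n q)"
  shows "card {x \<in> polygon_set n q. sgn x = y} = 2"
proof -
  obtain i j x x' where x: "i < j" "j < n" "nonadjacent n i j" "x \<in> edge q i" "x' \<in> edge q j" "x \<noteq> x'"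
    "sgn x = y" "sgn x' = y" using crossing_on_edges[OF assms] .
  have "z = x \<or> z = x'" if z: "k < n" "z \<in> edge q k" "sgn z = y" for z k
  proof (rule ccontr)
    assume "\<not> ?thesis"
    then have "nonadjacent n i k" "nonadjacent n j k"
      using sgn_eq_edges_nonadjacent[of i k x z] sgn_eq_edges_nonadjacent[of j k x' z] x z by auto
    then show False
      using no_triple_crossing[of i j k x x' z] x z by auto
  qed
  then have "{x \<in> polygon_set n q. sgn x = y} = {x, x'}"
    using x by (auto simp: polygon_set_def)
  then show ?thesis using \<open>x \<noteq> x'\<close> by simp
qed

text \<open>The velocity of the image of edge \<open>i\<close> stays in the plane that edge \<open>i\<close> spans with the origin, and it
  leaves the plane of edge \<open>j\<close>.  The same with \<open>i\<close> and \<open>j\<close> exchanged shows that the velocities of the two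
  strands are independent.\<close>

lemma crossing_velocity:
  assumes ij: "i < n" "j < n" "nonadjacent n i j" and x: "x \<in> edge q i" "y \<in> edge q j" "sgn x = sgn y"
    and t: "0 \<le> t" "t \<le> 1" "polygon_path n q t = x"
  obtains d where "0 < t" "t < 1" "((sgn \<circ> polygon_path n q) has_vector_derivative d) (at t)"
    "d \<bullet> (q i \<times> q (Suc i)) = 0" "d \<bullet> (q j \<times> q (Suc j)) \<noteq> 0"
proof -
  define k l where "k = next_index n i" and "l = next_index n j"
  have kl: "k < n" "l < n" "i \<noteq> j" "i \<noteq> k" "i \<noteq> l" "j \<noteq> k" "j \<noteq> l" "k \<noteq> l"
    using ij next_index_less next_index_neq[of i] next_index_neq[of j] next_index_eq_iff[of i j]
    by (auto simp: k_def l_def nonadjacent_def)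
  have S: "q (Suc i) = q k" "q (Suc j) = q l" by (auto simp: q_Suc k_def l_def)
  obtain a b c d where rel: "a > 0" "b > 0" "a + b = 1" "x = a *\<^sub>R q i + b *\<^sub>R q k"
    "x = c *\<^sub>R q j + d *\<^sub>R q l"
    using nonadjacent_edges_relation[OF ij x] unfolding k_def l_def by metis
  have n: "n > 0" using n_ge_3 by simp
  have unique_edge: "m = i" if m: "m < n" "x \<in> edge q m" for m
  proof (rule ccontr)
    assume "m \<noteq> i"
    then have "x \<in> {q m, q (Suc m)} \<inter> {q i, q (Suc i)}"
      using simple_polygonD(4)[OF simple m(1) ij(1)] m x by blast
    then have "x = q i \<or> x = q k" by (auto simp: S)
    moreover have "(a - 1) *\<^sub>R q i + b *\<^sub>R q k = 0" if "x = q i"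
      using rel(4) that by (simp add: algebra_simps)
    moreover have "a *\<^sub>R q i + (b - 1) *\<^sub>R q k = 0" if "x = q k"
      using rel(4) that by (simp add: algebra_simps)
    ultimately show False
      using cross_nonzero_independent(1)[OF cross_nonzero[OF ij(1) kl(1) kl(4)], of a "b - 1"]
        cross_nonzero_independent(2)[OF cross_nonzero[OF ij(1) kl(1) kl(4)], of "a - 1" b] rel by auto
  qed
  \<comment> \<open>The base point is a vertex, whereas \<open>x\<close> is an inner point of edge \<open>i\<close>.\<close>
  have "x \<noteq> q 0"
  proof
    assume x0: "x = q 0"
    have "x \<in> edge q 0" "x \<in> edge q (n - 1)"
      using x0 n closes_up by (auto simp: edge_def)
    then have "i = 0" "i = n - 1" using unique_edge[of 0] unique_edge[of "n - 1"] n by auto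
    then show False using n_ge_3 by simp
  qed
  then have "t \<noteq> 0" "t \<noteq> 1" using polygon_path_end[OF n closes_up] t by auto
  then have t01: "0 < t" "t < 1" using t by auto
  obtain m where m: "m < n" "real m \<le> real n * t" "real n * t < real (Suc m)"
    using unit_interval_piece[OF t(1) t01(2) n] .
  have xm: "x = edge_point q m (real n * t - real m)"
    using polygon_path_on_edge[of m n t q] m t by simp
  then have "x \<in> edge q m" using m edge_point_mem[of "real n * t - real m" q m] by auto
  then have "m = i" using unique_edge m by blast
  have "real n * t \<noteq> real i"
  proof
    assume "real n * t = real i"
    then have "x = q i" using xm \<open>m = i\<close> by (simp add: edge_point_def)
    then have "(a - 1) *\<^sub>R q i + b *\<^sub>R q k = 0" using rel(4) by (simp add: algebra_simps)
    then show False
      using cross_nonzero_independent(2)[OF cross_nonzero[OF ij(1) kl(1) kl(4)], of "a - 1" b] rel by auto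
  qed
  then have der: "(polygon_path n q has_vector_derivative (real n *\<^sub>R (q k - q i))) (at t)"
    using polygon_path_derivative[of i n t q] m \<open>m = i\<close> ij(1) by (simp add: S)
  have "polygon_path n q t \<noteq> 0" using edge_nonzero[OF ij(1) x(1)] t by simp
  then obtain \<alpha> \<beta> where \<alpha>: "\<alpha> \<noteq> 0" and
    der': "((\<lambda>t. sgn (polygon_path n q t)) has_vector_derivative
       (\<alpha> *\<^sub>R (real n *\<^sub>R (q k - q i)) + \<beta> *\<^sub>R polygon_path n q t)) (at t)"
    using has_vector_derivative_sgn[OF der] by metis
  define D where "D = \<alpha> *\<^sub>R (real n *\<^sub>R (q k - q i)) + \<beta> *\<^sub>R x"
  define N where "N = q j \<times> q l"
  have "D \<bullet> (q i \<times> q k) = 0"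
    unfolding D_def rel(4) by (simp add: inner_add_left inner_diff_left dot_cross_self)
  moreover have "D \<bullet> N \<noteq> 0"
  proof
    assume 0: "D \<bullet> N = 0"
    have xN: "x \<bullet> N = 0"
      unfolding rel(5) N_def by (simp add: inner_add_left dot_cross_self)
    then have "\<alpha> * real n * (q k \<bullet> N - q i \<bullet> N) = 0"
      using 0 by (simp add: D_def inner_add_left inner_diff_left)
    then have eq: "q k \<bullet> N = q i \<bullet> N" using \<alpha> n by simp
    have "a * (q i \<bullet> N) + b * (q k \<bullet> N) = 0"
      using xN unfolding rel(4) by (simp add: inner_add_left)
    then have "(a + b) * (q i \<bullet> N) = 0" unfolding eq by (simp add: algebra_simps)
    then have "q i \<bullet> N = 0" using rel by simp
    then show False
      using triple_nonzero[of j l i] ij kl by (simp add: N_def inner_commute)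
  qed
  ultimately show ?thesis
    using that[of D] t01 der' t by (simp add: D_def N_def S o_def)
qed

lemma general_position_polygon_path: "general_position sgn (polygon_path n q)"
proof -
  have im: "path_image (polygon_path n q) = polygon_set n q"
    using polygon_path_image[of n q] n_ge_3 closes_up by simp
  have "s \<in> {0<..<1} \<and> t \<in> {0<..<1} \<and>
        (\<exists>d e. ((sgn \<circ> polygon_path n q) has_vector_derivative d) (at s) \<and>
               ((sgn \<circ> polygon_path n q) has_vector_derivative e) (at t) \<and> d \<noteq> e \<and> independent {d, e})"
    if st: "s \<in> {0..1}" "t \<in> {0..1}"
      and ne: "polygon_path n q s \<noteq> polygon_path n q t" "sgn (polygon_path n q s) = sgn (polygon_path n q t)"
    for s t
  proof -
    define x y where "x = polygon_path n q s" and "y = polygon_path n q t"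
    have "x \<in> polygon_set n q" "y \<in> polygon_set n q"
      using im st unfolding x_def y_def path_image_def by blast+
    then obtain i j where ij: "i < n" "j < n" "x \<in> edge q i" "y \<in> edge q j"
      by (auto simp: polygon_set_def)
    have eq: "sgn x = sgn y" and "x \<noteq> y" using ne by (auto simp: x_def y_def)
    then have ap: "nonadjacent n i j" "nonadjacent n j i" using sgn_eq_edges_nonadjacent[of i j x y] ij nonadjacent_sym by auto
    obtain d where d: "0 < s" "s < 1" "((sgn \<circ> polygon_path n q) has_vector_derivative d) (at s)"
      "d \<bullet> (q i \<times> q (Suc i)) = 0" "d \<bullet> (q j \<times> q (Suc j)) \<noteq> 0"
      using crossing_velocity[OF ij(1,2) ap(1) ij(3,4) eq, of s] st x_def by auto
    obtain e where e: "0 < t" "t < 1" "((sgn \<circ> polygon_path n q) has_vector_derivative e) (at t)"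
      "e \<bullet> (q j \<times> q (Suc j)) = 0" "e \<bullet> (q i \<times> q (Suc i)) \<noteq> 0"
      using crossing_velocity[OF ij(2,1) ap(2) ij(4,3) eq[symmetric], of t] st y_def by auto
    have "e \<noteq> 0" using e by auto
    have "d \<notin> span {e}" using d(5) e(4) by (auto simp: span_singleton)
    then have "independent {d, e}" using \<open>e \<noteq> 0\<close> by (simp add: independent_insert)
    moreover have "d \<noteq> e" using d(5) e(4) by auto
    ultimately show ?thesis using d e by auto
  qed
  then show ?thesis
    unfolding general_position_def im using card_crossings_le crossing_fibre by blast
qed

end

section \<open>Bending an edge\<close>

lemma simple_polygon_reverse:
  assumes v: "simple_polygon n v"
  shows "simple_polygon n (\<lambda>i. v (n - i))" and "polygon_set n (\<lambda>i. v (n - i)) = polygon_set n v"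
proof -
  define w where "w = (\<lambda>i. v (n - i))"
  have n: "3 \<le> n" "v n = v 0" using simple_polygonD[OF v] by auto
  have e: "edge w i = edge v (n - 1 - i)" if "i < n" for i
  proof -
    have "n - i = Suc (n - 1 - i)" using that by simp
    then show ?thesis by (simp add: edge_def w_def closed_segment_commute)
  qed
  have img: "(\<lambda>i. n - 1 - i) ` {..<n} = {..<n}"
    by (rule endo_inj_surj) (use n in \<open>auto simp: inj_on_def\<close>)
  have "(\<Union>i<n. edge w i) = (\<Union>k\<in>(\<lambda>i. n - 1 - i) ` {..<n}. edge v k)"
    using e by auto
  then show "polygon_set n (\<lambda>i. v (n - i)) = polygon_set n v"
    unfolding w_def[symmetric] polygon_set_def by (simp only: img)
  show "simple_polygon n (\<lambda>i. v (n - i))"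
    unfolding w_def[symmetric] simple_polygon_def
  proof (intro conjI allI impI)
    show "inj_on w {..<n}"
    proof (rule inj_onI)
      fix i j assume ij: "i \<in> {..<n}" "j \<in> {..<n}" and "w i = w j"
      then have "v (Suc (n - 1 - i)) = v (Suc (n - 1 - j))"
        by (simp add: w_def Suc_diff_Suc)
      then have "n - 1 - i = n - 1 - j"
        using simple_polygon_Suc_eq_iff[OF v] n by auto
      then show "i = j" using ij by auto
    qed
    fix i j assume ij: "i < n" "j < n" "i \<noteq> j"
    have S: "w k = v (Suc (n - 1 - k))" "w (Suc k) = v (n - 1 - k)" if "k < n" for k
      using that by (simp_all add: w_def Suc_diff_Suc)
    show "edge w i \<inter> edge w j = {w i, w (Suc i)} \<inter> {w j, w (Suc j)}"
      using simple_polygonD(4)[OF v, of "n - 1 - i" "n - 1 - j"] ij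
      by (simp add: e S insert_commute)
  qed (use n in \<open>auto simp: w_def\<close>)
qed

definition insert_vertex :: "space \<Rightarrow> (nat \<Rightarrow> space) \<Rightarrow> nat \<Rightarrow> space" where
  "insert_vertex z v i = (if i = 0 then v 0 else if i = 1 then z else v (i - 1))"

lemma insert_vertex_edge:
  "edge (insert_vertex z v) 0 = closed_segment (v 0) z"
  "edge (insert_vertex z v) (Suc 0) = closed_segment z (v 1)"
  "k > 0 \<Longrightarrow> edge (insert_vertex z v) (Suc k) = edge v k"
  by (auto simp: edge_def insert_vertex_def)

lemma insert_vertex_polygon_set:
  assumes "n > 0"
  shows "polygon_set (Suc n) (insert_vertex z v) =
    closed_segment (v 0) z \<union> closed_segment z (v 1) \<union> (\<Union>k\<in>{1..<n}. edge v k)"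
proof -
  have "{..<Suc n} = insert 0 (insert (Suc 0) (Suc ` {1..<n}))"
    using assms by (auto simp: image_iff less_Suc_eq_0_disj)
  then have "polygon_set (Suc n) (insert_vertex z v) = edge (insert_vertex z v) 0 \<union>
      edge (insert_vertex z v) (Suc 0) \<union> (\<Union>k\<in>{1..<n}. edge (insert_vertex z v) (Suc k))"
    unfolding polygon_set_def by (simp only: UN_insert UN_simps Un_assoc)
  also have "(\<Union>k\<in>{1..<n}. edge (insert_vertex z v) (Suc k)) = (\<Union>k\<in>{1..<n}. edge v k)"
    by (intro SUP_cong) (auto simp: insert_vertex_edge)
  finally show ?thesis by (simp only: insert_vertex_edge)
qed

lemma simple_polygon_insert_vertex:
  assumes v: "simple_polygon n v"
    and corner: "closed_segment (v 0) z \<inter> closed_segment z (v 1) = {z}" "z \<noteq> v 0" "z \<noteq> v 1"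
    and apart: "\<And>k. 1 \<le> k \<Longrightarrow> k < n \<Longrightarrow>
      (closed_segment (v 0) z \<union> closed_segment z (v 1)) \<inter> edge v k \<subseteq> {v 0, v 1}"
  shows "simple_polygon (Suc n) (insert_vertex z v)"
proof -
  define w where "w = insert_vertex z v"
  have n: "3 \<le> n" "v n = v 0" using simple_polygonD[OF v] by auto
  have w: "w 0 = v 0" "w (Suc 0) = z" "\<And>k. k > 0 \<Longrightarrow> w (Suc k) = v k"
    by (auto simp: w_def insert_vertex_def)
  have we: "edge w 0 = closed_segment (v 0) z" "edge w (Suc 0) = closed_segment z (v 1)"
    "\<And>k. k > 0 \<Longrightarrow> edge w (Suc k) = edge v k"
    by (auto simp: w_def insert_vertex_edge)
  have v1: "v 1 \<notin> closed_segment (v 0) z" and v0: "v 0 \<notin> closed_segment z (v 1)"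
    using corner by auto
  have z: "z \<notin> edge v k" if "1 \<le> k" "k < n" for k
    using apart[OF that] corner by auto
  have ends: "v 0 \<in> edge v k \<longleftrightarrow> v 0 \<in> {v k, v (Suc k)}" "v 1 \<in> edge v k \<longleftrightarrow> v 1 \<in> {v k, v (Suc k)}"
    if "1 \<le> k" "k < n" for k
    using simple_polygonD(4)[OF v, of 0 k] that n by (auto simp: edge_def)
  have zv: "z \<noteq> v k" if "k \<le> n" for k
  proof (cases "k = 0 \<or> k = n")
    case False
    then have "v k \<in> edge v k" "1 \<le> k" "k < n" using that by (auto simp: edge_def)
    then show ?thesis using z by auto
  qed (use corner n in auto)
  have "v 0 \<noteq> v 1" using simple_polygon_edge_nontrivial[OF v, of 0] n by simp
  have e0: "edge w 0 \<inter> edge w (Suc k) = {w 0, w (Suc 0)} \<inter> {w (Suc k), w (Suc (Suc k))}" if "k < n" for k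
  proof (cases "k = 0")
    case True
    then show ?thesis using corner \<open>v 0 \<noteq> v 1\<close> by (auto simp: we w)
  next
    case False
    then have k: "1 \<le> k" "k < n" using that by auto
    then have "closed_segment (v 0) z \<inter> edge v k \<subseteq> {v 0}" using apart[OF k] v1 by auto
    then show ?thesis
      using ends[OF k] zv[of k] zv[of "Suc k"] k by (auto simp: we w)
  qed
  have e1: "edge w (Suc 0) \<inter> edge w (Suc k) = {w (Suc 0), w (Suc (Suc 0))} \<inter> {w (Suc k), w (Suc (Suc k))}"
    if k: "1 \<le> k" "k < n" for k
  proof -
    have "closed_segment z (v 1) \<inter> edge v k \<subseteq> {v 1}" using apart[OF k] v0 by auto
    then show ?thesis
      using ends[OF k] zv[of k] zv[of "Suc k"] k by (auto simp: we w)
  qed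
  have pairs: "edge w i \<inter> edge w j = {w i, w (Suc i)} \<inter> {w j, w (Suc j)}" if ij: "i < j" "j < Suc n" for i j
  proof -
    obtain k where k: "j = Suc k" using ij by (cases j) auto
    consider "i = 0" | "i = Suc 0" | l where "i = Suc l" "l > 0" by (cases i) force+
    then show ?thesis
    proof cases
      case 1
      then show ?thesis using e0[of k] k ij by auto
    next
      case 2
      then show ?thesis using e1[of k] k ij by auto
    next
      case 3
      then show ?thesis using simple_polygonD(4)[OF v, of l k] k ij by (auto simp: we w)
    qed
  qed
  show ?thesis
    unfolding w_def[symmetric] simple_polygon_def
  proof (intro conjI allI impI)
    show "w (Suc n) = w 0" using n by (simp add: w)
    show "inj_on w {..<Suc n}"
    proof (rule linorder_inj_onI')
      fix i j assume ij: "i \<in> {..<Suc n}" "j \<in> {..<Suc n}" "i < j"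
      then obtain k where k: "j = Suc k" "k < n" by (cases j) auto
      show "w i \<noteq> w j"
      proof (cases "k = 0")
        case True
        then show ?thesis using k ij corner(2) by (auto simp: w)
      next
        case False
        then have wj: "w j = v k" using k w by simp
        consider "i = 0" | "i = Suc 0" | l where "i = Suc l" "l > 0" by (cases i) force+
        then show ?thesis
        proof cases
          case 1
          then show ?thesis
            using simple_polygon_vertex_eq_iff[OF v, of 0 k] k False n by (auto simp: w wj)
        next
          case 2
          then have "w i = z" by (simp add: w)
          then show ?thesis using zv[of k] k(2) wj by (metis less_imp_le_nat)
        next
          case 3
          then show ?thesis
            using simple_polygon_vertex_eq_iff[OF v, of l k] k False ij by (auto simp: w wj)
        qed
      qed
    qed
    fix i j assume "i < Suc n" "j < Suc n" "i \<noteq> j"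
    then show "edge w i \<inter> edge w j = {w i, w (Suc i)} \<inter> {w j, w (Suc j)}"
      using pairs[of i j] pairs[of j i] by (cases "i < j") (auto simp: Int_commute)
  qed (use n in simp)
qed

text \<open>The inserted vertex travels from the middle of the edge to the apex of the triangle.  On the way
  the polygon stays simple, because the two new edges stay inside the triangle.\<close>

lemma triangle_move:
  assumes v: "simple_polygon n v" and off: "\<not> collinear {v 0, v 1, z}"
    and apart: "\<And>k. 1 \<le> k \<Longrightarrow> k < n \<Longrightarrow> convex hull {v 0, v 1, z} \<inter> edge v k \<subseteq> {v 0, v 1}"
  shows "simple_polygon (Suc n) (insert_vertex z v)"
    and "ambient_isotopic (polygon_set n v) (polygon_set (Suc n) (insert_vertex z v))"
proof -
  have n: "3 \<le> n" "v n = v 0" using simple_polygonD[OF v] by auto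
  define T where "T = convex hull {v 0, v 1, z}"
  define m where "m = midpoint (v 0) (v 1)"
  have ne: "v 0 \<noteq> v 1" using simple_polygon_edge_nontrivial[OF v, of 0] n by simp
  have m: "m \<in> closed_segment (v 0) (v 1)" unfolding m_def by (rule midpoint_in_closed_segment)
  have T: "v 0 \<in> T" "v 1 \<in> T" "z \<in> T" unfolding T_def by (auto intro: hull_inc)
  have cT: "convex T" by (simp add: T_def)
  have mT: "m \<in> T" using m closed_segment_subset[OF T(1,2) cT] by blast
  have simple: "simple_polygon (Suc n) (insert_vertex p v)" if p: "p \<in> closed_segment m z" for p
  proof (rule simple_polygon_insert_vertex[OF v])
    have pT: "p \<in> T" using p closed_segment_subset[OF mT T(3) cT] by blast
    show "(closed_segment (v 0) p \<union> closed_segment p (v 1)) \<inter> edge v k \<subseteq> {v 0, v 1}"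
      if "1 \<le> k" "k < n" for k
      using apart[OF that] closed_segment_subset[OF T(1) pT cT] closed_segment_subset[OF pT T(2) cT]
      unfolding T_def by blast
    obtain t where t: "0 \<le> t" "t \<le> 1" "p = (1 - t) *\<^sub>R m + t *\<^sub>R z"
      using p by (auto simp: closed_segment_def)
    define a b where "a = v 1 - v 0" and "b = z - v 0"
    have indep: "a \<times> b \<noteq> 0"
    proof -
      have "collinear {v 0, v 1, z} \<longleftrightarrow> collinear {0, a, b}"
        unfolding a_def b_def using collinear_3[of "v 1" "v 0" z] by (simp add: insert_commute)
      then show ?thesis using off cross_eq_0 by blast
    qed
    have p': "p = v 0 + ((1 - t) / 2) *\<^sub>R a + t *\<^sub>R b"
      unfolding t(3) m_def midpoint_def a_def b_def by (simp add: vec_eq_iff field_simps)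
    show "p \<noteq> v 0"
    proof
      assume "p = v 0"
      then have "((1 - t) / 2) *\<^sub>R a + t *\<^sub>R b = 0" using p' by simp
      from cross_nonzero_independent[OF indep this] show False by simp
    qed
    show "p \<noteq> v 1"
    proof
      assume "p = v 1"
      then have "((1 - t) / 2 - 1) *\<^sub>R a + t *\<^sub>R b = 0" using p' by (simp add: a_def algebra_simps)
      from cross_nonzero_independent[OF indep this] show False by simp
    qed
    show "closed_segment (v 0) p \<inter> closed_segment p (v 1) = {p}"
    proof
      show "closed_segment (v 0) p \<inter> closed_segment p (v 1) \<subseteq> {p}"
      proof
        fix x assume x: "x \<in> closed_segment (v 0) p \<inter> closed_segment p (v 1)"
        obtain r where r: "0 \<le> r" "r \<le> 1" "x = (1 - r) *\<^sub>R v 0 + r *\<^sub>R p"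
          using x by (auto simp: closed_segment_def)
        obtain s where s: "0 \<le> s" "s \<le> 1" "x = (1 - s) *\<^sub>R p + s *\<^sub>R v 1"
          using x by (auto simp: closed_segment_def)
        have "x - v 0 = (r * ((1 - t) / 2)) *\<^sub>R a + (r * t) *\<^sub>R b"
          unfolding r(3) p' by (simp add: algebra_simps)
        moreover have "x - v 0 = ((1 - s) * ((1 - t) / 2) + s) *\<^sub>R a + ((1 - s) * t) *\<^sub>R b"
        proof -
          have "v 1 = v 0 + a" by (simp add: a_def)
          then show ?thesis unfolding s(3) p' by (simp add: algebra_simps)
        qed
        ultimately have "(r * ((1 - t) / 2) - ((1 - s) * ((1 - t) / 2) + s)) *\<^sub>R a + (r * t - (1 - s) * t) *\<^sub>R b = 0"
          by (simp add: algebra_simps)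
        note eqs = cross_nonzero_independent[OF indep this]
        have e2: "t = 0 \<or> r = 1 - s" using eqs(2) by auto
        have "s = 0 \<and> r = 1"
        proof (cases "t = 0")
          case True
          then show ?thesis using eqs(1) r s by (auto simp: field_simps)
        next
          case False
          then have "r = 1 - s" using e2 by simp
          then show ?thesis using eqs(1) by simp
        qed
        then show "x \<in> {p}" using r by simp
      qed
    qed auto
  qed
  show "simple_polygon (Suc n) (insert_vertex z v)" by (rule simple) simp
  have "ambient_isotopic (polygon_set (Suc n) ((insert_vertex z v)(1 := m)))
      (polygon_set (Suc n) ((insert_vertex z v)(1 := z)))"
  proof (rule polygon_vertex_move)
    fix p assume "p \<in> closed_segment m z"
    moreover have "(insert_vertex z v)(1 := p) = insert_vertex p v"
      by (auto simp: insert_vertex_def)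
    ultimately show "simple_polygon (Suc n) ((insert_vertex z v)(1 := p))" using simple by simp
  qed (use n in auto)
  moreover have "(insert_vertex z v)(1 := m) = insert_vertex m v" "(insert_vertex z v)(1 := z) = insert_vertex z v"
    by (auto simp: insert_vertex_def)
  moreover have "polygon_set (Suc n) (insert_vertex m v) = polygon_set n v"
  proof -
    have "closed_segment (v 0) m \<union> closed_segment m (v 1) = edge v 0"
      using Un_closed_segment[OF m] by (simp add: edge_def)
    moreover have "{..<n} = insert 0 {1..<n}" using n by auto
    ultimately show ?thesis
      using insert_vertex_polygon_set[of n m v] n by (auto simp: polygon_set_def)
  qed
  ultimately show "ambient_isotopic (polygon_set n v) (polygon_set (Suc n) (insert_vertex z v))"
    by simp
qed

text \<open>The apex \<open>\<epsilon> *\<^sub>R d\<close> is close to the vertex \<open>0\<close>, and the triangle over the first edge is thin.  Seen from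
  that vertex, the second edge leaves \<open>v 1\<close> to one side and the triangle to the opposite side, as \<open>y > 0\<close>;
  so they meet in \<open>v 1\<close> only.  The last edge is kept off by hypothesis, and the others by thinness.\<close>

lemma bend_first_edge:
  assumes v: "simple_polygon n v" and v0: "v 0 = 0" and indep: "v 1 \<times> v 2 \<noteq> 0"
    and d: "d = x *\<^sub>R v 1 - y *\<^sub>R v 2" "y > 0"
    and last: "\<And>\<alpha> \<beta>. \<alpha> \<ge> 0 \<Longrightarrow> \<beta> \<ge> 0 \<Longrightarrow> \<alpha> *\<^sub>R v 1 + \<beta> *\<^sub>R d \<noteq> v (n - 1)"
  obtains \<epsilon> where "\<epsilon> > 0" "simple_polygon (Suc n) (insert_vertex (\<epsilon> *\<^sub>R d) v)"
    "ambient_isotopic (polygon_set n v) (polygon_set (Suc n) (insert_vertex (\<epsilon> *\<^sub>R d) v))"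
proof -
  have n: "3 \<le> n" "v n = v 0" using simple_polygonD[OF v] by auto
  \<comment> \<open>The edges that are disjoint from the first one.\<close>
  define R where "R = (\<Union>k\<in>{2..<n-1}. edge v k)"
  have "compact (edge v 0)" "closed R" unfolding R_def by (auto simp: edge_def)
  moreover have "edge v 0 \<inter> R = {}"
  proof -
    have "edge v 0 \<inter> edge v k = {}" if k: "2 \<le> k" "k < n - 1" for k
    proof -
      have "v 0 \<noteq> v k" "v 0 \<noteq> v (Suc k)" "v 1 \<noteq> v k" "v 1 \<noteq> v (Suc k)"
        using k n simple_polygon_vertex_eq_iff[OF v, of 0 k] simple_polygon_vertex_eq_iff[OF v, of 0 "Suc k"]
          simple_polygon_vertex_eq_iff[OF v, of 1 k] simple_polygon_vertex_eq_iff[OF v, of 1 "Suc k"] by auto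
      then show ?thesis using simple_polygonD(4)[OF v, of 0 k] k by auto
    qed
    then show ?thesis unfolding R_def by fastforce
  qed
  ultimately obtain \<rho> where \<rho>: "\<rho> > 0" "\<And>x y. x \<in> edge v 0 \<Longrightarrow> y \<in> R \<Longrightarrow> \<rho> \<le> dist x y"
    using separate_compact_closed by metis
  define \<epsilon> where "\<epsilon> = \<rho> / (2 * (norm d + 1))"
  have \<epsilon>: "\<epsilon> > 0" using \<rho>(1) by (auto simp: \<epsilon>_def add_nonneg_pos intro!: divide_pos_pos mult_pos_pos)
  have small: "norm (\<epsilon> *\<^sub>R d) < \<rho>"
  proof -
    have "norm (\<epsilon> *\<^sub>R d) = \<rho> * (norm d / (2 * (norm d + 1)))" using \<epsilon> \<rho>(1) by (simp add: \<epsilon>_def)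
    also have "\<dots> < \<rho> * 1"
    proof (intro mult_strict_left_mono \<rho>(1))
      have "0 < norm d + 1" by (simp add: add_nonneg_pos)
      then have "0 < 2 * (norm d + 1)" "norm d < 2 * (norm d + 1)" by (simp_all add: algebra_simps)
      then show "norm d / (2 * (norm d + 1)) < 1" by (simp only: divide_less_eq_1_pos)
    qed
    finally show ?thesis by simp
  qed
  define z where "z = \<epsilon> *\<^sub>R d"
  have d1: "d \<times> v 1 = y *\<^sub>R (v 1 \<times> v 2)"
    unfolding d(1) by (simp add: Cross3.left_diff_distrib cross_mult_left cross_skew[of "v 2" "v (Suc 0)"])
  have z1: "v 1 \<times> z \<noteq> 0"
  proof -
    have "v 1 \<times> z = - (\<epsilon> *\<^sub>R (d \<times> v 1))"
      unfolding z_def by (simp add: cross_mult_right cross_skew[of "v (Suc 0)" d])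
    then show ?thesis using d1 \<epsilon> d(2) indep by simp
  qed
  have off: "\<not> collinear {v 0, v 1, z}" using z1 v0 cross_eq_0 by metis
  have T: "\<exists>\<alpha> \<beta>. 0 \<le> \<alpha> \<and> \<alpha> \<le> 1 \<and> 0 \<le> \<beta> \<and> \<beta> \<le> 1 \<and> p = \<alpha> *\<^sub>R v 1 + \<beta> *\<^sub>R z"
    if p: "p \<in> convex hull {v 0, v 1, z}" for p
  proof -
    obtain r s t where "0 \<le> r" "0 \<le> s" "0 \<le> t" "r + s + t = 1" "p = r *\<^sub>R v 0 + s *\<^sub>R v 1 + t *\<^sub>R z"
      using p unfolding convex_hull_3 by blast
    then show ?thesis using v0 by (intro exI[of _ s] exI[of _ t]) auto
  qed
  have apart: "convex hull {v 0, v 1, z} \<inter> edge v k \<subseteq> {v 0, v 1}" if k: "1 \<le> k" "k < n" for k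
  proof
    fix p assume p: "p \<in> convex hull {v 0, v 1, z} \<inter> edge v k"
    then obtain \<alpha> \<beta> where \<alpha>: "0 \<le> \<alpha>" "\<alpha> \<le> 1" "0 \<le> \<beta>" "\<beta> \<le> 1" "p = \<alpha> *\<^sub>R v 1 + \<beta> *\<^sub>R z" using T by blast
    obtain s where s: "0 \<le> s" "s \<le> 1" "p = (1 - s) *\<^sub>R v k + s *\<^sub>R v (Suc k)"
      using p by (auto simp: edge_def closed_segment_def)
    consider "k = 1" | "k = n - 1" | "2 \<le> k" "k < n - 1" using k by linarith
    then show "p \<in> {v 0, v 1}"
    proof cases
      case 1
      then have "(\<alpha> + \<beta> * \<epsilon> * x - (1 - s)) *\<^sub>R v 1 + (- (\<beta> * \<epsilon> * y) - s) *\<^sub>R v 2 = 0"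
        using s(3) \<alpha>(5) unfolding z_def d(1) by (simp add: algebra_simps numeral_2_eq_2)
      note eqs = cross_nonzero_independent[OF indep this]
      have "\<beta> * \<epsilon> * y \<ge> 0" using \<alpha> \<epsilon> d by simp
      then have "s = 0" using eqs(2) s by linarith
      then show ?thesis using s 1 by simp
    next
      case 2
      then have p': "p = (1 - s) *\<^sub>R v (n - 1)" using s n v0 k by simp
      show ?thesis
      proof (cases "s = 1")
        case False
        then have pos: "1 - s > 0" using s by simp
        have "v (n - 1) = (1 / (1 - s)) *\<^sub>R p" using p' pos by simp
        also have "\<dots> = (\<alpha> / (1 - s)) *\<^sub>R v 1 + (\<beta> * \<epsilon> / (1 - s)) *\<^sub>R d"
          unfolding \<alpha>(5) z_def by (simp add: scaleR_right_distrib)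
        finally show ?thesis using last[of "\<alpha> / (1 - s)" "\<beta> * \<epsilon> / (1 - s)"] \<alpha> \<epsilon> pos by simp
      qed (use p' v0 in simp)
    next
      case 3
      then have "p \<in> R" using p by (auto simp: R_def)
      moreover have "\<alpha> *\<^sub>R v 1 \<in> edge v 0"
        using \<alpha> v0 by (auto simp: edge_def closed_segment_def intro!: exI[of _ \<alpha>])
      ultimately have "\<rho> \<le> norm (\<beta> *\<^sub>R z)"
        using \<rho>(2)[of "\<alpha> *\<^sub>R v 1" p] \<alpha>(5) by (simp add: dist_norm)
      also have "\<dots> \<le> norm z" using \<alpha> mult_left_le_one_le[of "norm z" \<beta>] by simp
      finally show ?thesis using small by (simp add: z_def)
    qed
  qed
  show ?thesis
    using that[of \<epsilon>] \<epsilon> triangle_move[OF v off apart] unfolding z_def by blast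
qed

section \<open>Counting crossings seen from a vertex\<close>

text \<open>The direction, parallel to the plane orthogonal to \<open>u\<close>, in which the great circle through \<open>x\<close> and \<open>y\<close>
  leaves the open half space below that plane when it is followed from \<open>y\<close> to \<open>x\<close> and beyond.\<close>

definition horizontal :: "space \<Rightarrow> space \<Rightarrow> space \<Rightarrow> space" where
  "horizontal u x y = (1 / \<bar>u \<bullet> x\<bar>) *\<^sub>R x - (1 / \<bar>u \<bullet> y\<bar>) *\<^sub>R y"

lemma inner_horizontal: "u \<bullet> x < 0 \<Longrightarrow> u \<bullet> y < 0 \<Longrightarrow> u \<bullet> horizontal u x y = 0"
  by (simp add: horizontal_def inner_diff_right)

text \<open>The corner \<open>v 0\<close> is replaced by the detour \<open>b, t, a\<close>, where \<open>a\<close> is next to \<open>v 1\<close> and \<open>b\<close> next to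
  \<open>v (n - 1)\<close>; so \<open>t\<close> has the index \<open>0\<close>, and the vertices \<open>v i\<close> are shifted by one.\<close>

definition bent_polygon :: "nat \<Rightarrow> (nat \<Rightarrow> space) \<Rightarrow> space \<Rightarrow> space \<Rightarrow> space \<Rightarrow> nat \<Rightarrow> space" where
  "bent_polygon n v t a b i =
     (if i = 0 then t else if i = 1 then a else if i \<le> n then v (i - 1) else if i = Suc n then b else t)"

text \<open>The closed condition that the cones over two edges meet outside of \<open>0\<close> or are degenerate.  It also
  makes sense for polygons whose crossings are not transverse, and its negation is stable.\<close>

definition weakly_crossing :: "(nat \<Rightarrow> space) \<Rightarrow> nat \<Rightarrow> nat \<Rightarrow> bool" where
  "weakly_crossing q i j \<longleftrightarrow> (\<exists>a b c d. a \<ge> 0 \<and> b \<ge> 0 \<and> c \<ge> 0 \<and> d \<ge> 0 \<and> a + b + c + d > 0 \<and>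
     a *\<^sub>R q i + b *\<^sub>R q (Suc i) = c *\<^sub>R q j + d *\<^sub>R q (Suc j))"

lemma card_pairs_at_distance_two:
  assumes "m \<ge> 1"
  shows "finite {(k, l). 1 \<le> k \<and> k + 2 \<le> l \<and> l \<le> (m::nat)}"
    and "2 * card {(k, l). 1 \<le> k \<and> k + 2 \<le> l \<and> l \<le> m} = (m - 1) * (m - 2)"
proof -
  define P where "P = (\<lambda>m::nat. {(k, l). 1 \<le> k \<and> k + 2 \<le> l \<and> l \<le> m})"
  have fin: "finite (P m)" for m
    by (rule finite_subset[of _ "Sigma {..m} (\<lambda>_. {..m})"]) (auto simp: P_def)
  then show "finite {(k, l). 1 \<le> k \<and> k + 2 \<le> l \<and> l \<le> m}" by (simp add: P_def)
  have "2 * card (P m) = (m - 1) * (m - 2)"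
    using assms
  proof (induction m rule: nat_induct_at_least)
    case base
    have "P 1 = {}" by (auto simp: P_def)
    then show ?case by simp
  next
    case (Suc m)
    have "P (Suc m) = P m \<union> (\<lambda>k. (k, Suc m)) ` {1..<m}" by (auto simp: P_def le_Suc_eq)
    moreover have "P m \<inter> (\<lambda>k. (k, Suc m)) ` {1..<m} = {}" by (auto simp: P_def)
    ultimately have "card (P (Suc m)) = card (P m) + (m - 1)"
      using fin by (simp add: card_Un_disjoint card_image inj_on_def)
    moreover obtain k where "m = Suc k" using \<open>1 \<le> m\<close> by (cases m) auto
    ultimately show ?case using Suc.IH by (cases k) (auto simp: algebra_simps)
  qed
  then show "2 * card {(k, l). 1 \<le> k \<and> k + 2 \<le> l \<and> l \<le> m} = (m - 1) * (m - 2)" by (simp add: P_def)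
qed

text \<open>Edge \<open>i\<close> of the bent polygon, \<open>1 \<le> i \<le> n\<close>, lies in the plane spanned by \<open>v k\<close> and \<open>v (Suc k)\<close> for this \<open>k\<close>.\<close>

definition plane_index :: "nat \<Rightarrow> nat \<Rightarrow> nat" where
  "plane_index n i = (if i \<le> 1 then 1 else if i < n then i - 1 else n - 2)"

definition weak_pairs :: "nat \<Rightarrow> (nat \<Rightarrow> space) \<Rightarrow> (nat \<times> nat) set" where
  "weak_pairs n q = {(i, j). i < j \<and> j < n + 2 \<and> nonadjacent (n + 2) i j \<and> weakly_crossing q i j}"

context
  fixes n :: nat and v :: "nat \<Rightarrow> space" and q :: "nat \<Rightarrow> space" and u :: space and \<alpha>0 \<beta>0 \<kappa> :: real
  assumes n3: "3 \<le> n"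
    and gen: "generic (n - 1) (\<lambda>i. v (Suc i))"
    and below: "\<And>i. 1 \<le> i \<Longrightarrow> i < n \<Longrightarrow> u \<bullet> v i < 0"
    and not_parallel: "\<And>r. r > 0 \<Longrightarrow> horizontal u (v 1) (v 2) \<noteq> r *\<^sub>R horizontal u (v (n - 1)) (v (n - 2))"
    and pos: "\<alpha>0 > 0" "\<beta>0 > 0" "\<kappa> > 0"
    and q_def: "q = bent_polygon n v (\<kappa> *\<^sub>R u) (\<alpha>0 *\<^sub>R horizontal u (v 1) (v 2))
      (\<beta>0 *\<^sub>R horizontal u (v (n - 1)) (v (n - 2)))"
begin

lemma q_simps: "q 0 = \<kappa> *\<^sub>R u" "q (Suc 0) = \<alpha>0 *\<^sub>R horizontal u (v 1) (v 2)"
  "\<And>i. 2 \<le> i \<Longrightarrow> i \<le> n \<Longrightarrow> q i = v (i - 1)"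
  "q (Suc n) = \<beta>0 *\<^sub>R horizontal u (v (n - 1)) (v (n - 2))" "q (Suc (Suc n)) = \<kappa> *\<^sub>R u"
  using n3 by (auto simp: q_def bent_polygon_def)

lemma gen_cross: "1 \<le> i \<Longrightarrow> i < n \<Longrightarrow> 1 \<le> j \<Longrightarrow> j < n \<Longrightarrow> i \<noteq> j \<Longrightarrow> v i \<times> v j \<noteq> 0"
  using genericD(1)[OF gen, of "i - 1" "j - 1"] by auto

lemma gen_triple: "1 \<le> i \<Longrightarrow> i < n \<Longrightarrow> 1 \<le> j \<Longrightarrow> j < n \<Longrightarrow> 1 \<le> k \<Longrightarrow> k < n \<Longrightarrow>
    i \<noteq> j \<Longrightarrow> j \<noteq> k \<Longrightarrow> i \<noteq> k \<Longrightarrow> triple (v i) (v j) (v k) \<noteq> 0"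
  using genericD(2)[OF gen, of "i - 1" "j - 1" "k - 1"] by auto

lemma horizontal_nonzero:
  assumes "1 \<le> i" "i < n" "1 \<le> j" "j < n" "i \<noteq> j"
  shows "horizontal u (v i) (v j) \<noteq> 0"
proof
  assume "horizontal u (v i) (v j) = 0"
  then have "(1 / \<bar>u \<bullet> v i\<bar>) *\<^sub>R v i + (- (1 / \<bar>u \<bullet> v j\<bar>)) *\<^sub>R v j = 0" by (simp add: horizontal_def)
  from cross_nonzero_independent(1)[OF gen_cross[OF assms] this] show False
    using below[of i] assms by simp
qed

lemma plane_index_bounds: "1 \<le> plane_index n i" "Suc (plane_index n i) < n"
  using n3 by (auto simp: plane_index_def)

text \<open>The edges \<open>1\<close> and \<open>2\<close> span the same plane with the origin, and so do the edges \<open>n - 1\<close> and \<open>n\<close>.  In the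
  basis of such a plane, the sign of one coordinate tells the two edges apart.\<close>

lemma plane_coordinates:
  assumes i: "1 \<le> i" "i \<le> n" and ab: "a \<ge> 0" "b \<ge> 0" "a + b > 0"
  obtains \<alpha> \<beta> where "a *\<^sub>R q i + b *\<^sub>R q (Suc i) = \<alpha> *\<^sub>R v (plane_index n i) + \<beta> *\<^sub>R v (Suc (plane_index n i))"
    "i = 1 \<longrightarrow> \<alpha> > 0 \<and> \<beta> \<le> 0" "i = n \<longrightarrow> \<alpha> \<le> 0 \<and> \<beta> > 0" "1 < i \<and> i < n \<longrightarrow> \<alpha> \<ge> 0 \<and> \<beta> \<ge> 0"
    "\<alpha> \<noteq> 0 \<or> \<beta> \<noteq> 0"
proof -
  have h: "u \<bullet> v i < 0" if "1 \<le> i" "i < n" for i using below that .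
  have combo_pos: "a * x + b > 0" "a + b * x > 0" if "x > 0" for x
    using ab that by (smt (verit) mult_nonneg_nonneg mult_pos_pos zero_less_mult_iff)+
  consider "i = 1" | "1 < i" "i < n" | "i = n" using i by linarith
  then show ?thesis
  proof cases
    case 1
    define x y where "x = \<alpha>0 / \<bar>u \<bullet> v 1\<bar>" and "y = \<alpha>0 / \<bar>u \<bullet> v 2\<bar>"
    have xy: "x > 0" "y > 0" using pos h[of 1] h[of 2] n3 by (auto simp: x_def y_def divide_pos_neg)
    have "a *\<^sub>R q i + b *\<^sub>R q (Suc i) = (a * x + b) *\<^sub>R v (plane_index n i) + (- (a * y)) *\<^sub>R v (Suc (plane_index n i))"
      using 1 n3 q_simps(3)[of 2]
      by (simp add: q_simps plane_index_def horizontal_def x_def y_def algebra_simps numeral_2_eq_2)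
    moreover have "a * x + b > 0" "- (a * y) \<le> 0" using combo_pos xy ab by auto
    ultimately show ?thesis using that[of "a * x + b" "- (a * y)"] 1 n3 by auto
  next
    case 2
    then have "a *\<^sub>R q i + b *\<^sub>R q (Suc i) = a *\<^sub>R v (plane_index n i) + b *\<^sub>R v (Suc (plane_index n i))"
      by (simp add: q_simps plane_index_def)
    then show ?thesis using that[of a b] 2 ab by auto
  next
    case 3
    define x y where "x = \<beta>0 / \<bar>u \<bullet> v (n - 1)\<bar>" and "y = \<beta>0 / \<bar>u \<bullet> v (n - 2)\<bar>"
    have xy: "x > 0" "y > 0" using pos h[of "n - 1"] h[of "n - 2"] n3 unfolding x_def y_def
      by (intro conjI divide_pos_pos; force)+
    have S: "Suc (n - 2) = n - 1" using n3 by simp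
    have "a *\<^sub>R q i + b *\<^sub>R q (Suc i) = (- (b * y)) *\<^sub>R v (plane_index n i) + (a + b * x) *\<^sub>R v (Suc (plane_index n i))"
      using 3 n3 by (simp add: q_simps plane_index_def S horizontal_def x_def y_def algebra_simps)
    moreover have "a + b * x > 0" "- (b * y) \<le> 0" using combo_pos xy ab by auto
    ultimately show ?thesis using that[of "- (b * y)" "a + b * x"] 3 n3 by auto
  qed
qed

lemma edge_cone_nonzero:
  assumes "1 \<le> i" "i \<le> n" "a \<ge> 0" "b \<ge> 0" "a + b > 0"
  shows "a *\<^sub>R q i + b *\<^sub>R q (Suc i) \<noteq> 0"
proof
  assume 0: "a *\<^sub>R q i + b *\<^sub>R q (Suc i) = 0"
  obtain \<alpha> \<beta> where "a *\<^sub>R q i + b *\<^sub>R q (Suc i) = \<alpha> *\<^sub>R v (plane_index n i) + \<beta> *\<^sub>R v (Suc (plane_index n i))" "\<alpha> \<noteq> 0 \<or> \<beta> \<noteq> 0"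
    using plane_coordinates[OF assms] by metis
  moreover have "v (plane_index n i) \<times> v (Suc (plane_index n i)) \<noteq> 0" using plane_index_bounds[of i] by (intro gen_cross) auto
  ultimately show False using 0 cross_nonzero_independent by metis
qed

text \<open>The edges \<open>1, \<dots>, n\<close> are below the horizon, and they touch it only in the end points \<open>q 1\<close> and \<open>q (n + 1)\<close>.\<close>

lemma below_plane: "1 \<le> i \<Longrightarrow> i \<le> Suc n \<Longrightarrow> u \<bullet> q i \<le> 0"
  and strictly_below_plane: "2 \<le> i \<Longrightarrow> i \<le> n \<Longrightarrow> u \<bullet> q i < 0"
  and on_plane: "u \<bullet> q (Suc 0) = 0" "u \<bullet> q (Suc n) = 0"
proof -
  show lt: "u \<bullet> q i < 0" if "2 \<le> i" "i \<le> n" for i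
    using that below[of "i - 1"] by (simp add: q_simps)
  show eq: "u \<bullet> q (Suc 0) = 0" "u \<bullet> q (Suc n) = 0"
    using inner_horizontal[of u "v 1" "v 2"] inner_horizontal[of u "v (n - 1)" "v (n - 2)"]
      below[of 1] below[of 2] below[of "n - 1"] below[of "n - 2"] n3
    by (auto simp: q_simps)
  show "u \<bullet> q i \<le> 0" if "1 \<le> i" "i \<le> Suc n"
    using that lt[of i] eq by (cases "i = 1 \<or> i = Suc n") auto
qed

lemma u_nonzero: "u \<noteq> 0"
  using below[of 1] n3 by auto

lemma ends_not_parallel:
  assumes "a \<ge> 0" "b \<ge> 0" "a + b > 0" shows "a *\<^sub>R q (Suc 0) \<noteq> b *\<^sub>R q (Suc n)"
proof
  assume eq: "a *\<^sub>R q (Suc 0) = b *\<^sub>R q (Suc n)"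
  have nz: "q (Suc 0) \<noteq> 0" "q (Suc n) \<noteq> 0"
    using horizontal_nonzero[of 1 2] horizontal_nonzero[of "n - 1" "n - 2"] n3 pos by (auto simp: q_simps)
  then have ab: "a > 0" "b > 0" using eq assms by (auto simp: less_le)
  have "(a * \<alpha>0) *\<^sub>R horizontal u (v 1) (v 2) = (b * \<beta>0) *\<^sub>R horizontal u (v (n - 1)) (v (n - 2))"
    using eq by (simp add: q_simps)
  then have "(1 / (a * \<alpha>0)) *\<^sub>R ((a * \<alpha>0) *\<^sub>R horizontal u (v 1) (v 2)) =
      (1 / (a * \<alpha>0)) *\<^sub>R ((b * \<beta>0) *\<^sub>R horizontal u (v (n - 1)) (v (n - 2)))"
    by simp
  then have "horizontal u (v 1) (v 2) = (b * \<beta>0 / (a * \<alpha>0)) *\<^sub>R horizontal u (v (n - 1)) (v (n - 2))"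
    using ab pos by simp
  then show False using not_parallel[of "b * \<beta>0 / (a * \<alpha>0)"] ab pos by simp
qed

text \<open>The edges \<open>0\<close> and \<open>n + 1\<close> lead from the horizon upwards, where the other edges are not; and they reach
  the horizon in different directions.\<close>

lemma top_edges_free:
  assumes w: "weakly_crossing q i j" and ij: "i < j" "j < n + 2" and ap: "nonadjacent (n + 2) i j"
  shows "1 \<le> i" "j \<le> n"
proof -
  obtain a b c d where c: "a \<ge> 0" "b \<ge> 0" "c \<ge> 0" "d \<ge> 0" "a + b + c + d > 0"
    "a *\<^sub>R q i + b *\<^sub>R q (Suc i) = c *\<^sub>R q j + d *\<^sub>R q (Suc j)"
    using w unfolding weakly_crossing_def by blast
  have uu: "u \<bullet> u > 0" using u_nonzero by simp
  have ineq: "a * (u \<bullet> q i) + b * (u \<bullet> q (Suc i)) = c * (u \<bullet> q j) + d * (u \<bullet> q (Suc j))"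
    using arg_cong[OF c(6), of "\<lambda>x. u \<bullet> x"] by (simp add: inner_add_right)
  show "1 \<le> i"
  proof (rule ccontr)
    assume "\<not> 1 \<le> i"
    then have i: "i = 0" by simp
    then have j: "2 \<le> j" "j \<le> n" using ap ij n3 by (auto simp: nonadjacent_def next_index_def split: if_splits)
    have eq: "a * \<kappa> * (u \<bullet> u) = c * (u \<bullet> q j) + d * (u \<bullet> q (Suc j))"
      using ineq i on_plane q_simps(1) by simp
    have np: "c * (u \<bullet> q j) \<le> 0" "d * (u \<bullet> q (Suc j)) \<le> 0" "0 \<le> a * \<kappa> * (u \<bullet> u)"
      using below_plane[of j] below_plane[of "Suc j"] j c pos by (auto simp: mult_le_0_iff)
    then have zero: "a * \<kappa> * (u \<bullet> u) = 0" "c * (u \<bullet> q j) = 0" "d * (u \<bullet> q (Suc j)) = 0" using eq by linarith+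
    then have "a = 0" "c = 0" using uu pos strictly_below_plane[of j] j by auto
    show False
    proof (cases "j = n")
      case True
      then show False using ends_not_parallel[of b d] c \<open>a = 0\<close> \<open>c = 0\<close> i by simp
    next
      case False
      then have "d = 0" using zero(3) strictly_below_plane[of "Suc j"] j by auto
      then show False using ends_not_parallel[of b 0] c \<open>a = 0\<close> \<open>c = 0\<close> i by simp
    qed
  qed
  then have i1: "1 \<le> i" .
  show "j \<le> n"
  proof (rule ccontr)
    assume "\<not> j \<le> n"
    then have j: "j = Suc n" using ij by simp
    then have i: "1 \<le> i" "Suc i \<le> n" using ap ij i1 by (auto simp: nonadjacent_def next_index_def)
    have eq: "a * (u \<bullet> q i) + b * (u \<bullet> q (Suc i)) = d * \<kappa> * (u \<bullet> u)"
      using ineq j on_plane q_simps(5) by simp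
    have np: "a * (u \<bullet> q i) \<le> 0" "b * (u \<bullet> q (Suc i)) \<le> 0" "0 \<le> d * \<kappa> * (u \<bullet> u)"
      using below_plane[of i] below_plane[of "Suc i"] i c pos by (auto simp: mult_le_0_iff)
    then have zero: "d * \<kappa> * (u \<bullet> u) = 0" "a * (u \<bullet> q i) = 0" "b * (u \<bullet> q (Suc i)) = 0" using eq by linarith+
    then have "d = 0" "b = 0" using uu pos strictly_below_plane[of "Suc i"] i by auto
    show False
    proof (cases "i = 1")
      case True
      then show False using ends_not_parallel[of a c] c \<open>d = 0\<close> \<open>b = 0\<close> j by simp
    next
      case False
      then have "a = 0" using zero(2) strictly_below_plane[of i] i by auto
      then show False using ends_not_parallel[of 0 c] c \<open>d = 0\<close> \<open>b = 0\<close> j by simp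
    qed
  qed
qed

lemma weak_pair_coordinates:
  assumes "(i, j) \<in> weak_pairs n q"
  obtains \<alpha> \<beta> \<gamma> \<epsilon> where "1 \<le> i" "i < j" "j \<le> n" "j \<noteq> Suc i"
    "\<alpha> *\<^sub>R v (plane_index n i) + \<beta> *\<^sub>R v (Suc (plane_index n i)) = \<gamma> *\<^sub>R v (plane_index n j) + \<epsilon> *\<^sub>R v (Suc (plane_index n j))"
    "\<alpha> \<ge> 0" "i = 1 \<longrightarrow> \<alpha> > 0 \<and> \<beta> \<le> 0" "1 < i \<longrightarrow> \<beta> \<ge> 0" "\<alpha> \<noteq> 0 \<or> \<beta> \<noteq> 0"
    "j = n \<longrightarrow> \<gamma> \<le> 0 \<and> \<epsilon> > 0" "j < n \<longrightarrow> \<gamma> \<ge> 0"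
proof -
  have ij: "i < j" "j < n + 2" "nonadjacent (n + 2) i j" "weakly_crossing q i j"
    using assms by (auto simp: weak_pairs_def)
  then have ij': "1 \<le> i" "j \<le> n" using top_edges_free by auto
  obtain a b c d where c: "a \<ge> 0" "b \<ge> 0" "c \<ge> 0" "d \<ge> 0" "a + b + c + d > 0"
    "a *\<^sub>R q i + b *\<^sub>R q (Suc i) = c *\<^sub>R q j + d *\<^sub>R q (Suc j)"
    using ij(4) unfolding weakly_crossing_def by blast
  have ab: "a + b > 0"
  proof (rule ccontr)
    assume "\<not> a + b > 0"
    then have "a = 0" "b = 0" using c by auto
    then show False using edge_cone_nonzero[of j c d] c ij ij' by simp
  qed
  have cd: "c + d > 0"
  proof (rule ccontr)
    assume "\<not> c + d > 0"
    then have "c = 0" "d = 0" using c by auto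
    then show False using edge_cone_nonzero[of i a b] c ij ij' by simp
  qed
  have range: "i \<le> n" "1 \<le> j" "i < n" "1 < j" using ij ij' by auto
  obtain \<alpha> \<beta> where \<alpha>:
    "a *\<^sub>R q i + b *\<^sub>R q (Suc i) = \<alpha> *\<^sub>R v (plane_index n i) + \<beta> *\<^sub>R v (Suc (plane_index n i))"
    "i = 1 \<longrightarrow> \<alpha> > 0 \<and> \<beta> \<le> 0" "i = n \<longrightarrow> \<alpha> \<le> 0 \<and> \<beta> > 0" "1 < i \<and> i < n \<longrightarrow> \<alpha> \<ge> 0 \<and> \<beta> \<ge> 0" "\<alpha> \<noteq> 0 \<or> \<beta> \<noteq> 0"
    using plane_coordinates[OF ij'(1) range(1) c(1,2) ab] by metis
  obtain \<gamma> \<epsilon> where \<gamma>: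
    "c *\<^sub>R q j + d *\<^sub>R q (Suc j) = \<gamma> *\<^sub>R v (plane_index n j) + \<epsilon> *\<^sub>R v (Suc (plane_index n j))"
    "j = 1 \<longrightarrow> \<gamma> > 0 \<and> \<epsilon> \<le> 0" "j = n \<longrightarrow> \<gamma> \<le> 0 \<and> \<epsilon> > 0" "1 < j \<and> j < n \<longrightarrow> \<gamma> \<ge> 0 \<and> \<epsilon> \<ge> 0"
    "\<gamma> \<noteq> 0 \<or> \<epsilon> \<noteq> 0"
    using plane_coordinates[OF range(2) ij'(2) c(3,4) cd] by metis
  show ?thesis
  proof (rule that[of \<alpha> \<beta> \<gamma> \<epsilon>])
    show "\<alpha> *\<^sub>R v (plane_index n i) + \<beta> *\<^sub>R v (Suc (plane_index n i)) = \<gamma> *\<^sub>R v (plane_index n j) + \<epsilon> *\<^sub>R v (Suc (plane_index n j))"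
      using c(6) \<alpha>(1) \<gamma>(1) by simp
    show "j \<noteq> Suc i" using ij ij' by (auto simp: nonadjacent_def next_index_def)
    show "\<alpha> \<ge> 0" using \<alpha>(2,4) ij'(1) range by (cases "i = 1") auto
  qed (use \<alpha> \<gamma> ij ij' range in auto)
qed

text \<open>Neighbouring planes \<open>k\<close> and \<open>k + 1\<close> intersect in the line of \<open>v (k + 1)\<close>.  The two edges that end in
  this vertex are adjacent, and the added edges \<open>1\<close> and \<open>n\<close> do not meet the line.\<close>

lemma weak_pair_planes_apart:
  assumes "(i, j) \<in> weak_pairs n q"
  shows "plane_index n i + 2 \<le> plane_index n j"
proof -
  obtain \<alpha> \<beta> \<gamma> \<epsilon> where c: "1 \<le> i" "i < j" "j \<le> n" "j \<noteq> Suc i"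
    "\<alpha> *\<^sub>R v (plane_index n i) + \<beta> *\<^sub>R v (Suc (plane_index n i)) = \<gamma> *\<^sub>R v (plane_index n j) + \<epsilon> *\<^sub>R v (Suc (plane_index n j))"
    "\<alpha> \<ge> 0" "i = 1 \<longrightarrow> \<alpha> > 0 \<and> \<beta> \<le> 0" "1 < i \<longrightarrow> \<beta> \<ge> 0" "\<alpha> \<noteq> 0 \<or> \<beta> \<noteq> 0"
    "j = n \<longrightarrow> \<gamma> \<le> 0 \<and> \<epsilon> > 0" "j < n \<longrightarrow> \<gamma> \<ge> 0"
    using weak_pair_coordinates[OF assms] by blast
  have "plane_index n i \<noteq> plane_index n j"
  proof
    assume same: "plane_index n i = plane_index n j"
    then have ij: "i = 1" "j = n" "n = 3" using c(1-4) by (auto simp: plane_index_def split: if_splits)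
    have "v (plane_index n i) \<times> v (Suc (plane_index n i)) \<noteq> 0" using plane_index_bounds[of i] by (intro gen_cross) auto
    moreover have "(\<alpha> - \<gamma>) *\<^sub>R v (plane_index n i) + (\<beta> - \<epsilon>) *\<^sub>R v (Suc (plane_index n i)) = 0"
      using c(5) same by (simp add: algebra_simps)
    ultimately have "\<alpha> - \<gamma> = 0" using cross_nonzero_independent by blast
    then show False using c(7,10) ij by auto
  qed
  moreover have "plane_index n j \<noteq> Suc (plane_index n i)"
  proof
    assume adj: "plane_index n j = Suc (plane_index n i)"
    have "triple (v (plane_index n i)) (v (Suc (plane_index n i))) (v (Suc (Suc (plane_index n i)))) \<noteq> 0"
      using plane_index_bounds[of i] plane_index_bounds[of j] adj by (intro gen_triple) auto
    moreover have "\<alpha> *\<^sub>R v (plane_index n i) + (\<beta> - \<gamma>) *\<^sub>R v (Suc (plane_index n i)) + (- \<epsilon>) *\<^sub>R v (Suc (Suc (plane_index n i))) = 0"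
      using c(5) adj by (simp add: algebra_simps)
    ultimately have "\<alpha> = 0" "- \<epsilon> = 0" using triple_nonzero_independent by blast+
    then have "i \<noteq> 1" "j \<noteq> n" using c(7,10) by auto
    then show False using adj c(1-4) by (auto simp: plane_index_def split: if_splits)
  qed
  moreover have "plane_index n i \<le> plane_index n j" using c(1-3) n3 by (simp add: plane_index_def; arith)
  ultimately show ?thesis by linarith
qed

lemma weak_pair_coordinates_nonzero:
  assumes ij: "plane_index n i + 2 \<le> plane_index n j" and "\<alpha> \<noteq> 0 \<or> \<beta> \<noteq> 0"
    and eq: "\<alpha> *\<^sub>R v (plane_index n i) + \<beta> *\<^sub>R v (Suc (plane_index n i)) = \<gamma> *\<^sub>R v (plane_index n j) + \<epsilon> *\<^sub>R v (Suc (plane_index n j))"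
  shows "\<alpha> \<noteq> 0" "\<beta> \<noteq> 0" "\<gamma> \<noteq> 0"
proof -
  define a b c d where "a = v (plane_index n i)" and "b = v (Suc (plane_index n i))" and "c = v (plane_index n j)" and "d = v (Suc (plane_index n j))"
  have trips: "triple b c d \<noteq> 0" "triple a c d \<noteq> 0" "triple a b d \<noteq> 0"
    unfolding a_def b_def c_def d_def using plane_index_bounds[of i] plane_index_bounds[of j] ij
    by (intro gen_triple; simp)+
  have eq: "\<alpha> *\<^sub>R a + \<beta> *\<^sub>R b = \<gamma> *\<^sub>R c + \<epsilon> *\<^sub>R d" using eq by (simp add: a_def b_def c_def d_def)
  have "\<beta> = 0" if "\<alpha> = 0"
  proof -
    have "\<beta> *\<^sub>R b + (- \<gamma>) *\<^sub>R c + (- \<epsilon>) *\<^sub>R d = 0" using eq that by (simp add: algebra_simps)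
    then show ?thesis by (rule triple_nonzero_independent(1)[OF trips(1)])
  qed
  moreover have "\<alpha> = 0" if "\<beta> = 0"
  proof -
    have "\<alpha> *\<^sub>R a + (- \<gamma>) *\<^sub>R c + (- \<epsilon>) *\<^sub>R d = 0" using eq that by (simp add: algebra_simps)
    then show ?thesis by (rule triple_nonzero_independent(1)[OF trips(2)])
  qed
  moreover have "\<alpha> = 0" if "\<gamma> = 0"
  proof -
    have "\<alpha> *\<^sub>R a + \<beta> *\<^sub>R b + (- \<epsilon>) *\<^sub>R d = 0" using eq that by (simp add: algebra_simps)
    then show ?thesis by (rule triple_nonzero_independent(1)[OF trips(3)])
  qed
  ultimately show "\<alpha> \<noteq> 0" "\<beta> \<noteq> 0" "\<gamma> \<noteq> 0" using assms(2) by auto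
qed

text \<open>The ends of the edges that span two planes satisfy only one linear relation up to a factor.  The factor
  between two crossing pairs is positive, because both first coordinates \<open>\<alpha>\<close> and \<open>\<alpha>'\<close> are.  So the two planes
  determine the signs that tell the edges in the same plane apart.\<close>

lemma inj_on_plane_indices: "inj_on (\<lambda>(i, j). (plane_index n i, plane_index n j)) (weak_pairs n q)"
proof (rule inj_onI, clarify)
  fix i j i' j' assume p: "(i, j) \<in> weak_pairs n q" and p': "(i', j') \<in> weak_pairs n q"
    and same: "plane_index n i = plane_index n i'" "plane_index n j = plane_index n j'"
  obtain \<alpha> \<beta> \<gamma> \<epsilon> where c: "1 \<le> i" "i < j" "j \<le> n" "j \<noteq> Suc i"
    "\<alpha> *\<^sub>R v (plane_index n i) + \<beta> *\<^sub>R v (Suc (plane_index n i)) = \<gamma> *\<^sub>R v (plane_index n j) + \<epsilon> *\<^sub>R v (Suc (plane_index n j))"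
    "\<alpha> \<ge> 0" "i = 1 \<longrightarrow> \<alpha> > 0 \<and> \<beta> \<le> 0" "1 < i \<longrightarrow> \<beta> \<ge> 0" "\<alpha> \<noteq> 0 \<or> \<beta> \<noteq> 0"
    "j = n \<longrightarrow> \<gamma> \<le> 0 \<and> \<epsilon> > 0" "j < n \<longrightarrow> \<gamma> \<ge> 0"
    using weak_pair_coordinates[OF p] by blast
  obtain \<alpha>' \<beta>' \<gamma>' \<epsilon>' where c': "1 \<le> i'" "i' < j'" "j' \<le> n" "j' \<noteq> Suc i'"
    "\<alpha>' *\<^sub>R v (plane_index n i) + \<beta>' *\<^sub>R v (Suc (plane_index n i)) = \<gamma>' *\<^sub>R v (plane_index n j) + \<epsilon>' *\<^sub>R v (Suc (plane_index n j))"
    "\<alpha>' \<ge> 0" "i' = 1 \<longrightarrow> \<alpha>' > 0 \<and> \<beta>' \<le> 0" "1 < i' \<longrightarrow> \<beta>' \<ge> 0" "\<alpha>' \<noteq> 0 \<or> \<beta>' \<noteq> 0"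
    "j' = n \<longrightarrow> \<gamma>' \<le> 0 \<and> \<epsilon>' > 0" "j' < n \<longrightarrow> \<gamma>' \<ge> 0"
    using weak_pair_coordinates[OF p'] unfolding same by blast
  have far: "plane_index n i + 2 \<le> plane_index n j" by (rule weak_pair_planes_apart[OF p])
  note nz = weak_pair_coordinates_nonzero[OF far c(9,5)] weak_pair_coordinates_nonzero[OF far c'(9,5)]
  have pos': "\<alpha> > 0" "\<alpha>' > 0" using nz c(6) c'(6) by auto
  have "triple (v (Suc (plane_index n i))) (v (plane_index n j)) (v (Suc (plane_index n j))) \<noteq> 0"
    using plane_index_bounds[of i] plane_index_bounds[of j] far by (intro gen_triple) auto
  note rel = four_vector_relation_unique[OF this c(5) c'(5)]
  have signs: "\<beta> > 0 \<longleftrightarrow> \<beta>' > 0" "\<gamma> > 0 \<longleftrightarrow> \<gamma>' > 0"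
    using rel(1,2) pos' by (metis mult.commute zero_less_mult_pos zero_less_mult_pos2 mult_pos_pos)+
  have "i = i'"
  proof (rule ccontr)
    assume "i \<noteq> i'"
    then have "i = 1 \<and> 1 < i' \<or> i' = 1 \<and> 1 < i"
      using same(1) far c(1-3) c'(1-3) plane_index_bounds[of j] by (auto simp: plane_index_def split: if_splits)
    then show False using signs(1) nz c(7,8) c'(7,8) by fastforce
  qed
  moreover have "j = j'"
  proof (rule ccontr)
    assume "j \<noteq> j'"
    then have "j = n \<and> j' < n \<or> j' = n \<and> j < n"
      using same(2) far c(1-3) c'(1-3) plane_index_bounds[of i] by (auto simp: plane_index_def split: if_splits)
    then show False using signs(2) nz c(10,11) c'(10,11) by fastforce
  qed
  ultimately show "i = i' \<and> j = j'" by simp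
qed

lemma card_weak_pairs: "finite (weak_pairs n q)" "2 * card (weak_pairs n q) \<le> (n - 3) * (n - 4)"
proof -
  define P where "P = {(k, l). 1 \<le> k \<and> k + 2 \<le> l \<and> l \<le> n - 2}"
  have P: "finite P" "2 * card P = (n - 3) * (n - 4)"
    using card_pairs_at_distance_two[of "n - 2"] n3 unfolding P_def by (auto simp: numeral_eq_Suc)
  have sub: "(\<lambda>(i, j). (plane_index n i, plane_index n j)) ` weak_pairs n q \<subseteq> P"
  proof clarify
    fix i j assume "(i, j) \<in> weak_pairs n q"
    then show "(plane_index n i, plane_index n j) \<in> P"
      using weak_pair_planes_apart[of i j] plane_index_bounds[of i] plane_index_bounds[of j] by (auto simp: P_def)
  qed
  show "finite (weak_pairs n q)"
    using finite_imageD[OF finite_subset[OF sub P(1)] inj_on_plane_indices] .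
  show "2 * card (weak_pairs n q) \<le> (n - 3) * (n - 4)"
    using card_inj_on_le[OF inj_on_plane_indices sub P(1)] P(2) by simp
qed

end

section \<open>Construction of the diagram\<close>

lemma finite_positive_lower_bound:
  fixes f :: "'a \<Rightarrow> real"
  assumes "finite I" "\<And>i. i \<in> I \<Longrightarrow> f i > 0"
  obtains \<delta> where "\<delta> > 0" "\<And>i. i \<in> I \<Longrightarrow> \<delta> \<le> f i"
proof -
  define \<delta> where "\<delta> = Min (insert 1 (f ` I))"
  have "\<delta> > 0" unfolding \<delta>_def using assms by (subst Min_gr_iff) auto
  moreover have "\<delta> \<le> f i" if "i \<in> I" for i
    unfolding \<delta>_def using assms(1) that by (intro Min_le) auto
  ultimately show ?thesis using that by blast
qed

lemma convex_hull_4_nested: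
  assumes "x \<in> convex hull {a, b, c, d :: 'a::real_vector}"
  obtains r s t where "0 \<le> r" "r \<le> 1" "0 \<le> s" "s \<le> 1" "0 \<le> t" "t \<le> (1::real)"
    "x = (1 - r) *\<^sub>R a + r *\<^sub>R ((1 - s) *\<^sub>R b + s *\<^sub>R ((1 - t) *\<^sub>R c + t *\<^sub>R d))"
  using assms by (auto simp: convex_hull_insert_alt)

text \<open>A pair of edges that does not cross weakly has \<open>0\<close> at a positive distance from the convex hull of the
  ends of one edge and the negatives of the ends of the other.\<close>

lemma weakly_crossing_stable:
  assumes "q N = q 0"
  obtains \<eta> where "\<eta> > 0" "\<And>q' i j. q' N = q' 0 \<Longrightarrow> (\<And>k. k < N \<Longrightarrow> norm (q' k - q k) < \<eta>) \<Longrightarrow>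
    i < N \<Longrightarrow> j < N \<Longrightarrow> weakly_crossing q' i j \<Longrightarrow> weakly_crossing q i j"
proof -
  define S where "S = (\<lambda>p. convex hull {q (fst p), q (Suc (fst p)), - q (snd p), - q (Suc (snd p))})"
  have weak: "weakly_crossing q i j" if hull: "0 \<in> S (i, j)" for i j
  proof -
    obtain r s t where r: "0 \<le> r" "r \<le> 1" "0 \<le> s" "s \<le> 1" "0 \<le> t" "t \<le> 1"
      "0 = (1 - r) *\<^sub>R q i + r *\<^sub>R ((1 - s) *\<^sub>R q (Suc i) + s *\<^sub>R ((1 - t) *\<^sub>R (- q j) + t *\<^sub>R (- q (Suc j))))"
      using hull unfolding S_def fst_conv snd_conv by (rule convex_hull_4_nested)
    define a b c d where "a = 1 - r" and "b = r * (1 - s)" and "c = r * s * (1 - t)" and "d = r * s * t"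
    have "a \<ge> 0" "b \<ge> 0" "c \<ge> 0" "d \<ge> 0" "a + b + c + d = 1"
      "0 = a *\<^sub>R q i + b *\<^sub>R q (Suc i) + c *\<^sub>R (- q j) + d *\<^sub>R (- q (Suc j))"
    proof -
      show "a \<ge> 0" "b \<ge> 0" "c \<ge> 0" "d \<ge> 0"
        using r unfolding a_def b_def c_def d_def by (auto intro!: mult_nonneg_nonneg)
    qed (auto simp: r(7) a_def b_def c_def d_def algebra_simps)
    then show ?thesis
      unfolding weakly_crossing_def
      by (intro exI[of _ a] exI[of _ b] exI[of _ c] exI[of _ d]) (auto simp: algebra_simps)
  qed
  define f where "f = (\<lambda>p. if 0 \<in> S p then 1 else infdist 0 (S p))"
  have "f p > 0" for p
  proof (cases "0 \<in> S p")
    case False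
    have "closed (S p)" "S p \<noteq> {}"
      unfolding S_def by (auto intro!: compact_imp_closed finite_imp_compact_convex_hull)
    then show ?thesis using False infdist_pos_not_in_closed unfolding f_def by auto
  qed (simp add: f_def)
  then obtain \<eta> where \<eta>: "\<eta> > 0" "\<And>p. p \<in> Sigma {..<N} (\<lambda>_. {..<N}) \<Longrightarrow> \<eta> \<le> f p"
    using finite_positive_lower_bound[of "Sigma {..<N} (\<lambda>_. {..<N})" f] by blast
  have "weakly_crossing q i j"
    if q': "q' N = q' 0" "\<And>k. k < N \<Longrightarrow> norm (q' k - q k) < \<eta> / 2" and ij: "i < N" "j < N"
      and cross: "weakly_crossing q' i j" for q' i j
  proof (rule ccontr)
    assume "\<not> weakly_crossing q i j"
    then have notin: "0 \<notin> S (i, j)" using weak by blast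
    have close: "norm (q k - q' k) \<le> \<eta> / 2" if "k \<le> N" for k
    proof (cases "k = N")
      case True
      then show ?thesis using q'(1) q'(2)[of 0] ij assms by (simp add: norm_minus_commute)
    next
      case False
      then show ?thesis using q'(2)[of k] that by (simp add: norm_minus_commute)
    qed
    obtain a b c d where abcd: "a \<ge> 0" "b \<ge> 0" "c \<ge> 0" "d \<ge> 0" "a + b + c + d > 0"
      "a *\<^sub>R q' i + b *\<^sub>R q' (Suc i) = c *\<^sub>R q' j + d *\<^sub>R q' (Suc j)"
      using cross unfolding weakly_crossing_def by blast
    define e where "e = a + b + c + d"
    define w where "w = (\<lambda>k::nat. if k = 0 then a / e else if k = 1 then b / e else if k = 2 then c / e else d / e)"
    define y where "y = (\<lambda>k::nat. if k = 0 then q i else if k = 1 then q (Suc i) else if k = 2 then - q j else - q (Suc j))"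
    define p where "p = (\<Sum>k<4. w k *\<^sub>R y k)"
    have "e > 0" using abcd(5) by (simp add: e_def)
    have wsum: "(\<Sum>k<4. w k) = 1"
      using \<open>e > 0\<close> by (simp add: w_def numeral_eq_Suc add_divide_distrib[symmetric] e_def[symmetric])
    have wnn: "w k \<ge> 0" for k using abcd \<open>e > 0\<close> by (simp add: w_def)
    have "p \<in> S (i, j)"
      unfolding p_def
    proof (rule convex_sum[OF _ _ wsum])
      show "y k \<in> S (i, j)" for k unfolding S_def y_def by (auto intro: hull_inc)
    qed (auto simp: S_def wnn)
    define y' where "y' = (\<lambda>k::nat. if k = 0 then q' i else if k = 1 then q' (Suc i) else if k = 2 then - q' j else - q' (Suc j))"
    have "(\<Sum>k<4. w k *\<^sub>R y' k) = (1 / e) *\<^sub>R (a *\<^sub>R q' i + b *\<^sub>R q' (Suc i) - (c *\<^sub>R q' j + d *\<^sub>R q' (Suc j)))"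
      by (simp add: w_def y'_def numeral_eq_Suc scaleR_right_distrib scaleR_diff_right)
    also have "\<dots> = 0" using abcd(6) by simp
    finally have "p = (\<Sum>k<4. w k *\<^sub>R (y k - y' k))"
      by (simp add: p_def scaleR_diff_right sum_subtractf)
    also have "norm \<dots> \<le> (\<Sum>k<4. w k * (\<eta> / 2))"
    proof (rule sum_norm_le)
      fix k :: nat
      have "norm (y k - y' k) \<le> \<eta> / 2"
        using close[of i] close[of "Suc i"] close[of j] close[of "Suc j"] ij
        by (auto simp: y_def y'_def norm_minus_commute)
      then show "norm (w k *\<^sub>R (y k - y' k)) \<le> w k * (\<eta> / 2)"
        using wnn[of k] mult_left_mono[of "norm (y k - y' k)" "\<eta> / 2" "w k"] by simp
    qed
    also have "\<dots> = \<eta> / 2" unfolding sum_distrib_right[symmetric] wsum by simp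
    finally have "norm p \<le> \<eta> / 2" .
    moreover have "infdist 0 (S (i, j)) \<le> norm p"
      using infdist_le[OF \<open>p \<in> S (i, j)\<close>, of 0] by simp
    moreover have "\<eta> \<le> infdist 0 (S (i, j))" using \<eta>(2)[of "(i, j)"] ij notin by (simp add: f_def)
    ultimately show False using \<eta>(1) by linarith
  qed
  then show ?thesis using that[of "\<eta> / 2"] \<eta>(1) by auto
qed

text \<open>The supporting plane at a vertex farthest from the origin bounds a half space that contains all
  other vertices in its interior.\<close>

lemma extreme_vertex_at_origin:
  assumes v: "simple_polygon n v"
  obtains w u where "simple_polygon n w" "ambient_isotopic (polygon_set n v) (polygon_set n w)"
    "w 0 = 0" "\<And>i. 1 \<le> i \<Longrightarrow> i < n \<Longrightarrow> u \<bullet> w i < 0"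
proof -
  have n: "3 \<le> n" "v n = v 0" using simple_polygonD[OF v] by auto
  have "Max ((\<lambda>i. norm (v i)) ` {..<n}) \<in> (\<lambda>i. norm (v i)) ` {..<n}"
    using n by (intro Max_in) (auto simp: lessThan_empty_iff)
  then obtain r where r: "r < n" "norm (v r) = Max ((\<lambda>i. norm (v i)) ` {..<n})" by auto
  have far: "norm (v i) \<le> norm (v r)" if "i < n" for i
    unfolding r(2) using that by (intro Max_ge) auto
  define x where "x = (\<lambda>i. v ((i + r) mod n))"
  define w where "w = (\<lambda>i. - v r + x i)"
  have x: "simple_polygon n x" "polygon_set n x = polygon_set n v"
    unfolding x_def using simple_polygon_rotate[OF v r(1)] by auto
  have x0: "x 0 = v r" using r by (simp add: x_def)
  show ?thesis
  proof (rule that[of w "v r"])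
    show "simple_polygon n w" unfolding w_def by (rule simple_polygon_translate[OF x(1)])
    show "ambient_isotopic (polygon_set n v) (polygon_set n w)"
      unfolding w_def simple_polygon_translate(2)[OF x(1)] x(2) by (rule ambient_isotopic_translation)
    show "w 0 = 0" by (simp add: w_def x0)
    fix i assume i: "1 \<le> i" "i < n"
    have "x i \<noteq> x 0" using simple_polygon_vertex_eq_iff[OF x(1), of i 0] i by auto
    then have "(x i - v r) \<bullet> (x i - v r) > 0" using x0 by simp
    moreover have "norm (x i) \<le> norm (v r)" unfolding x_def using n by (intro far) auto
    then have "x i \<bullet> x i \<le> v r \<bullet> v r" by (simp add: norm_le)
    ultimately show "v r \<bullet> w i < 0"
      by (simp add: w_def inner_diff_left inner_diff_right inner_commute)
  qed
qed

text \<open>A common direction would lie in both planes, hence on their line of intersection; but the line is not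
  horizontal by hypothesis.  For \<open>n = 3\<close> the planes coincide, and the directions are opposite.\<close>

lemma horizontal_directions_not_parallel:
  assumes n: "3 \<le> n" and gen: "generic (n - 1) (\<lambda>i. v (Suc i))"
    and below: "\<And>i. 1 \<le> i \<Longrightarrow> i < n \<Longrightarrow> u \<bullet> v i < 0"
    and X: "n > 3 \<Longrightarrow> u \<bullet> ((v 1 \<times> v 2) \<times> (v (n - 1) \<times> v (n - 2))) \<noteq> 0" and "r > 0"
  shows "horizontal u (v 1) (v 2) \<noteq> r *\<^sub>R horizontal u (v (n - 1)) (v (n - 2))"
proof
  define A where "A = horizontal u (v 1) (v 2)"
  define B where "B = horizontal u (v (n - 1)) (v (n - 2))"
  assume "horizontal u (v 1) (v 2) = r *\<^sub>R horizontal u (v (n - 1)) (v (n - 2))"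
  then have AB: "A = r *\<^sub>R B" by (simp add: A_def B_def)
  have "A \<noteq> 0"
  proof
    assume "A = 0"
    then have "(1 / \<bar>u \<bullet> v 1\<bar>) *\<^sub>R v 1 + (- (1 / \<bar>u \<bullet> v 2\<bar>)) *\<^sub>R v 2 = 0" by (simp add: A_def horizontal_def)
    moreover have "v 1 \<times> v 2 \<noteq> 0" using genericD(1)[OF gen, of 0 1] n by (simp add: numeral_2_eq_2)
    ultimately have "1 / \<bar>u \<bullet> v 1\<bar> = 0" using cross_nonzero_independent(1) by blast
    then show False using below[of 1] n by simp
  qed
  show False
  proof (cases "n = 3")
    case True
    then have "B = - A" by (simp add: A_def B_def horizontal_def)
    then have "A = r *\<^sub>R (- A)" using AB by simp
    moreover have "(1 + r) *\<^sub>R A = A - r *\<^sub>R (- A)" by (simp add: scaleR_left_distrib)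
    ultimately have "(1 + r) *\<^sub>R A = 0" by (metis diff_self)
    then show False using \<open>A \<noteq> 0\<close> \<open>r > 0\<close> by simp
  next
    case False
    define N N' where "N = v 1 \<times> v 2" and "N' = v (n - 1) \<times> v (n - 2)"
    have "A \<bullet> N = 0" unfolding A_def N_def horizontal_def by (simp add: inner_diff_left dot_cross_self)
    moreover have "A \<bullet> N' = 0"
      unfolding AB B_def N'_def horizontal_def by (simp add: inner_diff_left dot_cross_self)
    ultimately have "A \<times> (N \<times> N') = 0" by (simp add: Lagrange)
    then have "(u \<bullet> (N \<times> N')) *\<^sub>R A - (u \<bullet> A) *\<^sub>R (N \<times> N') = 0"
      using Lagrange[of u A "N \<times> N'"] by simp
    moreover have "u \<bullet> A = 0"
      unfolding A_def using below[of 1] below[of 2] n by (intro inner_horizontal) auto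
    ultimately show False using X False n \<open>A \<noteq> 0\<close> by (simp add: N_def N'_def)
  qed
qed

text \<open>Generic vertices come first.  Only then the direction \<open>u\<close> is tilted, to keep the line of intersection of
  the planes of the first and the last edge of the chain \<open>w 1, \<dots>, w (n - 1)\<close> away from the horizon.\<close>

lemma generic_polygon_at_extreme_vertex:
  assumes v: "simple_polygon n v"
  obtains w u where "simple_polygon n w" "ambient_isotopic (polygon_set n v) (polygon_set n w)"
    "w 0 = 0" "generic (n - 1) (\<lambda>i. w (Suc i))" "\<And>i. 1 \<le> i \<Longrightarrow> i < n \<Longrightarrow> u \<bullet> w i < 0"
    "\<And>r. r > 0 \<Longrightarrow> horizontal u (w 1) (w 2) \<noteq> r *\<^sub>R horizontal u (w (n - 1)) (w (n - 2))"
proof -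
  have n: "3 \<le> n" using simple_polygonD[OF v] by auto
  obtain x u0 where x: "simple_polygon n x" "ambient_isotopic (polygon_set n v) (polygon_set n x)"
    "x 0 = 0" "\<And>i. 1 \<le> i \<Longrightarrow> i < n \<Longrightarrow> u0 \<bullet> x i < 0"
    using extreme_vertex_at_origin[OF v] by blast
  obtain \<delta>1 where \<delta>1: "\<delta>1 > 0" "\<And>w. w n = w 0 \<Longrightarrow> (\<And>i. i < n \<Longrightarrow> norm (w i - x i) < \<delta>1) \<Longrightarrow>
    simple_polygon n w \<and> ambient_isotopic (polygon_set n x) (polygon_set n w)"
    using polygon_vertex_perturbation[OF x(1)] by blast
  \<comment> \<open>The roles of vertex and direction are symmetric: either may move a little without affecting the sign.\<close>
  have stay: "\<exists>\<delta>>0. \<forall>y. norm (y - p) < \<delta> \<longrightarrow> a \<bullet> y < 0" if ap: "a \<bullet> p < 0" for a p :: space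
  proof -
    have "open {y. a \<bullet> y < 0}" by (rule open_halfspace_lt)
    then obtain \<delta> where "\<delta> > 0" "ball p \<delta> \<subseteq> {y. a \<bullet> y < 0}"
      using ap unfolding open_contains_ball by blast
    then show ?thesis by (intro exI[of _ \<delta>]) (auto simp: dist_norm norm_minus_commute subset_iff)
  qed
  have "\<exists>f. \<forall>i\<in>{1..<n}. f i > 0 \<and> (\<forall>y. norm (y - x i) < f i \<longrightarrow> u0 \<bullet> y < 0)"
    using stay x(4) by (intro bchoice) auto
  then obtain f where f: "\<And>i. i \<in> {1..<n} \<Longrightarrow> f i > 0 \<and> (\<forall>y. norm (y - x i) < f i \<longrightarrow> u0 \<bullet> y < (0::real))" by blast
  obtain \<delta>2 where \<delta>2: "\<delta>2 > 0" "\<And>i. i \<in> {1..<n} \<Longrightarrow> \<delta>2 \<le> f i"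
    using finite_positive_lower_bound[of "{1..<n}" f] f by blast
  obtain p where p: "\<And>k. k < n - 1 \<Longrightarrow> norm (p k - x (Suc k)) < min \<delta>1 \<delta>2" "generic_polygon (n - 1) p"
    using generic_polygon_perturbation[of "min \<delta>1 \<delta>2" "n - 1" "\<lambda>k. x (Suc k)"] \<delta>1(1) \<delta>2(1) by auto
  define w where "w = (\<lambda>i. if i = 0 \<or> i \<ge> n then 0 else p (i - 1))"
  have wx: "norm (w i - x i) < min \<delta>1 \<delta>2" if "i < n" for i
    using p(1)[of "i - 1"] that x(3) \<delta>1(1) \<delta>2(1) by (cases "i = 0") (auto simp: w_def)
  have w: "simple_polygon n w" "ambient_isotopic (polygon_set n x) (polygon_set n w)"
    using \<delta>1(2)[of w] wx by (auto simp: w_def)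
  have below0: "w i \<bullet> u0 < 0" if "1 \<le> i" "i < n" for i
  proof -
    have "norm (w i - x i) < f i" using wx[of i] \<delta>2(2)[of i] that by auto
    then show ?thesis using f[of i] that inner_commute[of "w i" u0] by auto
  qed
  have gen: "generic (n - 1) (\<lambda>i. w (Suc i))"
    using p(2) unfolding generic_polygon_def generic_def by (auto simp: w_def)
  have "\<exists>g. \<forall>i\<in>{1..<n}. g i > 0 \<and> (\<forall>y. norm (y - u0) < g i \<longrightarrow> w i \<bullet> y < 0)"
    using stay below0 by (intro bchoice) auto
  then obtain g where g: "\<And>i. i \<in> {1..<n} \<Longrightarrow> g i > 0 \<and> (\<forall>y. norm (y - u0) < g i \<longrightarrow> w i \<bullet> y < (0::real))" by blast
  obtain \<delta>3 where \<delta>3: "\<delta>3 > 0" "\<And>i. i \<in> {1..<n} \<Longrightarrow> \<delta>3 \<le> g i"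
    using finite_positive_lower_bound[of "{1..<n}" g] g by blast
  define X where "X = (w 1 \<times> w 2) \<times> (w (n - 1) \<times> w (n - 2))"
  obtain u where u: "norm (u - u0) < \<delta>3" "X \<noteq> 0 \<Longrightarrow> X \<bullet> u \<noteq> 0"
    using avoid_hyperplanes[of "{X}" \<delta>3 u0] \<delta>3(1) by auto
  have below: "u \<bullet> w i < 0" if "1 \<le> i" "i < n" for i
    using g[of i] u(1) \<delta>3(2)[of i] that by (auto simp: inner_commute)
  have "X \<noteq> 0" if "n > 3"
  proof
    assume "X = 0"
    define N where "N = w 1 \<times> w 2"
    have "(N \<bullet> w (n - 2)) *\<^sub>R w (n - 1) + (- (N \<bullet> w (n - 1))) *\<^sub>R w (n - 2) = 0"
      using \<open>X = 0\<close> unfolding X_def N_def[symmetric] Lagrange by simp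
    moreover have "w (n - 1) \<times> w (n - 2) \<noteq> 0"
      using genericD(1)[OF gen, of "n - 2" "n - 3"] that by (simp add: numeral_eq_Suc Suc_diff_Suc)
    ultimately have "- (N \<bullet> w (n - 1)) = 0" using cross_nonzero_independent by blast
    moreover have "N \<bullet> w (n - 1) \<noteq> 0"
      using genericD(2)[OF gen, of 0 1 "n - 2"] that by (simp add: N_def numeral_eq_Suc Suc_diff_Suc)
    ultimately show False by simp
  qed
  then have "horizontal u (w 1) (w 2) \<noteq> r *\<^sub>R horizontal u (w (n - 1)) (w (n - 2))" if "r > 0" for r
    using horizontal_directions_not_parallel[OF n gen below _ that] u(2)
    by (simp add: X_def inner_commute)
  then show ?thesis
    using that[of w u] w(1) ambient_isotopic_trans[OF x(2) w(2)] gen below by (auto simp: w_def)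
qed

text \<open>The bend next to \<open>w 1\<close> is made after the other one and thin enough to stay clear of it, even where
  the two bends overlap as seen from the origin.  At the origin itself they leave in different directions
  along the horizon.\<close>

lemma bend_at_origin:
  assumes w: "simple_polygon n w" and w0: "w 0 = 0" and gen: "generic (n - 1) (\<lambda>i. w (Suc i))"
    and below: "\<And>i. 1 \<le> i \<Longrightarrow> i < n \<Longrightarrow> u \<bullet> w i < 0"
    and not_parallel: "\<And>r. r > 0 \<Longrightarrow> horizontal u (w 1) (w 2) \<noteq> r *\<^sub>R horizontal u (w (n - 1)) (w (n - 2))"
  obtains \<alpha> \<beta> q where "\<alpha> > 0" "\<beta> > 0" "simple_polygon (n + 2) q"
    "ambient_isotopic (polygon_set n w) (polygon_set (n + 2) q)"
    "q = bent_polygon n w 0 (\<alpha> *\<^sub>R horizontal u (w 1) (w 2)) (\<beta> *\<^sub>R horizontal u (w (n - 1)) (w (n - 2)))"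
proof -
  have n: "3 \<le> n" "w n = w 0" using simple_polygonD[OF w] by auto
  define A where "A = horizontal u (w 1) (w 2)"
  define B where "B = horizontal u (w (n - 1)) (w (n - 2))"
  have cross: "w i \<times> w j \<noteq> 0" if "1 \<le> i" "i < n" "1 \<le> j" "j < n" "i \<noteq> j" for i j
    using genericD(1)[OF gen, of "i - 1" "j - 1"] that by auto
  have triple: "triple (w i) (w j) (w k) \<noteq> 0" if "1 \<le> i" "i < n" "1 \<le> j" "j < n" "1 \<le> k" "k < n"
    "i \<noteq> j" "j \<noteq> k" "i \<noteq> k" for i j k
    using genericD(2)[OF gen, of "i - 1" "j - 1" "k - 1"] that by auto
  have uA: "u \<bullet> A = 0" and uB: "u \<bullet> B = 0"
    unfolding A_def B_def using below n by (auto intro!: inner_horizontal)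
  \<comment> \<open>The corner is bent first next to \<open>w (n - 1)\<close>, on the polygon traversed backwards.\<close>
  define x where "x = (\<lambda>i. w (n - i))"
  have x: "simple_polygon n x" "polygon_set n x = polygon_set n w"
    unfolding x_def using simple_polygon_reverse[OF w] by auto
  have x_simps: "x 0 = 0" "x 1 = w (n - 1)" "x 2 = w (n - 2)" "x (n - 1) = w 1"
    using n w0 by (auto simp: x_def)
  obtain \<beta> where \<beta>: "\<beta> > 0" "simple_polygon (Suc n) (insert_vertex (\<beta> *\<^sub>R B) x)"
    "ambient_isotopic (polygon_set n x) (polygon_set (Suc n) (insert_vertex (\<beta> *\<^sub>R B) x))"
  proof (rule bend_first_edge[OF x(1) x_simps(1), of B "1 / \<bar>u \<bullet> w (n - 1)\<bar>" "1 / \<bar>u \<bullet> w (n - 2)\<bar>"])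
    show "x 1 \<times> x 2 \<noteq> 0" unfolding x_simps using n by (intro cross) auto
    show "B = (1 / \<bar>u \<bullet> w (n - 1)\<bar>) *\<^sub>R x 1 - (1 / \<bar>u \<bullet> w (n - 2)\<bar>) *\<^sub>R x 2"
      unfolding x_simps by (simp only: B_def horizontal_def)
    have "u \<bullet> w (n - 2) < 0" using n by (intro below) auto
    then show "1 / \<bar>u \<bullet> w (n - 2)\<bar> > 0" by simp
    fix a b :: real assume ab: "a \<ge> 0" "b \<ge> 0"
    show "a *\<^sub>R x 1 + b *\<^sub>R B \<noteq> x (n - 1)"
    proof
      assume "a *\<^sub>R x 1 + b *\<^sub>R B = x (n - 1)"
      then have eq: "(a + b / \<bar>u \<bullet> w (n - 1)\<bar>) *\<^sub>R w (n - 1) + (- (b / \<bar>u \<bullet> w (n - 2)\<bar>)) *\<^sub>R w (n - 2) = w 1"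
        unfolding x_simps by (simp add: B_def horizontal_def algebra_simps)
      show False
      proof (cases "n = 3")
        case True
        then have "(a + b / \<bar>u \<bullet> w (n - 1)\<bar>) *\<^sub>R w 2 + (- (b / \<bar>u \<bullet> w (n - 2)\<bar>) - 1) *\<^sub>R w 1 = 0"
          using eq by (simp add: algebra_simps)
        moreover have "w 2 \<times> w 1 \<noteq> 0" using n by (intro cross) auto
        ultimately have "- (b / \<bar>u \<bullet> w (n - 2)\<bar>) - 1 = 0" using cross_nonzero_independent by blast
        moreover have "b / \<bar>u \<bullet> w (n - 2)\<bar> \<ge> 0" using ab by simp
        ultimately show False by linarith
      next
        case False
        have "triple (w 1) (w (n - 1)) (w (n - 2)) \<noteq> 0" using n False by (intro triple) auto
        moreover have "(- 1) *\<^sub>R w 1 + (a + b / \<bar>u \<bullet> w (n - 1)\<bar>) *\<^sub>R w (n - 1) + (- (b / \<bar>u \<bullet> w (n - 2)\<bar>)) *\<^sub>R w (n - 2) = 0"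
          unfolding add.assoc eq by simp
        ultimately have "(- 1 :: real) = 0" by (rule triple_nonzero_independent(1))
        then show False by simp
      qed
    qed
  qed
  define y where "y = (\<lambda>i. insert_vertex (\<beta> *\<^sub>R B) x (Suc n - i))"
  have y: "simple_polygon (Suc n) y" "polygon_set (Suc n) y = polygon_set (Suc n) (insert_vertex (\<beta> *\<^sub>R B) x)"
    unfolding y_def using simple_polygon_reverse[OF \<beta>(2)] by auto
  have y_simps: "y 0 = 0" "y n = \<beta> *\<^sub>R B" "\<And>i. 1 \<le> i \<Longrightarrow> i < n \<Longrightarrow> y i = w i" "y (Suc n) = 0"
    using n w0 by (auto simp: y_def insert_vertex_def x_def)
  obtain \<alpha> where \<alpha>: "\<alpha> > 0" "simple_polygon (Suc (Suc n)) (insert_vertex (\<alpha> *\<^sub>R A) y)"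
    "ambient_isotopic (polygon_set (Suc n) y) (polygon_set (Suc (Suc n)) (insert_vertex (\<alpha> *\<^sub>R A) y))"
  proof (rule bend_first_edge[OF y(1) y_simps(1), of A "1 / \<bar>u \<bullet> w 1\<bar>" "1 / \<bar>u \<bullet> w 2\<bar>"])
    have y12: "y 1 = w 1" "y 2 = w 2" using y_simps(3)[of 1] y_simps(3)[of 2] n by auto
    show "y 1 \<times> y 2 \<noteq> 0" unfolding y12 using n by (intro cross) auto
    show "A = (1 / \<bar>u \<bullet> w 1\<bar>) *\<^sub>R y 1 - (1 / \<bar>u \<bullet> w 2\<bar>) *\<^sub>R y 2"
      unfolding y12 by (simp add: A_def horizontal_def)
    show "1 / \<bar>u \<bullet> w 2\<bar> > 0" using below[of 2] n by simp
    fix a b :: real assume ab: "a \<ge> 0" "b \<ge> 0"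
    show "a *\<^sub>R y 1 + b *\<^sub>R A \<noteq> y (Suc n - 1)"
    proof
      assume "a *\<^sub>R y 1 + b *\<^sub>R A = y (Suc n - 1)"
      then have eq: "a *\<^sub>R w 1 + b *\<^sub>R A = \<beta> *\<^sub>R B" by (simp add: y12[simplified] y_simps)
      then have "u \<bullet> (a *\<^sub>R w 1 + b *\<^sub>R A) = u \<bullet> (\<beta> *\<^sub>R B)" by simp
      then have "a * (u \<bullet> w 1) = 0" by (simp add: inner_add_right uA uB)
      then have "a = 0" using below[of 1] n by auto
      have "B \<noteq> 0"
      proof
        assume "B = 0"
        then have "(1 / \<bar>u \<bullet> w (n - 1)\<bar>) *\<^sub>R w (n - 1) + (- (1 / \<bar>u \<bullet> w (n - 2)\<bar>)) *\<^sub>R w (n - 2) = 0"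
          by (simp add: B_def horizontal_def)
        moreover have "w (n - 1) \<times> w (n - 2) \<noteq> 0" using n by (intro cross) auto
        ultimately have "1 / \<bar>u \<bullet> w (n - 1)\<bar> = 0" using cross_nonzero_independent(1) by blast
        moreover have "u \<bullet> w (n - 1) < 0" using n by (intro below) auto
        ultimately show False by simp
      qed
      then have "b > 0" using eq \<open>a = 0\<close> ab \<beta>(1) by (cases "b = 0") auto
      have "A = (1 / b) *\<^sub>R (b *\<^sub>R A)" using \<open>b > 0\<close> by simp
      also have "b *\<^sub>R A = \<beta> *\<^sub>R B" using eq \<open>a = 0\<close> by simp
      finally have "A = (\<beta> / b) *\<^sub>R B" by simp
      then show False
        using not_parallel[of "\<beta> / b"] \<beta>(1) \<open>b > 0\<close> by (simp add: A_def B_def)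
    qed
  qed
  have "insert_vertex (\<alpha> *\<^sub>R A) y = bent_polygon n w 0 (\<alpha> *\<^sub>R A) (\<beta> *\<^sub>R B)"
  proof
    fix i
    consider "i = 0" | "i = 1" | "2 \<le> i" "i \<le> n" | "i = Suc n" | "i > Suc n" by linarith
    then show "insert_vertex (\<alpha> *\<^sub>R A) y i = bent_polygon n w 0 (\<alpha> *\<^sub>R A) (\<beta> *\<^sub>R B) i"
    proof cases
      case 3
      then show ?thesis using y_simps(3)[of "i - 1"] by (auto simp: insert_vertex_def bent_polygon_def)
    next
      case 5
      then show ?thesis using w0 n
        by (auto simp: insert_vertex_def bent_polygon_def y_def x_def)
    qed (use n y_simps in \<open>auto simp: insert_vertex_def bent_polygon_def\<close>)
  qed
  moreover have "ambient_isotopic (polygon_set n w) (polygon_set (Suc (Suc n)) (insert_vertex (\<alpha> *\<^sub>R A) y))"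
    using ambient_isotopic_trans[OF \<beta>(3)] \<alpha>(3) x(2) y(2) by simp
  ultimately show ?thesis
    using that[of \<alpha> \<beta> "insert_vertex (\<alpha> *\<^sub>R A) y"] \<alpha>(1,2) \<beta>(1) by (simp add: A_def B_def)
qed



text \<open>The origin, from which the polygon is to be projected, still is the vertex \<open>0\<close> of the bent polygon \<open>q0\<close>.
  It is raised to \<open>\<kappa> *\<^sub>R u\<close>.  The cones over the edges do not depend on \<open>\<kappa> > 0\<close>; so \<open>\<kappa>\<close> can be chosen
  within the tolerance \<open>\<delta>\<close> of the isotopy.  Then a generic perturbation, small enough not to create
  crossings, puts the polygon in general position.\<close>

lemma polygon_diagram:
  assumes v: "simple_polygon n v" and K: "ambient_isotopic K (polygon_set n v)"
  shows "\<exists>m. projection_with_crossings K m \<and> 2 * m \<le> (n - 3) * (n - 4)"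
proof -
  have n: "3 \<le> n" using simple_polygonD[OF v] by auto
  obtain w u where w: "simple_polygon n w" "ambient_isotopic (polygon_set n v) (polygon_set n w)"
    "w 0 = 0" "generic (n - 1) (\<lambda>i. w (Suc i))" "\<And>i. 1 \<le> i \<Longrightarrow> i < n \<Longrightarrow> u \<bullet> w i < 0"
    "\<And>r. r > 0 \<Longrightarrow> horizontal u (w 1) (w 2) \<noteq> r *\<^sub>R horizontal u (w (n - 1)) (w (n - 2))"
    using generic_polygon_at_extreme_vertex[OF v] by blast
  obtain \<alpha> \<beta> q0 where q0: "\<alpha> > 0" "\<beta> > 0" "simple_polygon (n + 2) q0"
    "ambient_isotopic (polygon_set n w) (polygon_set (n + 2) q0)"
    "q0 = bent_polygon n w 0 (\<alpha> *\<^sub>R horizontal u (w 1) (w 2)) (\<beta> *\<^sub>R horizontal u (w (n - 1)) (w (n - 2)))"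
    using bend_at_origin[OF w(1,3,4,5,6)] by blast
  obtain \<delta> where \<delta>: "\<delta> > 0" "\<And>p. p (n + 2) = p 0 \<Longrightarrow> (\<And>i. i < n + 2 \<Longrightarrow> norm (p i - q0 i) < \<delta>) \<Longrightarrow>
    simple_polygon (n + 2) p \<and> ambient_isotopic (polygon_set (n + 2) q0) (polygon_set (n + 2) p)"
    using polygon_vertex_perturbation[OF q0(3)] by blast
  \<comment> \<open>Half of \<open>\<delta>\<close> is for raising the vertex, the other half for the generic perturbation.\<close>
  define \<kappa> where "\<kappa> = \<delta> / (2 * (norm u + 1))"
  have up: "norm u + 1 > 0" by (simp add: add_nonneg_pos)
  have \<kappa>: "\<kappa> > 0" using \<delta>(1) up by (simp add: \<kappa>_def)
  have \<kappa>u: "norm (\<kappa> *\<^sub>R u) \<le> \<delta> / 2"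
  proof -
    have "\<delta> * norm u \<le> \<delta> * (norm u + 1)" using \<delta>(1) by simp
    then have "\<kappa> * norm u \<le> \<delta> / 2" using up by (simp add: \<kappa>_def field_simps)
    then show ?thesis using \<kappa> by simp
  qed
  define q where "q = bent_polygon n w (\<kappa> *\<^sub>R u) (\<alpha> *\<^sub>R horizontal u (w 1) (w 2))
    (\<beta> *\<^sub>R horizontal u (w (n - 1)) (w (n - 2)))"
  have qq0: "norm (q i - q0 i) \<le> \<delta> / 2" for i
    using \<kappa>u \<delta>(1) by (auto simp: q_def q0(5) bent_polygon_def)
  have closed: "q (n + 2) = q 0" by (simp add: q_def bent_polygon_def)
  obtain \<eta> where \<eta>: "\<eta> > 0" "\<And>q' i j. q' (n + 2) = q' 0 \<Longrightarrow> (\<And>k. k < n + 2 \<Longrightarrow> norm (q' k - q k) < \<eta>) \<Longrightarrow>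
    i < n + 2 \<Longrightarrow> j < n + 2 \<Longrightarrow> weakly_crossing q' i j \<Longrightarrow> weakly_crossing q i j"
    using weakly_crossing_stable[OF closed] by blast
  obtain p where p: "p (n + 2) = p 0" "\<And>k. k < n + 2 \<Longrightarrow> norm (p k - q k) < min (\<delta> / 2) \<eta>"
    "generic_polygon (n + 2) p"
    using generic_polygon_perturbation[of "min (\<delta> / 2) \<eta>" "n + 2" q] \<delta>(1) \<eta>(1) by auto
  have "norm (p i - q0 i) < \<delta>" if "i < n + 2" for i
    using norm_triangle_ineq[of "p i - q i" "q i - q0 i"] p(2)[OF that] qq0[of i] by simp
  then have sp: "simple_polygon (n + 2) p" "ambient_isotopic (polygon_set (n + 2) q0) (polygon_set (n + 2) p)"
    using \<delta>(2)[OF p(1)] by auto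
  have wk: "finite (weak_pairs n q)" "2 * card (weak_pairs n q) \<le> (n - 3) * (n - 4)"
    using card_weak_pairs[OF n w(4,5,6) q0(1,2) \<kappa> q_def] by blast+
  have "crossing_pairs (n + 2) p \<subseteq> weak_pairs n q"
  proof clarify
    fix i j assume "(i, j) \<in> crossing_pairs (n + 2) p"
    then obtain x y where x: "i < j" "j < n + 2" "nonadjacent (n + 2) i j" "x \<in> edge p i" "y \<in> edge p j" "sgn x = sgn y"
      by (auto simp: crossing_pairs_def)
    have "x \<noteq> 0" using edge_nonzero[OF sp(1) p(3), of i x] x by auto
    then obtain r where r: "r > 0" "y = r *\<^sub>R x" using sgn_eq_imp_scaleR x(6) by metis
    obtain s where s: "0 \<le> s" "s \<le> 1" "x = (1 - s) *\<^sub>R p i + s *\<^sub>R p (Suc i)"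
      using x(4) by (auto simp: edge_def closed_segment_def)
    obtain t where t: "0 \<le> t" "t \<le> 1" "y = (1 - t) *\<^sub>R p j + t *\<^sub>R p (Suc j)"
      using x(5) by (auto simp: edge_def closed_segment_def)
    have "(r * (1 - s)) *\<^sub>R p i + (r * s) *\<^sub>R p (Suc i) = (1 - t) *\<^sub>R p j + t *\<^sub>R p (Suc j)"
      using r(2) s(3) t(3) by (simp add: scaleR_right_distrib)
    then have "weakly_crossing p i j"
      unfolding weakly_crossing_def using r s t
      by (intro exI[of _ "r * (1 - s)"] exI[of _ "r * s"] exI[of _ "1 - t"] exI[of _ t])
        (auto intro!: add_nonneg_pos)
    then have "weakly_crossing q i j"
      using \<eta>(2)[OF p(1), of i j] p(2) x by auto
    then show "(i, j) \<in> weak_pairs n q" using x by (simp add: weak_pairs_def)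
  qed
  then have "card (crossing_pairs (n + 2) p) \<le> card (weak_pairs n q)" by (rule card_mono[OF wk(1)])
  then have le: "2 * card (crossings sgn (polygon_set (n + 2) p)) \<le> (n - 3) * (n - 4)"
    using card_crossings_le[OF sp(1) p(3)] wk(2) by linarith
  define g where "g = polygon_path (n + 2) p"
  have im: "path_image g = polygon_set (n + 2) p"
    unfolding g_def using p(1) by (intro polygon_path_image) auto
  have sgn: "sphere_projection 0 = sgn" by (auto simp: sphere_projection_def)
  have "0 \<notin> path_image g"
    using edge_nonzero[OF sp(1) p(3)] unfolding im polygon_set_def by blast
  then have "admissible_projection (path_image g) sgn"
    unfolding admissible_projection_def using sgn by metis
  moreover have "closed_loop g" unfolding g_def by (rule closed_loop_polygon_path[OF sp(1)])
  moreover have "general_position sgn g"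
    unfolding g_def by (rule general_position_polygon_path[OF sp(1) p(3)])
  moreover have "ambient_isotopic K (path_image g)"
    unfolding im using K w(2) q0(4) sp(2) ambient_isotopic_trans by blast
  ultimately have "projection_with_crossings K (card (crossings sgn (path_image g)))"
    unfolding projection_with_crossings_def by blast
  then show ?thesis using le im by auto
qed

section \<open>Triangles are trivial\<close>

lemma simple_triangleI:
  assumes "v 3 = v 0" and indep: "(v 1 - v 0) \<times> (v 2 - v 0) \<noteq> 0"
  shows "simple_polygon 3 v"
proof -
  define a b where "a = v 1 - v 0" and "b = v 2 - v 0"
  have ab: "a \<times> b \<noteq> 0" using indep by (simp add: a_def b_def)
  have v: "v (Suc 0) = v 0 + a" "v (Suc (Suc 0)) = v 0 + b" "v (Suc (Suc (Suc 0))) = v 0"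
    using assms(1) by (simp_all add: a_def b_def numeral_eq_Suc)
  have zero: "x = 0 \<and> y = 0" if "x *\<^sub>R a + y *\<^sub>R b = 0" for x y
    using cross_nonzero_independent[OF ab that] by simp
  have ne: "a \<noteq> 0" "b \<noteq> 0" "a \<noteq> b" using ab by auto
  have e: "edge v 0 = (\<lambda>s. v 0 + s *\<^sub>R a) ` {0..1}"
    "edge v (Suc 0) = (\<lambda>s. v 0 + ((1 - s) *\<^sub>R a + s *\<^sub>R b)) ` {0..1}"
    "edge v (Suc (Suc 0)) = (\<lambda>s. v 0 + (1 - s) *\<^sub>R b) ` {0..1}"
    unfolding edge_eq_image edge_point_def v by (simp_all add: algebra_simps)
  have e01: "edge v 0 \<inter> edge v (Suc 0) = {v 0 + a}"
  proof
    show "edge v 0 \<inter> edge v (Suc 0) \<subseteq> {v 0 + a}"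
    proof
      fix x assume "x \<in> edge v 0 \<inter> edge v (Suc 0)"
      then obtain s t where "x = v 0 + s *\<^sub>R a" "x = v 0 + ((1 - t) *\<^sub>R a + t *\<^sub>R b)" unfolding e by blast
      moreover from this have "(s - (1 - t)) *\<^sub>R a + (- t) *\<^sub>R b = 0" by (simp add: algebra_simps)
      ultimately show "x \<in> {v 0 + a}" using zero[of "s - (1 - t)" "- t"] by auto
    qed
    show "{v 0 + a} \<subseteq> edge v 0 \<inter> edge v (Suc 0)"
      unfolding edge_def v by auto
  qed
  have e12: "edge v (Suc 0) \<inter> edge v (Suc (Suc 0)) = {v 0 + b}"
  proof
    show "edge v (Suc 0) \<inter> edge v (Suc (Suc 0)) \<subseteq> {v 0 + b}"
    proof
      fix x assume "x \<in> edge v (Suc 0) \<inter> edge v (Suc (Suc 0))"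
      then obtain s t where "x = v 0 + (1 - s) *\<^sub>R b" "x = v 0 + ((1 - t) *\<^sub>R a + t *\<^sub>R b)" unfolding e by blast
      moreover from this have "(1 - t) *\<^sub>R a + (t - (1 - s)) *\<^sub>R b = 0" by (simp add: algebra_simps)
      ultimately show "x \<in> {v 0 + b}" using zero[of "1 - t" "t - (1 - s)"] by auto
    qed
    show "{v 0 + b} \<subseteq> edge v (Suc 0) \<inter> edge v (Suc (Suc 0))"
      unfolding edge_def v by auto
  qed
  have e02: "edge v 0 \<inter> edge v (Suc (Suc 0)) = {v 0}"
  proof
    show "edge v 0 \<inter> edge v (Suc (Suc 0)) \<subseteq> {v 0}"
    proof
      fix x assume "x \<in> edge v 0 \<inter> edge v (Suc (Suc 0))"
      then obtain s t where "x = v 0 + s *\<^sub>R a" "x = v 0 + (1 - t) *\<^sub>R b" unfolding e by blast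
      moreover from this have "s *\<^sub>R a + (- (1 - t)) *\<^sub>R b = 0" by (simp add: algebra_simps)
      ultimately show "x \<in> {v 0}" using zero[of s "- (1 - t)"] by auto
    qed
    show "{v 0} \<subseteq> edge v 0 \<inter> edge v (Suc (Suc 0))"
      unfolding edge_def v by auto
  qed
  have set3: "{..<3} = {0, Suc 0, Suc (Suc 0)}" by auto
  have pairs: "edge v i \<inter> edge v j = {v i, v (Suc i)} \<inter> {v j, v (Suc j)}" if "i < j" "j < 3" for i j
  proof -
    have "i = 0 \<and> j = Suc 0 \<or> i = 0 \<and> j = Suc (Suc 0) \<or> i = Suc 0 \<and> j = Suc (Suc 0)"
      using that by auto
    then show ?thesis using e01 e12 e02 ne by (elim disjE conjE) (auto simp: v)
  qed
  show ?thesis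
    unfolding simple_polygon_def
  proof (intro conjI allI impI)
    show "inj_on v {..<3}" unfolding set3 using ne by (auto simp: v)
    fix i j :: nat assume "i < 3" "j < 3" "i \<noteq> j"
    then show "edge v i \<inter> edge v j = {v i, v (Suc i)} \<inter> {v j, v (Suc j)}"
      using pairs[of i j] pairs[of j i] by (cases "i < j") (auto simp: Int_commute)
  qed (use assms in auto)
qed

lemma simple_triangle_independent:
  assumes v: "simple_polygon 3 v"
  shows "(v 1 - v 0) \<times> (v 2 - v 0) \<noteq> 0"
proof
  define a b where "a = v 1 - v 0" and "b = v 2 - v 0"
  have v': "v (Suc 0) = v 0 + a" "v (Suc (Suc 0)) = v 0 + b" "v (Suc (Suc (Suc 0))) = v 0"
    using simple_polygonD(3)[OF v] by (simp_all add: a_def b_def numeral_eq_Suc)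
  assume "(v 1 - v 0) \<times> (v 2 - v 0) = 0"
  then have "collinear {v 0, v 1, v 2}"
    unfolding cross_eq_0 using collinear_3[of "v 1" "v 0" "v 2"] by (simp add: insert_commute)
  then have "v 0 \<in> closed_segment (v 1) (v 2) \<or> v 1 \<in> closed_segment (v 2) (v 0) \<or> v 2 \<in> closed_segment (v 0) (v 1)"
    by (simp add: collinear_between_cases between_mem_segment)
  moreover have ne: "v 0 \<noteq> v 1" "v 0 \<noteq> v 2" "v 1 \<noteq> v 2"
    using simple_polygon_vertex_eq_iff[OF v, of 0 1] simple_polygon_vertex_eq_iff[OF v, of 0 2]
      simple_polygon_vertex_eq_iff[OF v, of 1 2] by auto
  have seg: "edge v 0 = closed_segment (v 0) (v 1)" "edge v 1 = closed_segment (v 1) (v 2)" "edge v 2 = closed_segment (v 2) (v 0)"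
    using simple_polygonD(3)[OF v] by (auto simp: edge_def numeral_eq_Suc)
  have meet: "edge v 0 \<inter> edge v 1 = {v 0, v 1} \<inter> {v 1, v 2}" "edge v 1 \<inter> edge v 2 = {v 1, v 2} \<inter> {v 2, v 0}"
    "edge v 0 \<inter> edge v 2 = {v 0, v 1} \<inter> {v 2, v 0}"
    using simple_polygonD(4)[OF v, of 0 1] simple_polygonD(4)[OF v, of 1 2] simple_polygonD(4)[OF v, of 0 2]
      simple_polygonD(3)[OF v] by (auto simp: numeral_eq_Suc)
  ultimately show False
  proof (elim disjE)
    assume "v 0 \<in> closed_segment (v 1) (v 2)"
    then have "v 0 \<in> edge v 0 \<inter> edge v 1" unfolding seg by simp
    then show False using meet(1) ne by auto
  next
    assume "v 1 \<in> closed_segment (v 2) (v 0)"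
    then have "v 1 \<in> edge v 1 \<inter> edge v 2" unfolding seg by simp
    then show False using meet(2) ne by auto
  next
    assume "v 2 \<in> closed_segment (v 0) (v 1)"
    then have "v 2 \<in> edge v 0 \<inter> edge v 2" unfolding seg by simp
    then show False using meet(3) ne by auto
  qed
qed

lemma triple_nonzero_cross:
  assumes "triple a b c \<noteq> 0"
  shows "b \<times> c \<noteq> 0" "c \<times> b \<noteq> 0" "a \<times> c \<noteq> 0" "c \<times> a \<noteq> 0"
proof -
  note perm = triple_permute[where a = a and b = b and c = c]
  show "b \<times> c \<noteq> 0" "c \<times> b \<noteq> 0" "a \<times> c \<noteq> 0" "c \<times> a \<noteq> 0"
  proof safe
    assume "b \<times> c = 0" then show False using perm(4) assms by simp
  next
    assume "c \<times> b = 0" then show False using perm(3) assms by simp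
  next
    assume "a \<times> c = 0" then show False using perm(2) assms by simp
  next
    assume "c \<times> a = 0" then show False using perm(5) assms by simp
  qed
qed

definition triangle_at :: "space \<Rightarrow> space \<Rightarrow> space \<Rightarrow> nat \<Rightarrow> space" where
  "triangle_at p x y i = (if i = 1 then p + x else if i = 2 then p + y else p)"

lemma simple_triangle_at: "x \<times> y \<noteq> 0 \<Longrightarrow> simple_polygon 3 (triangle_at p x y)"
  by (rule simple_triangleI) (auto simp: triangle_at_def)

text \<open>The vertex moves along a segment that leaves the plane of the triangle.\<close>

lemma triangle_move_first:
  assumes "x \<times> y \<noteq> 0" "triple x z y \<noteq> 0"
  shows "ambient_isotopic (polygon_set 3 (triangle_at p x y)) (polygon_set 3 (triangle_at p z y))"
proof -
  have upd: "(triangle_at p x y)(1 := p + w) = triangle_at p w y" for w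
    by (auto simp: triangle_at_def)
  have "ambient_isotopic (polygon_set 3 ((triangle_at p x y)(1 := p + x)))
     (polygon_set 3 ((triangle_at p x y)(1 := p + z)))"
  proof (rule polygon_vertex_move)
    fix w assume "w \<in> closed_segment (p + x) (p + z)"
    then obtain t where "w = (1 - t) *\<^sub>R (p + x) + t *\<^sub>R (p + z)" by (auto simp: closed_segment_def)
    then have w: "w = p + ((1 - t) *\<^sub>R x + t *\<^sub>R z)" by (simp add: algebra_simps)
    have "((1 - t) *\<^sub>R x + t *\<^sub>R z) \<times> y \<noteq> 0"
    proof
      assume 0: "((1 - t) *\<^sub>R x + t *\<^sub>R z) \<times> y = 0"
      then have "(((1 - t) *\<^sub>R x + t *\<^sub>R z) \<times> y) \<bullet> x = 0" by simp
      then have "t * ((z \<times> y) \<bullet> x) = 0"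
        by (simp add: cross_add_left cross_mult_left inner_add_left dot_cross_self)
      moreover have "(z \<times> y) \<bullet> x \<noteq> 0" using assms(2) by (metis cross_triple)
      ultimately have "t = 0" by simp
      then show False using 0 assms(1) by simp
    qed
    then show "simple_polygon 3 ((triangle_at p x y)(1 := w))"
      unfolding w upd by (rule simple_triangle_at)
  qed auto
  then show ?thesis unfolding upd .
qed

lemma triangle_move_second:
  assumes "x \<times> y \<noteq> 0" "triple y z x \<noteq> 0"
  shows "ambient_isotopic (polygon_set 3 (triangle_at p x y)) (polygon_set 3 (triangle_at p x z))"
proof -
  have swap: "polygon_set 3 (triangle_at p a b) = polygon_set 3 (triangle_at p b a)" for a b
    by (auto simp: polygon_set_def edge_def triangle_at_def closed_segment_commute numeral_eq_Suc lessThan_Suc)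
  have "y \<times> x \<noteq> 0" using assms(1) cross_skew[of x y] by auto
  from triangle_move_first[OF this assms(2)] show ?thesis unfolding swap[of x] .
qed

text \<open>The vertices of a triangle can be moved one by one, via intermediate vertices \<open>c\<close> and \<open>d\<close> that avoid the
  planes in which a moving triangle could degenerate.\<close>

lemma triangles_isotopic:
  assumes "x \<times> y \<noteq> 0" "x' \<times> y' \<noteq> 0"
  shows "ambient_isotopic (polygon_set 3 (triangle_at p x y)) (polygon_set 3 (triangle_at p x' y'))"
proof -
  have "x' \<noteq> 0" using assms(2) by auto
  then obtain a :: 3 where a: "x' \<times> axis a 1 \<noteq> 0" using cross_basis_nonzero by blast
  obtain c where c: "\<And>m. m \<in> {x \<times> y, x' \<times> axis a 1} \<Longrightarrow> m \<noteq> 0 \<Longrightarrow> m \<bullet> c \<noteq> 0"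
    using avoid_hyperplanes[of "{x \<times> y, x' \<times> axis a 1}" 1 0] by auto
  have c1: "triple x y c \<noteq> 0" and c2: "triple x' (axis a 1) c \<noteq> 0" using c assms a by auto
  have yc: "c \<times> y \<noteq> 0" and cx': "c \<times> x' \<noteq> 0"
    using triple_nonzero_cross[OF c1] triple_nonzero_cross[OF c2] by auto
  obtain d where d: "\<And>m. m \<in> {c \<times> y, c \<times> x', x' \<times> y'} \<Longrightarrow> m \<noteq> 0 \<Longrightarrow> m \<bullet> d \<noteq> 0"
    using avoid_hyperplanes[of "{c \<times> y, c \<times> x', x' \<times> y'}" 1 0] by auto
  have d1: "triple c y d \<noteq> 0" and d2: "triple c x' d \<noteq> 0" and d3: "triple x' y' d \<noteq> 0"
    using d yc cx' assms(2) by auto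
  have cd: "c \<times> d \<noteq> 0" and x'd: "x' \<times> d \<noteq> 0"
    using triple_nonzero_cross[OF d1] triple_nonzero_cross[OF d3] by auto
  have "ambient_isotopic (polygon_set 3 (triangle_at p x y)) (polygon_set 3 (triangle_at p c y))"
    using c1 by (intro triangle_move_first assms(1)) (simp add: triple_permute(2)[of x y c])
  moreover have "ambient_isotopic (polygon_set 3 (triangle_at p c y)) (polygon_set 3 (triangle_at p c d))"
    using d1 by (intro triangle_move_second yc) (simp only: triple_permute(4)[of y d c] not_False_eq_True)
  moreover have "ambient_isotopic (polygon_set 3 (triangle_at p c d)) (polygon_set 3 (triangle_at p x' d))"
    using d2 by (intro triangle_move_first cd)
  moreover have "ambient_isotopic (polygon_set 3 (triangle_at p x' d)) (polygon_set 3 (triangle_at p x' y'))"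
    using d3 by (intro triangle_move_second x'd) (simp add: triple_permute(3)[of x' y' d])
  ultimately show ?thesis using ambient_isotopic_trans by blast
qed

subsection \<open>From a triangle to the circle\<close>

definition shadow :: "space \<Rightarrow> space" where
  "shadow x = vector [x $ 1, x $ 2, 0]"

text \<open>The gauge of the triangle with corners \<open>(-1, -1)\<close>, \<open>(2, -1)\<close>, \<open>(-1, 2)\<close>.\<close>

definition triangle_gauge :: "space \<Rightarrow> real" where
  "triangle_gauge x = max (max (- (x $ 1)) (- (x $ 2))) (x $ 1 + x $ 2)"

lemma shadow_simps [simp]: "shadow x $ 1 = x $ 1" "shadow x $ 2 = x $ 2" "shadow x $ 3 = 0"
  by (simp_all add: shadow_def)

lemma shadow_eq_0_iff: "shadow x = 0 \<longleftrightarrow> x $ 1 = 0 \<and> x $ 2 = 0"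
  by (auto simp: vec_eq_iff forall_3)

lemma norm_shadow: "norm (shadow x) = sqrt ((x $ 1)\<^sup>2 + (x $ 2)\<^sup>2)"
  by (simp add: norm_vec_def L2_set_def sum_3)

lemma triangle_gauge_shadow: "triangle_gauge (shadow x) = triangle_gauge x"
  by (simp add: triangle_gauge_def)

lemma triangle_gauge_pos: "shadow x \<noteq> 0 \<Longrightarrow> triangle_gauge x > 0"
  by (auto simp: triangle_gauge_def shadow_eq_0_iff)

lemma triangle_gauge_scaleR: "c \<ge> 0 \<Longrightarrow> triangle_gauge (c *\<^sub>R x) = c * triangle_gauge x"
  by (simp add: triangle_gauge_def max_mult_distrib_left distrib_left)

text \<open>Every horizontal plane is stretched along the rays from its centre, by a factor that depends on the ray
  only and leads from the unit ball of the gauge to the round disc.\<close>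

definition radial_factor :: "real \<Rightarrow> space \<Rightarrow> real" where
  "radial_factor t x = (1 - t) + t * (triangle_gauge x / norm (shadow x))"

definition radial_isotopy :: "real \<times> space \<Rightarrow> space" where
  "radial_isotopy z = snd z + fst z *\<^sub>R (triangle_gauge (snd z) *\<^sub>R sgn (shadow (snd z)) - shadow (snd z))"

lemma continuous_on_shadow: "continuous_on A shadow"
proof -
  have eq: "shadow = (\<lambda>x. x - (x $ 3) *\<^sub>R axis 3 1)"
    by (auto simp: vec_eq_iff forall_3 axis_def)
  show ?thesis unfolding eq by (intro continuous_intros)
qed

lemma continuous_on_triangle_gauge: "continuous_on A triangle_gauge"
  unfolding triangle_gauge_def by (intro continuous_intros)

text \<open>On the vertical axis the field has no direction, but the gauge vanishes there.\<close>

lemma continuous_on_radial_isotopy: "continuous_on UNIV radial_isotopy"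
proof -
  have "isCont (\<lambda>x. triangle_gauge x *\<^sub>R sgn (shadow x)) x" for x
  proof (cases "shadow x = 0")
    case False
    have "isCont shadow x" "isCont triangle_gauge x"
      using continuous_on_shadow[of UNIV] continuous_on_triangle_gauge[of UNIV]
      by (auto simp: continuous_on_eq_continuous_at)
    then show ?thesis using False by (intro continuous_intros) auto
  next
    case True
    then have "triangle_gauge x = 0" by (auto simp: triangle_gauge_def shadow_eq_0_iff)
    moreover have "isCont triangle_gauge x"
      using continuous_on_triangle_gauge[of UNIV] by (auto simp: continuous_on_eq_continuous_at)
    ultimately have "(triangle_gauge \<longlongrightarrow> 0) (at x)" by (simp add: isCont_def)
    then have "((\<lambda>y. triangle_gauge y *\<^sub>R sgn (shadow y)) \<longlongrightarrow> 0) (at x)"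
      by (rule tendsto_0_le[where K = 1]) (auto simp: norm_sgn)
    then show ?thesis using True by (simp add: isCont_def)
  qed
  then have cont: "continuous_on UNIV (\<lambda>x. triangle_gauge x *\<^sub>R sgn (shadow x))"
    by (simp add: continuous_on_eq_continuous_at)
  have snd: "continuous_on UNIV (snd :: real \<times> space \<Rightarrow> space)"
    by (intro continuous_intros)
  have 1: "continuous_on UNIV (\<lambda>z :: real \<times> space. triangle_gauge (snd z) *\<^sub>R sgn (shadow (snd z)))"
    by (rule continuous_on_compose2[OF cont snd]) auto
  have 2: "continuous_on UNIV (\<lambda>z :: real \<times> space. shadow (snd z))"
    by (rule continuous_on_compose2[OF continuous_on_shadow[of UNIV] snd]) auto
  have 3: "continuous_on UNIV (fst :: real \<times> space \<Rightarrow> real)"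
    by (intro continuous_intros)
  show ?thesis
    unfolding radial_isotopy_def
    by (rule continuous_on_add[OF snd continuous_on_scaleR[OF 3 continuous_on_diff[OF 1 2]]])
qed

lemma radial_isotopy_eq: "radial_isotopy (t, x) = x + (radial_factor t x - 1) *\<^sub>R shadow x"
  by (simp add: radial_isotopy_def radial_factor_def sgn_div_norm divide_inverse algebra_simps)

lemma shadow_radial_isotopy:
  "shadow (radial_isotopy (t, x)) = radial_factor t x *\<^sub>R shadow x"
  "radial_isotopy (t, x) - shadow (radial_isotopy (t, x)) = x - shadow x"
  by (auto simp: radial_isotopy_eq vec_eq_iff forall_3 algebra_simps)

lemma radial_factor_pos:
  assumes "0 \<le> t" "t \<le> 1" "shadow x \<noteq> 0" shows "radial_factor t x > 0"
proof -
  have "triangle_gauge x / norm (shadow x) > 0" using triangle_gauge_pos assms by simp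
  then have "t * (triangle_gauge x / norm (shadow x)) > 0" if "t \<noteq> 0"
    using that assms by (intro mult_pos_pos) auto
  then show ?thesis
    unfolding radial_factor_def using assms by (cases "t = 0") (auto simp: add_nonneg_pos)
qed

lemma radial_factor_cong:
  assumes "shadow y = c *\<^sub>R shadow x" "c > 0" shows "radial_factor t y = radial_factor t x"
proof -
  have "triangle_gauge y = c * triangle_gauge x"
    using triangle_gauge_scaleR[of c "shadow x"] assms triangle_gauge_shadow[of x] triangle_gauge_shadow[of y]
    by simp
  then show ?thesis using assms by (simp add: radial_factor_def)
qed

lemma homeomorphism_radial_isotopy:
  assumes t: "0 \<le> t" "t \<le> 1"
  shows "\<exists>h. homeomorphism UNIV UNIV (\<lambda>x. radial_isotopy (t, x)) h"
proof -
  have inj: "inj (\<lambda>x. radial_isotopy (t, x))"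
  proof (rule injI)
    fix x y assume eq: "radial_isotopy (t, x) = radial_isotopy (t, y)"
    have sh: "radial_factor t x *\<^sub>R shadow x = radial_factor t y *\<^sub>R shadow y"
      using eq by (metis shadow_radial_isotopy(1))
    have rest: "x - shadow x = y - shadow y" using eq by (metis shadow_radial_isotopy(2))
    have "shadow x = shadow y"
    proof (cases "shadow x = 0 \<or> shadow y = 0")
      case True
      then show ?thesis using sh radial_factor_pos[OF t, of x] radial_factor_pos[OF t, of y]
        by (cases "shadow x = 0"; cases "shadow y = 0") auto
    next
      case False
      then have pos: "radial_factor t x > 0" "radial_factor t y > 0" using radial_factor_pos[OF t] by auto
      have "shadow y = (1 / radial_factor t y) *\<^sub>R (radial_factor t y *\<^sub>R shadow y)" using pos by simp
      also have "\<dots> = (radial_factor t x / radial_factor t y) *\<^sub>R shadow x" unfolding sh[symmetric] by simp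
      finally have "shadow y = (radial_factor t x / radial_factor t y) *\<^sub>R shadow x" .
      then have "radial_factor t y = radial_factor t x"
        by (rule radial_factor_cong) (use pos in simp)
      then show ?thesis using sh pos by simp
    qed
    then show "x = y" using rest by (metis diff_add_cancel)
  qed
  have surj: "surj (\<lambda>x. radial_isotopy (t, x))"
  proof (rule surjI)
    fix z
    define c where "c = (if shadow z = 0 then 1 else 1 / radial_factor t z)"
    define x where "x = z + (c - 1) *\<^sub>R shadow z"
    have c: "c > 0" using radial_factor_pos[OF t, of z] by (auto simp: c_def)
    have shx: "shadow x = c *\<^sub>R shadow z" by (auto simp: x_def vec_eq_iff forall_3 algebra_simps)
    then have f: "radial_factor t x = radial_factor t z" using c by (rule radial_factor_cong)
    have "(radial_factor t z * c) *\<^sub>R shadow z = shadow z"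
      using radial_factor_pos[OF t, of z] by (cases "shadow z = 0") (auto simp: c_def)
    then have "radial_isotopy (t, x) = z"
      unfolding radial_isotopy_eq f shx by (simp add: x_def algebra_simps)
    then have "\<exists>x. radial_isotopy (t, x) = z" by blast
    then show "radial_isotopy (t, SOME x. radial_isotopy (t, x) = z) = z" by (rule someI_ex)
  qed
  have "continuous_on UNIV (\<lambda>x. radial_isotopy (t, x))"
    by (rule continuous_on_compose2[OF continuous_on_radial_isotopy]) (auto intro!: continuous_intros)
  then show ?thesis
    using inj surj by (metis invariance_of_domain_homeomorphism open_UNIV order_refl)
qed

lemma standard_triangle_trivial:
  "trivial_knot (polygon_set 3 (triangle_at (vector [-1, -1, 0]) (vector [3, 0, 0]) (vector [0, 3, 0])))"
proof -
  define w where "w = triangle_at (vector [-1, -1, 0]) (vector [3, 0, 0]) (vector [0, 3, 0])"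
  define T where "T = polygon_set 3 w"
  have mem: "x \<in> T \<longleftrightarrow> triangle_gauge x = 1 \<and> x $ 3 = 0" for x
  proof
    assume "x \<in> T"
    then show "triangle_gauge x = 1 \<and> x $ 3 = 0"
      by (auto simp: T_def polygon_set_def edge_eq_image edge_point_def w_def triangle_at_def
          triangle_gauge_def numeral_eq_Suc lessThan_Suc vector_3 max_def)
  next
    assume x: "triangle_gauge x = 1 \<and> x $ 3 = 0"
    then consider "x $ 1 = - 1" "- 1 \<le> x $ 2" "x $ 2 \<le> 2" | "x $ 2 = - 1" "- 1 \<le> x $ 1" "x $ 1 \<le> 2"
      | "x $ 1 + x $ 2 = 1" "- 1 \<le> x $ 1" "x $ 1 \<le> 2"
      by (auto simp: triangle_gauge_def max_def split: if_splits)
    then show "x \<in> T"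
    proof cases
      case 1
      have "x = edge_point w 2 ((2 - x $ 2) / 3)"
        using 1 x by (simp add: edge_point_def w_def triangle_at_def vec_eq_iff forall_3 field_simps)
      moreover have "(2 - x $ 2) / 3 \<in> {0..1}" using 1 by simp
      ultimately show ?thesis
        unfolding T_def polygon_set_def edge_eq_image by (intro UN_I[of 2] image_eqI) auto
    next
      case 2
      have "x = edge_point w 0 ((x $ 1 + 1) / 3)"
        using 2 x by (simp add: edge_point_def w_def triangle_at_def vec_eq_iff forall_3 field_simps)
      moreover have "(x $ 1 + 1) / 3 \<in> {0..1}" using 2 by simp
      ultimately show ?thesis
        unfolding T_def polygon_set_def edge_eq_image by (intro UN_I[of 0] image_eqI) auto
    next
      case 3
      have "x = edge_point w 1 ((2 - x $ 1) / 3)"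
        using 3 x by (simp add: edge_point_def w_def triangle_at_def vec_eq_iff forall_3 field_simps)
      moreover have "(2 - x $ 1) / 3 \<in> {0..1}" using 3 by simp
      ultimately show ?thesis
        unfolding T_def polygon_set_def edge_eq_image by (intro UN_I[of 1] image_eqI) auto
    qed
  qed
  have circle: "x \<in> {x. (x $ 1)\<^sup>2 + (x $ 2)\<^sup>2 = 1 \<and> x $ 3 = 0} \<longleftrightarrow> norm (shadow x) = 1 \<and> x $ 3 = 0" for x :: space
    by (simp add: norm_shadow real_sqrt_eq_1_iff)
  have end1: "radial_isotopy (1, x) = (triangle_gauge x / norm (shadow x)) *\<^sub>R shadow x" if "x $ 3 = 0" for x
  proof -
    have "shadow x = x" using that by (auto simp: vec_eq_iff forall_3)
    then show ?thesis by (simp add: radial_isotopy_eq radial_factor_def algebra_simps)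
  qed
  have "(\<lambda>x. radial_isotopy (1, x)) ` T = {x. (x $ 1)\<^sup>2 + (x $ 2)\<^sup>2 = 1 \<and> x $ 3 = 0}"
  proof
    show "(\<lambda>x. radial_isotopy (1, x)) ` T \<subseteq> {x. (x $ 1)\<^sup>2 + (x $ 2)\<^sup>2 = 1 \<and> x $ 3 = 0}"
    proof
      fix y assume "y \<in> (\<lambda>x. radial_isotopy (1, x)) ` T"
      then obtain x where x: "triangle_gauge x = 1" "x $ 3 = 0" "y = radial_isotopy (1, x)"
        using mem by auto
      have "shadow x \<noteq> 0" using x(1) by (auto simp: triangle_gauge_def shadow_eq_0_iff)
      moreover have y: "y = (1 / norm (shadow x)) *\<^sub>R shadow x" using x end1 by simp
      moreover have "shadow y = y" unfolding y by (auto simp: vec_eq_iff forall_3)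
      ultimately have "norm (shadow y) = 1 \<and> y $ 3 = 0" by simp
      then show "y \<in> {x. (x $ 1)\<^sup>2 + (x $ 2)\<^sup>2 = 1 \<and> x $ 3 = 0}" using circle by blast
    qed
  next
    show "{x. (x $ 1)\<^sup>2 + (x $ 2)\<^sup>2 = 1 \<and> x $ 3 = 0} \<subseteq> (\<lambda>x. radial_isotopy (1, x)) ` T"
    proof
      fix y :: space assume "y \<in> {x. (x $ 1)\<^sup>2 + (x $ 2)\<^sup>2 = 1 \<and> x $ 3 = 0}"
      then have y: "norm (shadow y) = 1" "y $ 3 = 0" using circle by blast+
      then have sy: "shadow y = y" by (auto simp: vec_eq_iff forall_3)
      have g: "triangle_gauge y > 0" using y by (intro triangle_gauge_pos) auto
      define x where "x = (1 / triangle_gauge y) *\<^sub>R y"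
      have x: "triangle_gauge x = 1" "x $ 3 = 0"
        using g y triangle_gauge_scaleR[of "1 / triangle_gauge y" y] by (auto simp: x_def)
      have sx: "shadow x = x" using x by (auto simp: vec_eq_iff forall_3)
      have "radial_isotopy (1, x) = (1 / norm x) *\<^sub>R x" using end1[OF x(2)] x(1) sx by simp
      also have "\<dots> = y" using g y sy by (simp add: x_def)
      finally show "y \<in> (\<lambda>x. radial_isotopy (1, x)) ` T" using mem x by (metis image_eqI)
    qed
  qed
  moreover have "continuous_on (Sigma {0..1} (\<lambda>_. UNIV)) radial_isotopy"
    using continuous_on_subset[OF continuous_on_radial_isotopy] by blast
  moreover have "radial_isotopy (0, x) = x" for x by (simp add: radial_isotopy_def)
  ultimately show ?thesis
    unfolding trivial_knot_def ambient_isotopic_def w_def[symmetric] T_def[symmetric]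
    by (intro exI[of _ radial_isotopy]) (auto intro!: homeomorphism_radial_isotopy)
qed

lemma triangle_trivial:
  assumes v: "simple_polygon 3 v" and K: "ambient_isotopic K (polygon_set 3 v)"
  shows "trivial_knot K"
proof -
  define x y where "x = v 1 - v 0" and "y = v 2 - v 0"
  define p :: space where "p = vector [-1, -1, 0]"
  define x' y' :: space where "x' = vector [3, 0, 0]" and "y' = vector [0, 3, 0]"
  have "x \<times> y \<noteq> 0" unfolding x_def y_def by (rule simple_triangle_independent[OF v])
  moreover have "x' \<times> y' \<noteq> 0"
    by (simp add: x'_def y'_def cross3_def vec_eq_iff forall_3)
  ultimately have 1: "ambient_isotopic (polygon_set 3 (triangle_at p x y)) (polygon_set 3 (triangle_at p x' y'))"
    by (rule triangles_isotopic)
  have "polygon_set 3 (triangle_at p x y) = polygon_set 3 (\<lambda>i. (p - v 0) + v i)"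
    using simple_polygonD(3)[OF v]
    by (auto simp: polygon_set_def edge_def triangle_at_def x_def y_def numeral_eq_Suc lessThan_Suc algebra_simps)
  then have "ambient_isotopic (polygon_set 3 v) (polygon_set 3 (triangle_at p x y))"
    using simple_polygon_translate(2)[OF v, of "p - v 0"] ambient_isotopic_translation by simp
  then have "ambient_isotopic K (polygon_set 3 (triangle_at p x' y'))"
    using 1 K ambient_isotopic_trans by blast
  then show ?thesis
    using standard_triangle_trivial ambient_isotopic_trans
    unfolding trivial_knot_def p_def x'_def y'_def by blast
qed

section \<open>The bound\<close>

theorem theorem4:
  fixes K :: "(real ^ 3) set" and c s :: real
  assumes "knot K" and "tame K"
  defines "c \<equiv> real (crossing_number K)" and "s \<equiv> real (polygon_index K)"
  shows "c \<le> (s - 3) * (s - 4) / 2 \<and>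
         2 * c \<le> s\<^sup>2 - 7 * s + 12 \<and>
         s\<^sup>2 - 7 * s + 12 = (s - 7 / 2)\<^sup>2 - 1 / 4 \<and>
         (\<not> trivial_knot K \<longrightarrow> (7 + sqrt (8 * c + 1)) / 2 \<le> s)"
proof -
  define n where "n = polygon_index K"
  have "polygonal_realization K n"
    using \<open>tame K\<close> unfolding tame_def n_def polygon_index_def by (rule LeastI_ex)
  then obtain v where v: "simple_polygon n v" "ambient_isotopic K (polygon_set n v)"
    unfolding polygonal_realization_def polygon_with_edges_iff by blast
  have n: "3 \<le> n" using simple_polygonD[OF v(1)] by auto
  obtain m where m: "projection_with_crossings K m" "2 * m \<le> (n - 3) * (n - 4)"
    using polygon_diagram[OF v] by blast
  have "crossing_number K \<le> m"
    unfolding crossing_number_def using m(1) by (rule Least_le)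
  then have "2 * crossing_number K \<le> (n - 3) * (n - 4)" using m(2) by linarith
  then have "real (2 * crossing_number K) \<le> real ((n - 3) * (n - 4))" by (rule of_nat_mono)
  moreover have "real ((n - 3) * (n - 4)) = (s - 3) * (s - 4)"
    using n by (cases "n = 3") (auto simp: s_def n_def[symmetric] of_nat_diff)
  ultimately have bound: "2 * c \<le> (s - 3) * (s - 4)" by (simp add: c_def)
  have square: "(s - 3) * (s - 4) = s\<^sup>2 - 7 * s + 12" "s\<^sup>2 - 7 * s + 12 = (s - 7 / 2)\<^sup>2 - 1 / 4"
    by (simp_all add: power2_eq_square algebra_simps)
  have "(7 + sqrt (8 * c + 1)) / 2 \<le> s" if nontrivial: "\<not> trivial_knot K"
  proof -
    have "n \<noteq> 3" using triangle_trivial v nontrivial by blast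
    then have "s \<ge> 4" using n by (simp add: s_def n_def[symmetric])
    have "8 * c + 1 \<le> (2 * s - 7)\<^sup>2"
      using bound by (simp add: power2_eq_square algebra_simps)
    then have "sqrt (8 * c + 1) \<le> 2 * s - 7"
      using \<open>s \<ge> 4\<close> by (intro real_le_lsqrt) (auto simp: c_def)
    then show ?thesis by simp
  qed
  then show ?thesis using bound square by auto
qed

end
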